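(* For any polynomial-time computable function $\alpha(|V|)$, the optimization problem $(\mathbf{MSP})$ is not $\alpha(|V|)$-approximable unless $\mathbf{P}=\mathbf{NP}$. This holds even when restricted to instances with $m=1$, $w(e)=1$ for all $e\in E$, and $a=\infty$.
   Context: Modal Split Problem: data. A directed, weighted graph $G=(V,E,w)$ with $w:E\to\mathbb{N}_{>0}$; a budget $B$; a demand $D:V^2\to\mathbb{N}_{\ge 0}$ with $D(v,v)=0$; a number $m$ of public transportation modes; and for each mode $i=0,\dots,m$ a travel time $\tau_i$, an energy consumption $\eta_i$, a cost $c_i$ (all nonnegative, per unit of distance, the last two per vehicle) and a positive capacity $k_i$ per vehicle. Mode $0$ is private transport, with $c_0=0$ and $k_0=1$; it is allowed on every edge without capacity constraint. For complexity purposes all numbers in an instance are rationals encoded in binary. The commodities are $K=\{(s,t)\in V^2: D(s,t)>0\}$. A layout is a map $L:E\to\mathbb{N}^m$ (with $0\in\mathbb{N}$); it is feasible if $\sum_{e}w(e)\sum_{i=1}^m c_iL(e)_i\le B$. For each $\kappa=(s,t)\in K$, a flow is a map $F_\kappa:E\to\mathbb{R}_{\ge 0}$ such that for every $v$ the inflow minus the outflow, $\sum_{e\in \mathrm{in}(v)}F_\kappa(e)-\sum_{e\in \mathrm{out}(v)}F_\kappa(e)$, equals $0$ if $v\ne s,t$, equals $D(s,t)$ if $v=t$, and equals $-D(s,t)$ if $v=s$. A modal split consists of maps $M_\kappa:E\to[0,1]^{m+1}$, $\kappa\in K$, with $\sum_{i=0}^m M_\kappa(e)_i=1$ for all $e$;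 it is feasible if $\sum_{\kappa\in K}F_\kappa(e)M_\kappa(e)_i\le k_iL(e)_i$ for all $e\in E$ and $i=1,\dots,m$. Put $F(e)=\sum_\kappa F_\kappa(e)$ and $M(e)_i=\frac{1}{F(e)}\sum_\kappa F_\kappa(e)M_\kappa(e)_i$ if $F(e)>0$, and $M(e)=(1,0,\dots,0)$ otherwise. A feasible solution is a triple $(F,L,M)$ of flows, a feasible layout and a feasible modal split. Total travel time: $\mathrm{T}(F,L,M)=\sum_e w(e)\sum_{i=0}^m\tau_iF(e)M(e)_i$. Total energy consumption: $\mathrm{H}(F,L,M)=\sum_e w(e)\bigl(\eta_0F(e)M(e)_0+\sum_{i=1}^m\eta_iL(e)_i\bigr)$. Optimization problem $(\mathbf{MSP})$. Instance: a directed, weighted graph $G=(V,E,w)$ with $w:E\to\mathbb{N}_{>0}$, a budget $B$, a demand $D:V^2\to\mathbb{N}_{\ge 0}$ with $D(v,v)=0$, a number $m$ of public transportation modes, and mode data $\tau_i,\eta_i,c_i\ge 0$, $k_i>0$ for $i=0,\dots,m$ with $c_0=0$ and $k_0=1$, together with a bound $a\ge 0$ (or $a=\infty$, meaning that $\mathrm{T}$ is not bounded). Task: find a feasible solution $(F,L,M)$ with $\mathrm{T}(F,L,M)\le a$ and $\mathrm{H}(F,L,M)$ minimal. A feasible solution $X$ is an $\alpha$-approximation for an instance if $\mathrm{T}(X)\le a$ and $\mathrm{H}(X)\le\alpha\,\mathrm{H}^*$, where $\mathrm{H}^*$ is the minimal value of $\mathrm{H}$ among all feasible solutions with $\mathrm{T}\le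 a$. $(\mathbf{MSP})$ is $\alpha$-approximable if there is a polynomial-time algorithm that computes an $\alpha$-approximation for each instance; $\alpha$ may be a constant or a function of the parameters. *)

theory Defs
  imports Complex_Main "HOL-Computational_Algebra.Polynomial"
begin

section \<open>Polynomial time on multi-tape Turing machines\<close>

text \<open>
  Deterministic Turing machines with finitely many two-way infinite tapes. States are the numbers
  below \<open>num_states\<close>, the start state is \<open>0\<close> and the halting state is \<open>num_states\<close> itself.
  Tape symbols are the numbers below \<open>num_symbols\<close>: \<open>0\<close> is the blank, \<open>1\<close> and \<open>2\<close> are the input
  bits, further symbols are working symbols. Well-formedness confines the transition function to a
  finite domain and range, so that it is a finite table; its values elsewhere are never used.
\<close>

datatype direction = MoveLeft | Stay | MoveRight

record tm =
  num_tapes :: nat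
  num_states :: nat
  num_symbols :: nat
  delta :: "nat \<Rightarrow> nat list \<Rightarrow> nat \<times> (nat \<times> direction) list"

definition wf_tm :: "tm \<Rightarrow> bool" where
  "wf_tm M \<longleftrightarrow> num_tapes M \<ge> 2 \<and> num_symbols M \<ge> 3 \<and>
     (\<forall>q < num_states M. \<forall>s. length s = num_tapes M \<longrightarrow> set s \<subseteq> {..<num_symbols M} \<longrightarrow>
        fst (delta M q s) \<le> num_states M \<and>
        length (snd (delta M q s)) = num_tapes M \<and>
        fst ` set (snd (delta M q s)) \<subseteq> {..<num_symbols M})"

type_synonym tape = "(int \<Rightarrow> nat) \<times> int"
type_synonym config = "nat \<times> tape list"

fun move :: "direction \<Rightarrow> int \<Rightarrow> int" where
  "move MoveLeft h = h - 1"
| "move Stay h = h"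
| "move MoveRight h = h + 1"

definition read_tape :: "tape \<Rightarrow> nat" where
  "read_tape t = fst t (snd t)"

definition act_tape :: "tape \<Rightarrow> nat \<times> direction \<Rightarrow> tape" where
  "act_tape t a = ((fst t)(snd t := fst a), move (snd a) (snd t))"

definition tm_step :: "tm \<Rightarrow> config \<Rightarrow> config" where
  "tm_step M c =
     (if fst c < num_states M
      then (let r = delta M (fst c) (map read_tape (snd c))
            in (fst r, map2 act_tape (snd c) (snd r)))
      else c)"

text \<open>The tape inscription holding the word \<open>x\<close> in cells \<open>0, 1, \<dots>\<close> and blanks everywhere else.\<close>

definition inscription :: "bool list \<Rightarrow> int \<Rightarrow> nat" where
  "inscription x i = (if 0 \<le> i \<and> i < int (length x) then (if x ! nat i then 2 else 1) else 0)"

definition init_config :: "tm \<Rightarrow> bool list \<Rightarrow> config" where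
  "init_config M x =
     (0, (inscription x, 0) # replicate (num_tapes M - 1) (inscription [], 0))"

text \<open>
  The input is on tape 0, the output on tape 1. Halting configurations are fixed points of
  \<open>tm_step\<close>, so the following says that \<open>M\<close> halts on \<open>x\<close> after at most \<open>t\<close> steps with output \<open>y\<close>.
\<close>

definition outputs_within :: "tm \<Rightarrow> bool list \<Rightarrow> bool list \<Rightarrow> nat \<Rightarrow> bool" where
  "outputs_within M x y t \<longleftrightarrow>
     (let c = (tm_step M ^^ t) (init_config M x)
      in fst c = num_states M \<and> fst (snd c ! 1) = inscription y)"

definition class_P :: "bool list set set" where
  "class_P = {A. \<exists>M (p :: nat poly). wf_tm M \<and>
     (\<forall>x. outputs_within M x [x \<in> A] (poly p (length x)))}"

text \<open>An injective pairing of words: the bits of \<open>x\<close> are doubled, followed by a separator.\<close>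

definition pair_word :: "bool list \<Rightarrow> bool list \<Rightarrow> bool list" where
  "pair_word x y = concat (map (\<lambda>b. [b, b]) x) @ [False, True] @ y"

definition class_NP :: "bool list set set" where
  "class_NP = {A. \<exists>R \<in> class_P. \<exists>p :: nat poly. \<forall>x.
     x \<in> A \<longleftrightarrow> (\<exists>y. length y \<le> poly p (length x) \<and> pair_word x y \<in> R)}"


section \<open>Binary encodings\<close>

text \<open>Least significant bit first.\<close>

fun bin_digits :: "nat \<Rightarrow> bool list" where
  "bin_digits n = (if n = 0 then [] else odd n # bin_digits (n div 2))"

declare bin_digits.simps [simp del]

text \<open>
  Every element is announced by \<open>True\<close> and the end of the list is marked by \<open>False\<close>. This is a
  prefix code whenever the encoding of the elements is one, so that encodings can be
  concatenated without ambiguity.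
\<close>

definition enc_list :: "('a \<Rightarrow> bool list) \<Rightarrow> 'a list \<Rightarrow> bool list" where
  "enc_list f xs = concat (map (\<lambda>x. True # f x) xs) @ [False]"

definition enc_nat :: "nat \<Rightarrow> bool list" where
  "enc_nat n = enc_list (\<lambda>b. [b]) (bin_digits n)"

definition enc_rat :: "rat \<Rightarrow> bool list" where
  "enc_rat r = (let (a, b) = quotient_of r
                in [a < 0] @ enc_nat (nat \<bar>a\<bar>) @ enc_nat (nat b))"

text \<open>
  For a function of a graph parameter, polynomial time means polynomial in the value \<open>n\<close> of the
  argument (here \<open>|V|\<close>), hence the argument is given in unary. This admits for instance
  \<open>n \<mapsto> 2 ^ n\<close>, and every function computable in time polynomial in the binary length of \<open>n\<close>.
\<close>

definition polytime_computable :: "(nat \<Rightarrow> rat) \<Rightarrow> bool" where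
  "polytime_computable \<alpha> \<longleftrightarrow> (\<exists>M (p :: nat poly). wf_tm M \<and>
     (\<forall>n. outputs_within M (replicate n True) (enc_rat (\<alpha> n)) (poly p n)))"


section \<open>The Modal Split Problem\<close>

text \<open>
  The vertex set is \<open>{0, \<dots>, num_vertices - 1}\<close>. The values of \<open>weight\<close> outside \<open>edges\<close>, of
  \<open>demand\<close> outside the vertex pairs, and of the mode data beyond index \<open>num_modes\<close> are irrelevant.
  The time bound \<open>None\<close> stands for \<open>\<infinity>\<close>.
\<close>

type_synonym edge = "nat \<times> nat"

record msp =
  num_vertices :: nat
  edges :: "edge set"
  weight :: "edge \<Rightarrow> nat"
  budget :: rat
  demand :: "nat \<times> nat \<Rightarrow> nat"
  num_modes :: nat
  tau :: "nat \<Rightarrow> rat"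
  eta :: "nat \<Rightarrow> rat"
  cost :: "nat \<Rightarrow> rat"
  cap :: "nat \<Rightarrow> rat"
  time_bound :: "rat option"

definition vertices :: "msp \<Rightarrow> nat set" where
  "vertices I = {..<num_vertices I}"

definition msp_instance :: "msp \<Rightarrow> bool" where
  "msp_instance I \<longleftrightarrow>
     edges I \<subseteq> vertices I \<times> vertices I \<and>
     (\<forall>e \<in> edges I. weight I e > 0) \<and>
     (\<forall>v \<in> vertices I. demand I (v, v) = 0) \<and>
     (\<forall>i \<le> num_modes I. tau I i \<ge> 0 \<and> eta I i \<ge> 0 \<and> cost I i \<ge> 0 \<and> cap I i > 0) \<and>
     cost I 0 = 0 \<and> cap I 0 = 1 \<and>
     (case time_bound I of None \<Rightarrow> True | Some a \<Rightarrow> a \<ge> 0)"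

definition commodities :: "msp \<Rightarrow> (nat \<times> nat) set" where
  "commodities I = {\<kappa> \<in> vertices I \<times> vertices I. demand I \<kappa> > 0}"

type_synonym flows = "nat \<times> nat \<Rightarrow> edge \<Rightarrow> real"
type_synonym layout = "edge \<Rightarrow> nat \<Rightarrow> nat"
type_synonym modal_split = "nat \<times> nat \<Rightarrow> edge \<Rightarrow> nat \<Rightarrow> real"

definition feasible_layout :: "msp \<Rightarrow> layout \<Rightarrow> bool" where
  "feasible_layout I L \<longleftrightarrow>
     (\<Sum>e\<in>edges I. real (weight I e) * (\<Sum>i=1..num_modes I. of_rat (cost I i) * real (L e i)))
       \<le> of_rat (budget I)"

definition is_flow :: "msp \<Rightarrow> nat \<times> nat \<Rightarrow> (edge \<Rightarrow> real) \<Rightarrow> bool" where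
  "is_flow I \<kappa> f \<longleftrightarrow>
     (\<forall>e \<in> edges I. f e \<ge> 0) \<and>
     (\<forall>v \<in> vertices I.
        (\<Sum>e | e \<in> edges I \<and> snd e = v. f e) - (\<Sum>e | e \<in> edges I \<and> fst e = v. f e) =
        (if v = snd \<kappa> then real (demand I \<kappa>)
         else if v = fst \<kappa> then - real (demand I \<kappa>)
         else 0))"

definition is_modal_split :: "msp \<Rightarrow> modal_split \<Rightarrow> bool" where
  "is_modal_split I M \<longleftrightarrow>
     (\<forall>\<kappa> \<in> commodities I. \<forall>e \<in> edges I.
        (\<forall>i \<le> num_modes I. 0 \<le> M \<kappa> e i \<and> M \<kappa> e i \<le> 1) \<and>
        (\<Sum>i=0..num_modes I. M \<kappa> e i) = 1)"

definition feasible_split :: "msp \<Rightarrow> flows \<Rightarrow> layout \<Rightarrow> modal_split \<Rightarrow> bool" where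
  "feasible_split I F L M \<longleftrightarrow>
     is_modal_split I M \<and>
     (\<forall>e \<in> edges I. \<forall>i \<in> {1..num_modes I}.
        (\<Sum>\<kappa>\<in>commodities I. F \<kappa> e * M \<kappa> e i) \<le> of_rat (cap I i) * real (L e i))"

definition feasible :: "msp \<Rightarrow> flows \<Rightarrow> layout \<Rightarrow> modal_split \<Rightarrow> bool" where
  "feasible I F L M \<longleftrightarrow>
     (\<forall>\<kappa> \<in> commodities I. is_flow I \<kappa> (F \<kappa>)) \<and> feasible_layout I L \<and> feasible_split I F L M"

definition total_flow :: "msp \<Rightarrow> flows \<Rightarrow> edge \<Rightarrow> real" where
  "total_flow I F e = (\<Sum>\<kappa>\<in>commodities I. F \<kappa> e)"

definition total_split :: "msp \<Rightarrow> flows \<Rightarrow> modal_split \<Rightarrow> edge \<Rightarrow> nat \<Rightarrow> real" where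
  "total_split I F M e i =
     (if total_flow I F e > 0
      then 1 / total_flow I F e * (\<Sum>\<kappa>\<in>commodities I. F \<kappa> e * M \<kappa> e i)
      else if i = 0 then 1 else 0)"

definition travel_time :: "msp \<Rightarrow> flows \<Rightarrow> layout \<Rightarrow> modal_split \<Rightarrow> real" where
  "travel_time I F L M =
     (\<Sum>e\<in>edges I. real (weight I e) *
        (\<Sum>i=0..num_modes I. of_rat (tau I i) * total_flow I F e * total_split I F M e i))"

definition energy :: "msp \<Rightarrow> flows \<Rightarrow> layout \<Rightarrow> modal_split \<Rightarrow> real" where
  "energy I F L M =
     (\<Sum>e\<in>edges I. real (weight I e) *
        (of_rat (eta I 0) * total_flow I F e * total_split I F M e 0 +
         (\<Sum>i=1..num_modes I. of_rat (eta I i) * real (L e i))))"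

definition admissible :: "msp \<Rightarrow> flows \<Rightarrow> layout \<Rightarrow> modal_split \<Rightarrow> bool" where
  "admissible I F L M \<longleftrightarrow>
     feasible I F L M \<and>
     (case time_bound I of None \<Rightarrow> True | Some a \<Rightarrow> travel_time I F L M \<le> of_rat a)"

text \<open>Energies are nonnegative; the infimum is meaningful whenever \<open>I\<close> has an admissible solution.\<close>

definition opt_energy :: "msp \<Rightarrow> real" where
  "opt_energy I = Inf {energy I F L M | F L M. admissible I F L M}"

definition is_approximation ::
    "msp \<Rightarrow> rat \<Rightarrow> flows \<Rightarrow> layout \<Rightarrow> modal_split \<Rightarrow> bool" where
  "is_approximation I \<alpha> F L M \<longleftrightarrow>
     admissible I F L M \<and> energy I F L M \<le> of_rat \<alpha> * opt_energy I"


section \<open>Encoding and approximability\<close>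

text \<open>Vertex pairs, edges and commodities are listed in lexicographic order.\<close>

definition vertex_pairs :: "msp \<Rightarrow> (nat \<times> nat) list" where
  "vertex_pairs I = List.product [0..<num_vertices I] [0..<num_vertices I]"

definition edge_list :: "msp \<Rightarrow> edge list" where
  "edge_list I = filter (\<lambda>e. e \<in> edges I) (vertex_pairs I)"

definition commodity_list :: "msp \<Rightarrow> (nat \<times> nat) list" where
  "commodity_list I = filter (\<lambda>\<kappa>. \<kappa> \<in> commodities I) (vertex_pairs I)"

text \<open>The number of modes is recorded as the length of the list of mode data.\<close>

definition enc_msp :: "msp \<Rightarrow> bool list" where
  "enc_msp I =
     enc_nat (num_vertices I) @
     enc_list (\<lambda>e. enc_nat (fst e) @ enc_nat (snd e) @ enc_nat (weight I e)) (edge_list I) @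
     enc_rat (budget I) @
     enc_list (\<lambda>\<kappa>. enc_nat (demand I \<kappa>)) (vertex_pairs I) @
     enc_list (\<lambda>i. enc_rat (tau I i) @ enc_rat (eta I i) @ enc_rat (cost I i) @ enc_rat (cap I i))
       [0..<Suc (num_modes I)] @
     (case time_bound I of None \<Rightarrow> [False] | Some a \<Rightarrow> True # enc_rat a)"

text \<open>Only solutions with rational entries can be written down by an algorithm.\<close>

definition enc_solution ::
    "msp \<Rightarrow> (nat \<times> nat \<Rightarrow> edge \<Rightarrow> rat) \<Rightarrow> layout \<Rightarrow> (nat \<times> nat \<Rightarrow> edge \<Rightarrow> nat \<Rightarrow> rat) \<Rightarrow> bool list" where
  "enc_solution I F L M =
     enc_list (\<lambda>\<kappa>. enc_list (\<lambda>e. enc_rat (F \<kappa> e)) (edge_list I)) (commodity_list I) @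
     enc_list (\<lambda>e. enc_list (\<lambda>i. enc_nat (L e i)) [1..<Suc (num_modes I)]) (edge_list I) @
     enc_list (\<lambda>\<kappa>. enc_list (\<lambda>e. enc_list (\<lambda>i. enc_rat (M \<kappa> e i)) [0..<Suc (num_modes I)])
       (edge_list I)) (commodity_list I)"

text \<open>
  Approximability of the problem restricted to the instances in \<open>C\<close>. The algorithm has to halt in
  polynomial time on all of them. An instance without admissible solution has no approximation at
  all; on such instances the output is arbitrary.
\<close>

definition msp_approximable :: "msp set \<Rightarrow> (nat \<Rightarrow> rat) \<Rightarrow> bool" where
  "msp_approximable C \<alpha> \<longleftrightarrow>
     (\<exists>A (p :: nat poly). wf_tm A \<and>
        (\<forall>I \<in> C. \<exists>out.
           outputs_within A (enc_msp I) out (poly p (length (enc_msp I))) \<and>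
           ((\<exists>F L M. admissible I F L M) \<longrightarrow>
              (\<exists>F L M. out = enc_solution I F L M \<and>
                 is_approximation I (\<alpha> (card (vertices I)))
                   (\<lambda>\<kappa> e. of_rat (F \<kappa> e)) L (\<lambda>\<kappa> e i. of_rat (M \<kappa> e i))))))"

end

theory Submission
  imports Defs
begin

text \<open>
  With one mode of public transport that is free of energy and a budget that just suffices for the
  necessary edges, the optimum is \<open>0\<close> iff the demands can be served by public transport alone, and
  then every approximation has energy \<open>0\<close>, whatever the factor. A directed graph of depth two
  encodes set cover in this way, and hence satisfiability: the sets are the literals, the elements
  are the clauses and the tautologies \<open>x \<or> \<not> x\<close>, and there are as many sets to be chosen as there
  are variables. Clauses describe an accepting computation of a verifier as in the Cook-Levin
  theorem; they become uniform if the tapes are shifted under fixed heads and the state is kept on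
  an additional tape. All that an algorithm for the problem still needs in order to decide a
  language in NP are the construction of the instance and a test whether a solution has energy \<open>0\<close>.
  The former is written in a small language of expressions and bounded loops, compiled to Turing
  machines whose counters are head positions; the latter is a finite state transducer followed by
  another program of this language.
\<close>

section \<open>Composition of machines\<close>


text \<open>Set cover fits because a vehicle on an edge is paid once however many commodities share
  it, just as a chosen set is shared by its elements; the tautologies turn a bound on the number of
  chosen literals into consistency. Two requirements shape the construction. An approximation
  algorithm promises a solution only if an admissible one exists, so the instance must have one even
  if the formula is unsatisfiable; hence every active clause keeps a literal inside the grid. And
  the instance is printed by loops in the order of the encoding, so the vertices fill a complete box
  of coordinates, with isolated vertices as padding and a direct edge from the source to each
  element whose clause is switched off at its place. The tableau clauses lead from correct contents
  to correct contents; marks of further symbols do no harm, so uniqueness of symbols is not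
  expressed. Unary counters are affordable because all numbers of the instance, such as vertex
  names, budget and capacity, are polynomial in the length of the word.\<close>

datatype machine =
  Machine (states: nat) (trans: "nat \<Rightarrow> (nat \<Rightarrow> nat) \<Rightarrow> nat \<times> (nat \<Rightarrow> nat \<times> direction)")

definition reads :: "(nat \<Rightarrow> tape) \<Rightarrow> nat \<Rightarrow> nat" where
  "reads T j = read_tape (T j)"

definition acts :: "(nat \<Rightarrow> tape) \<Rightarrow> (nat \<Rightarrow> nat \<times> direction) \<Rightarrow> nat \<Rightarrow> tape" where
  "acts T a j = act_tape (T j) (a j)"

text \<open>All natural numbers index tapes and a machine acts on all of them at once, so combining
  machines needs no bookkeeping of tape lists; \<open>wf_m\<close> later cuts this down to finitely
  many tapes.\<close>

inductive exec :: "machine \<Rightarrow> nat \<Rightarrow> (nat \<Rightarrow> tape) \<Rightarrow> (nat \<Rightarrow> tape) \<Rightarrow> nat \<Rightarrow> bool" for m where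
  exec_halt: "exec m (states m) T T 0"
| exec_step: "q < states m \<Longrightarrow>
    exec m (fst (trans m q (reads T))) (acts T (snd (trans m q (reads T)))) T' t \<Longrightarrow>
    exec m q T T' (Suc t)"

text \<open>An upper bound instead of the exact time allows costs to be rounded up to a common
  polynomial.\<close>

definition runs :: "machine \<Rightarrow> (nat \<Rightarrow> tape) \<Rightarrow> (nat \<Rightarrow> tape) \<Rightarrow> nat \<Rightarrow> bool" where
  "runs m T T' t \<longleftrightarrow> (\<exists>t'\<le>t. exec m 0 T T' t')"

lemma runs_mono: "runs m T T' t \<Longrightarrow> t \<le> t' \<Longrightarrow> runs m T T' t'"
  unfolding runs_def using le_trans by blast

text \<open>
  Machines are combined by embedding their states along \<open>h\<close>; the halting state of the embedded
  machine becomes the entry point of whatever follows.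
\<close>

lemma exec_relabel:
  assumes "exec m q T T1 t1"
    and "\<And>q s. q < states m \<Longrightarrow> h q < states m' \<and>
      trans m' (h q) s = (h (fst (trans m q s)), snd (trans m q s))"
    and "exec m' (h (states m)) T1 T2 t2"
  shows "exec m' (h q) T T2 (t1 + t2)"
  using assms(1,3)
proof (induction rule: exec.induct)
  case (exec_halt T)
  then show ?case by simp
next
  case (exec_step q T T' t)
  then show ?case using assms(2)[of q "reads T"]
    by (auto intro!: exec.exec_step)
qed

text \<open>The halting state of \<open>m1\<close> has the number of the shifted start state of
  \<open>m2\<close>, so no step is spent on gluing.\<close>

definition seq :: "machine \<Rightarrow> machine \<Rightarrow> machine" where
  "seq m1 m2 = Machine (states m1 + states m2) (\<lambda>q s.
     if q < states m1 then trans m1 q s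
     else (fst (trans m2 (q - states m1) s) + states m1, snd (trans m2 (q - states m1) s)))"

abbreviation stay :: "(nat \<Rightarrow> nat) \<Rightarrow> nat \<Rightarrow> nat \<times> direction" where
  "stay s \<equiv> \<lambda>j. (s j, Stay)"

text \<open>State \<open>0\<close> tests the symbol on tape \<open>j\<close>; \<open>m1\<close>
  follows with shift 1 and \<open>m2\<close> with shift \<open>n1 + 1\<close>. The halting state of
  \<open>m1\<close> would collide with the start of \<open>m2\<close>, hence \<open>h\<close>
  redirects it to the common exit; the entry \<open>h 0\<close> also covers an \<open>m1\<close>
  without states.\<close>

definition cond :: "nat \<Rightarrow> (nat \<Rightarrow> bool) \<Rightarrow> machine \<Rightarrow> machine \<Rightarrow> machine" where
  "cond j P m1 m2 =
     (let n1 = states m1; n = n1 + states m2 + 1; h = (\<lambda>q. if q = n1 then n else q + 1)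
      in Machine n (\<lambda>q s.
        if q = 0 then (if P (s j) then h 0 else n1 + 1, stay s)
        else if q \<le> n1 then (h (fst (trans m1 (q - 1) s)), snd (trans m1 (q - 1) s))
        else (fst (trans m2 (q - n1 - 1) s) + (n1 + 1), snd (trans m2 (q - n1 - 1) s))))"

definition loop :: "nat \<Rightarrow> (nat \<Rightarrow> bool) \<Rightarrow> machine \<Rightarrow> machine" where
  "loop j P m =
     (let n = states m; h = (\<lambda>q. if q = n then 0 else q + 1)
      in Machine (n + 1) (\<lambda>q s.
        if q = 0 then (if P (s j) then h 0 else n + 1, stay s)
        else (h (fst (trans m (q - 1) s)), snd (trans m (q - 1) s))))"

definition act :: "((nat \<Rightarrow> nat) \<Rightarrow> nat \<Rightarrow> nat \<times> direction) \<Rightarrow> machine" where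
  "act f = Machine 1 (\<lambda>q s. (1, f s))"

definition skip :: machine where
  "skip = Machine 0 (\<lambda>q s. (0, stay s))"

lemma seq_simps:
  "states (seq m1 m2) = states m1 + states m2"
  "trans (seq m1 m2) q s = (if q < states m1 then trans m1 q s
     else (fst (trans m2 (q - states m1) s) + states m1, snd (trans m2 (q - states m1) s)))"
  by (simp_all add: seq_def)

lemma cond_simps:
  "states (cond j P m1 m2) = states m1 + states m2 + 1"
  "trans (cond j P m1 m2) q s =
     (if q = 0 then
        (if P (s j) then (if states m1 = 0 then states m1 + states m2 + 1 else 1) else states m1 + 1, stay s)
      else if q \<le> states m1 then
        (if fst (trans m1 (q - 1) s) = states m1 then states m1 + states m2 + 1
         else fst (trans m1 (q - 1) s) + 1, snd (trans m1 (q - 1) s))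
      else (fst (trans m2 (q - states m1 - 1) s) + (states m1 + 1),
            snd (trans m2 (q - states m1 - 1) s)))"
  by (simp_all add: cond_def Let_def)

lemma loop_simps:
  "states (loop j P m) = states m + 1"
  "trans (loop j P m) q s =
     (if q = 0 then (if P (s j) then (if states m = 0 then 0 else 1) else states m + 1, stay s)
      else (if fst (trans m (q - 1) s) = states m then 0 else fst (trans m (q - 1) s) + 1,
            snd (trans m (q - 1) s)))"
  by (simp_all add: loop_def Let_def)

lemma act_simps: "states (act f) = 1" "trans (act f) q s = (1, f s)"
  by (simp_all add: act_def)

lemma acts_stay [simp]: "acts T (stay (reads T)) = T"
  by (auto simp: acts_def fun_eq_iff act_tape_def reads_def read_tape_def prod_eq_iff)

lemma runs_skip: "runs skip T T t"
  using exec_halt[of skip T] by (auto simp: runs_def skip_def)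

lemma runs_act: "runs (act f) T (acts T (f (reads T))) 1"
proof -
  have "exec (act f) 0 T (acts T (f (reads T))) (Suc 0)"
    using exec_halt[of "act f" "acts T (f (reads T))"]
    by (intro exec_step) (auto simp: act_simps)
  then show ?thesis by (auto simp: runs_def)
qed

lemma runs_seq:
  assumes "runs m1 T T1 t1" "runs m2 T1 T2 t2"
  shows "runs (seq m1 m2) T T2 (t1 + t2)"
proof -
  obtain u1 u2 where u: "u1 \<le> t1" "u2 \<le> t2" "exec m1 0 T T1 u1" "exec m2 0 T1 T2 u2"
    using assms by (auto simp: runs_def)
  have "exec (seq m1 m2) (states m2 + states m1) T2 T2 0"
    using exec_halt[of "seq m1 m2" T2] by (simp add: seq_simps add.commute)
  from exec_relabel[OF u(4), of "\<lambda>q. q + states m1" "seq m1 m2", OF _ this]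
  have "exec (seq m1 m2) (states m1) T1 T2 u2" by (auto simp: seq_simps)
  from exec_relabel[OF u(3), of id "seq m1 m2"] this
  have "exec (seq m1 m2) 0 T T2 (u1 + u2)" by (auto simp: seq_simps)
  then show ?thesis using u unfolding runs_def by (meson add_mono)
qed

lemma runs_cond_True:
  assumes "P (reads T j)" "runs m1 T T' t"
  shows "runs (cond j P m1 m2) T T' (Suc t)"
proof -
  obtain u where u: "u \<le> t" "exec m1 0 T T' u" using assms(2) by (auto simp: runs_def)
  let ?h = "\<lambda>q. if q = states m1 then states m1 + states m2 + 1 else q + 1"
  have "exec (cond j P m1 m2) (?h (states m1)) T' T' 0"
    using exec_halt[of "cond j P m1 m2" T'] by (simp add: cond_simps)
  from exec_relabel[OF u(2), of ?h "cond j P m1 m2", OF _ this]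
  have "exec (cond j P m1 m2) (?h 0) T T' u" by (auto simp: cond_simps)
  then have "exec (cond j P m1 m2) 0 T T' (Suc u)"
    using assms(1) by (intro exec_step) (auto simp: cond_simps)
  then show ?thesis using u unfolding runs_def by (meson Suc_le_mono)
qed

lemma runs_cond_False:
  assumes "\<not> P (reads T j)" "runs m2 T T' t"
  shows "runs (cond j P m1 m2) T T' (Suc t)"
proof -
  obtain u where u: "u \<le> t" "exec m2 0 T T' u" using assms(2) by (auto simp: runs_def)
  have "exec (cond j P m1 m2) (states m2 + (states m1 + 1)) T' T' 0"
    using exec_halt[of "cond j P m1 m2" T'] by (simp add: cond_simps ac_simps)
  from exec_relabel[OF u(2), of "\<lambda>q. q + (states m1 + 1)" "cond j P m1 m2", OF _ this]
  have "exec (cond j P m1 m2) (states m1 + 1) T T' u" by (auto simp: cond_simps)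
  then have "exec (cond j P m1 m2) 0 T T' (Suc u)"
    using assms(1) by (intro exec_step) (auto simp: cond_simps)
  then show ?thesis using u unfolding runs_def by (meson Suc_le_mono)
qed

lemma runs_loop_False:
  assumes "\<not> P (reads T j)"
  shows "runs (loop j P m) T T 1"
proof -
  have "exec (loop j P m) (states m + 1) T T 0"
    using exec_halt[of "loop j P m" T] by (simp add: loop_simps)
  then have "exec (loop j P m) 0 T T (Suc 0)"
    using assms(1) by (intro exec_step) (auto simp: loop_simps)
  then show ?thesis by (auto simp: runs_def)
qed

lemma runs_loop_True:
  assumes "P (reads T j)" "runs m T T1 t1" "runs (loop j P m) T1 T2 t2"
  shows "runs (loop j P m) T T2 (t1 + t2 + 1)"
proof -
  obtain u1 u2 where u: "u1 \<le> t1" "u2 \<le> t2" "exec m 0 T T1 u1" "exec (loop j P m) 0 T1 T2 u2"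
    using assms by (auto simp: runs_def)
  let ?h = "\<lambda>q. if q = states m then 0 else q + 1"
  from exec_relabel[OF u(3), of ?h "loop j P m" T2 u2]
  have "exec (loop j P m) (?h 0) T T2 (u1 + u2)" using u(4) by (auto simp: loop_simps)
  then have "exec (loop j P m) 0 T T2 (Suc (u1 + u2))"
    using assms(1) by (intro exec_step) (auto simp: loop_simps)
  then show ?thesis using u unfolding runs_def
    by (intro exI[of _ "Suc (u1 + u2)"]) auto
qed

text \<open>Induction on the number \<open>k\<close> of remaining rounds, backwards from the exit,
  since \<open>runs_loop_True\<close> puts one round in front of a run.\<close>

lemma runs_loop_iter:
  assumes "\<And>i. i < n \<Longrightarrow> P (reads (S i) j) \<and> runs m (S i) (S (Suc i)) b"
    and "\<not> P (reads (S n) j)"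
  shows "runs (loop j P m) (S 0) (S n) (n * (b + 1) + 1)"
proof -
  have "runs (loop j P m) (S (n - k)) (S n) (k * (b + 1) + 1)" if "k \<le> n" for k
    using that
  proof (induction k)
    case 0
    then show ?case using runs_loop_False[of P "S n" j m] assms(2) by simp
  next
    case (Suc k)
    then have "n - Suc k < n" "Suc (n - Suc k) = n - k" by auto
    then have "P (reads (S (n - Suc k)) j)" "runs m (S (n - Suc k)) (S (n - k)) b"
      using assms(1)[of "n - Suc k"] by auto
    moreover have "runs (loop j P m) (S (n - k)) (S n) (k * (b + 1) + 1)" using Suc by simp
    ultimately have "runs (loop j P m) (S (n - Suc k)) (S n) (b + (k * (b + 1) + 1) + 1)"
      by (rule runs_loop_True)
    then show ?case by (rule runs_mono) simp
  qed
  from this[of n] show ?thesis by simp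
qed

section \<open>Finite transition tables; translation to and from Turing machines\<close>

text \<open>The first clause says that the behaviour on the first \<open>K\<close> tapes is
  determined by what is scanned there, the second that symbols and states stay in range: together
  they make the transition function a finite table.\<close>

definition wf_m :: "nat \<Rightarrow> nat \<Rightarrow> machine \<Rightarrow> bool" where
  "wf_m K S m \<longleftrightarrow>
     (\<forall>q < states m. \<forall>s s'. (\<forall>j<K. s j = s' j) \<longrightarrow>
        fst (trans m q s) = fst (trans m q s') \<and>
        (\<forall>j<K. snd (trans m q s) j = snd (trans m q s') j)) \<and>
     (\<forall>q < states m. \<forall>s. (\<forall>j<K. s j < S) \<longrightarrow>
        fst (trans m q s) \<le> states m \<and> (\<forall>j<K. fst (snd (trans m q s) j) < S))"

lemma wf_m_local:
  assumes "wf_m K S m" "q < states m" "\<And>j. j < K \<Longrightarrow> s j = s' j"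
  shows "fst (trans m q s) = fst (trans m q s')"
    and "j < K \<Longrightarrow> snd (trans m q s) j = snd (trans m q s') j"
  using assms unfolding wf_m_def by blast+

lemma wf_m_bound:
  assumes "wf_m K S m" "q < states m" "\<And>j. j < K \<Longrightarrow> s j < S"
  shows "fst (trans m q s) \<le> states m" and "j < K \<Longrightarrow> fst (snd (trans m q s) j) < S"
  using assms unfolding wf_m_def by blast+

lemma wf_mI:
  assumes "\<And>q s s'. q < states m \<Longrightarrow> (\<And>j. j < K \<Longrightarrow> s j = s' j) \<Longrightarrow>
        fst (trans m q s) = fst (trans m q s') \<and>
        (\<forall>j<K. snd (trans m q s) j = snd (trans m q s') j)"
    and "\<And>q s. q < states m \<Longrightarrow> (\<And>j. j < K \<Longrightarrow> s j < S) \<Longrightarrow>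
        fst (trans m q s) \<le> states m \<and> (\<forall>j<K. fst (snd (trans m q s) j) < S)"
  shows "wf_m K S m"
  using assms unfolding wf_m_def by blast

lemma wf_skip: "wf_m K S skip"
  by (auto simp: wf_m_def skip_def)

lemma wf_act:
  assumes "\<forall>s s'. (\<forall>j<K. s j = s' j) \<longrightarrow> (\<forall>j<K. f s j = f s' j)"
    and "\<forall>s. (\<forall>j<K. s j < S) \<longrightarrow> (\<forall>j<K. fst (f s j) < S)"
  shows "wf_m K S (act f)"
  using assms by (auto simp: wf_m_def act_simps)

lemma wf_seq:
  assumes "wf_m K S m1" "wf_m K S m2"
  shows "wf_m K S (seq m1 m2)"
proof (rule wf_mI)
  fix q :: nat and s s' :: "nat \<Rightarrow> nat" assume q: "q < states (seq m1 m2)" and s: "\<And>j. j < K \<Longrightarrow> s j = s' j"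
  show "fst (trans (seq m1 m2) q s) = fst (trans (seq m1 m2) q s') \<and>
        (\<forall>j<K. snd (trans (seq m1 m2) q s) j = snd (trans (seq m1 m2) q s') j)"
    using wf_m_local[OF assms(1), of q s s'] wf_m_local[OF assms(2), of "q - states m1" s s'] q s
    by (auto simp: seq_simps)
next
  fix q :: nat and s :: "nat \<Rightarrow> nat" assume q: "q < states (seq m1 m2)" and s: "\<And>j. j < K \<Longrightarrow> s j < S"
  show "fst (trans (seq m1 m2) q s) \<le> states (seq m1 m2) \<and>
        (\<forall>j<K. fst (snd (trans (seq m1 m2) q s) j) < S)"
    using wf_m_bound[OF assms(1), of q s] wf_m_bound[OF assms(2), of "q - states m1" s] q s
    by (fastforce simp: seq_simps)
qed

lemma wf_cond:
  assumes "wf_m K S m1" "wf_m K S m2" "j < K"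
  shows "wf_m K S (cond j P m1 m2)"
proof (rule wf_mI)
  fix q :: nat and s s' :: "nat \<Rightarrow> nat" assume q: "q < states (cond j P m1 m2)" and s: "\<And>j. j < K \<Longrightarrow> s j = s' j"
  show "fst (trans (cond j P m1 m2) q s) = fst (trans (cond j P m1 m2) q s') \<and>
        (\<forall>i<K. snd (trans (cond j P m1 m2) q s) i = snd (trans (cond j P m1 m2) q s') i)"
    using wf_m_local[OF assms(1), of "q - 1" s s']
      wf_m_local[OF assms(2), of "q - states m1 - 1" s s'] q s assms(3)
    by (auto simp: cond_simps)
next
  fix q :: nat and s :: "nat \<Rightarrow> nat" assume q: "q < states (cond j P m1 m2)" and s: "\<And>j. j < K \<Longrightarrow> s j < S"
  show "fst (trans (cond j P m1 m2) q s) \<le> states (cond j P m1 m2) \<and>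
        (\<forall>i<K. fst (snd (trans (cond j P m1 m2) q s) i) < S)"
    using wf_m_bound[OF assms(1), of "q - 1" s]
      wf_m_bound[OF assms(2), of "q - states m1 - 1" s] q s
    by (fastforce simp: cond_simps)
qed

lemma wf_loop:
  assumes "wf_m K S m" "j < K"
  shows "wf_m K S (loop j P m)"
proof (rule wf_mI)
  fix q :: nat and s s' :: "nat \<Rightarrow> nat" assume q: "q < states (loop j P m)" and s: "\<And>j. j < K \<Longrightarrow> s j = s' j"
  show "fst (trans (loop j P m) q s) = fst (trans (loop j P m) q s') \<and>
        (\<forall>i<K. snd (trans (loop j P m) q s) i = snd (trans (loop j P m) q s') i)"
    using wf_m_local[OF assms(1), of "q - 1" s s'] q s assms(2)
    by (auto simp: loop_simps)
next
  fix q :: nat and s :: "nat \<Rightarrow> nat" assume q: "q < states (loop j P m)" and s: "\<And>j. j < K \<Longrightarrow> s j < S"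
  show "fst (trans (loop j P m) q s) \<le> states (loop j P m) \<and>
        (\<forall>i<K. fst (snd (trans (loop j P m) q s) i) < S)"
    using wf_m_bound[OF assms(1), of "q - 1" s] q s
    by (fastforce simp: loop_simps)
qed

definition to_tm :: "nat \<Rightarrow> nat \<Rightarrow> machine \<Rightarrow> tm" where
  "to_tm K S m = \<lparr>num_tapes = K, num_states = states m, num_symbols = S,
     delta = (\<lambda>q s. (fst (trans m q (\<lambda>j. s ! j)), map (snd (trans m q (\<lambda>j. s ! j))) [0..<K]))\<rparr>"

lemma wf_to_tm:
  assumes "wf_m K S m" "K \<ge> 2" "S \<ge> 3"
  shows "wf_tm (to_tm K S m)"
proof -
  have "s ! j < S" if "set s \<subseteq> {..<S}" "j < length s" for s :: "nat list" and j
    using that nth_mem by blast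
  then show ?thesis
    using assms wf_m_bound[OF assms(1)] by (auto simp: wf_tm_def to_tm_def)
qed

lemma halted_steps: "fst c = num_states M \<Longrightarrow> (tm_step M ^^ t) c = c"
  by (induction t) (auto simp: tm_step_def)

lemma to_tm_exec:
  assumes "wf_m K S m" "exec m q T T' t"
  shows "(tm_step (to_tm K S m) ^^ t) (q, map T [0..<K]) = (states m, map T' [0..<K])"
  using assms(2)
proof (induction rule: exec.induct)
  case (exec_halt T)
  then show ?case by simp
next
  case (exec_step q T T' t)
  let ?s = "map read_tape (map T [0..<K])"
  have s: "\<And>j. j < K \<Longrightarrow> ?s ! j = reads T j" by (simp add: reads_def)
  have "tm_step (to_tm K S m) (q, map T [0..<K]) =
      (fst (trans m q (reads T)), map (acts T (snd (trans m q (reads T)))) [0..<K])"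
    using wf_m_local[OF assms(1) exec_step(1), of "\<lambda>j. ?s ! j" "reads T"] s exec_step(1)
    by (auto simp: tm_step_def to_tm_def Let_def acts_def intro!: nth_equalityI)
  then show ?case using exec_step
    by (simp add: funpow_Suc_right del: funpow.simps)
qed

definition init_tapes :: "bool list \<Rightarrow> nat \<Rightarrow> tape" where
  "init_tapes x = (\<lambda>j. if j = 0 then (inscription x, 0) else (inscription [], 0))"

lemma init_config_eq:
  assumes "num_tapes M \<ge> 1"
  shows "init_config M x = (0, map (init_tapes x) [0..<num_tapes M])"
proof -
  have "[0..<num_tapes M] = 0 # [1..<num_tapes M]" using assms by (simp add: upt_conv_Cons)
  moreover have "map (init_tapes x) [1..<num_tapes M] =
      replicate (num_tapes M - 1) (inscription [], 0)"
    by (auto simp: init_tapes_def intro!: nth_equalityI)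
  ultimately show ?thesis by (simp add: init_config_def init_tapes_def)
qed

lemma to_tm_outputs:
  assumes "wf_m K S m" "K \<ge> 2" "runs m (init_tapes x) T' t" "fst (T' 1) = inscription y"
  shows "outputs_within (to_tm K S m) x y t"
proof -
  obtain u where u: "u \<le> t" "exec m 0 (init_tapes x) T' u" using assms(3) by (auto simp: runs_def)
  have "init_config (to_tm K S m) x = (0, map (init_tapes x) [0..<K])"
    using init_config_eq[of "to_tm K S m" x] assms(2) by (simp add: to_tm_def)
  then have *: "(tm_step (to_tm K S m) ^^ u) (init_config (to_tm K S m) x) =
      (states m, map T' [0..<K])"
    using to_tm_exec[OF assms(1) u(2)] by simp
  have "(tm_step (to_tm K S m) ^^ t) (init_config (to_tm K S m) x) = (states m, map T' [0..<K])"
  proof -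
    have "t = (t - u) + u" using u by simp
    then have "(tm_step (to_tm K S m) ^^ t) (init_config (to_tm K S m) x) =
        (tm_step (to_tm K S m) ^^ (t - u)) (states m, map T' [0..<K])"
      using * by (metis comp_apply funpow_add)
    then show ?thesis by (simp add: halted_steps to_tm_def)
  qed
  then show ?thesis using assms(2,4) by (simp add: outputs_within_def to_tm_def)
qed

text \<open>
  Symbols that are foreign to \<open>M\<close> let the machine halt, so that it is well-formed for every larger
  alphabet, too.
\<close>

definition of_tm :: "tm \<Rightarrow> machine" where
  "of_tm M = Machine (num_states M) (\<lambda>q s.
     if \<forall>j<num_tapes M. s j < num_symbols M then
       let r = delta M q (map s [0..<num_tapes M])
       in (fst r, \<lambda>j. if j < num_tapes M then snd r ! j else (s j, Stay))
     else (num_states M, stay s))"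

lemma of_tm_simps:
  "states (of_tm M) = num_states M"
  "trans (of_tm M) q s =
     (if \<forall>j<num_tapes M. s j < num_symbols M then
        (fst (delta M q (map s [0..<num_tapes M])),
         \<lambda>j. if j < num_tapes M then snd (delta M q (map s [0..<num_tapes M])) ! j else (s j, Stay))
      else (num_states M, stay s))"
  by (auto simp: of_tm_def Let_def)

lemma wf_of_tm:
  assumes "wf_tm M" "num_symbols M \<le> S"
  shows "wf_m (num_tapes M) S (of_tm M)"
proof (rule wf_mI)
  fix q :: nat and s s' :: "nat \<Rightarrow> nat" assume "q < states (of_tm M)" and s: "\<And>j. j < num_tapes M \<Longrightarrow> s j = s' j"
  have "map s [0..<num_tapes M] = map s' [0..<num_tapes M]" using s by auto
  then show "fst (trans (of_tm M) q s) = fst (trans (of_tm M) q s') \<and>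
        (\<forall>j<num_tapes M. snd (trans (of_tm M) q s) j = snd (trans (of_tm M) q s') j)"
    using s by (auto simp: of_tm_simps simp del: map_eq_conv)
next
  fix q :: nat and s :: "nat \<Rightarrow> nat" assume q: "q < states (of_tm M)" and s: "\<And>j. j < num_tapes M \<Longrightarrow> s j < S"
  let ?r = "delta M q (map s [0..<num_tapes M])"
  show "fst (trans (of_tm M) q s) \<le> states (of_tm M) \<and>
        (\<forall>j<num_tapes M. fst (snd (trans (of_tm M) q s) j) < S)"
  proof (cases "\<forall>j<num_tapes M. s j < num_symbols M")
    case True
    then have "length (map s [0..<num_tapes M]) = num_tapes M"
      "set (map s [0..<num_tapes M]) \<subseteq> {..<num_symbols M}" by auto
    then have "fst ?r \<le> num_states M \<and> length (snd ?r) = num_tapes M \<and>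
        fst ` set (snd ?r) \<subseteq> {..<num_symbols M}"
      using assms(1) q unfolding wf_tm_def of_tm_simps by blast
    moreover from this have "fst (snd ?r ! j) < S" if "j < num_tapes M" for j
      using that nth_mem[of j "snd ?r"] assms(2) by fastforce
    ultimately show ?thesis using True by (auto simp: of_tm_simps)
  qed (use s in \<open>auto simp: of_tm_simps\<close>)
qed

text \<open>\<open>tm_step\<close> idles in the halting state whereas \<open>exec\<close> stops
  there; this is why \<open>t'\<close> may be smaller than \<open>t\<close>.\<close>

lemma of_tm_exec:
  assumes M: "wf_tm M"
  shows "(\<And>j p. j < num_tapes M \<Longrightarrow> fst (T j) p < num_symbols M) \<Longrightarrow> q \<le> num_states M \<Longrightarrow>
    (tm_step M ^^ t) (q, map T [0..<num_tapes M]) = (num_states M, ts) \<Longrightarrow>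
    \<exists>T' t'. t' \<le> t \<and> exec (of_tm M) q T T' t' \<and> ts = map T' [0..<num_tapes M]"
proof (induction t arbitrary: q T)
  case 0
  then show ?case using exec_halt[of "of_tm M" T] by (auto simp: of_tm_simps)
next
  case (Suc t)
  show ?case
  proof (cases "q = num_states M")
    case True
    then show ?thesis using Suc.prems(3) halted_steps[of "(q, map T [0..<num_tapes M])" M "Suc t"]
        exec_halt[of "of_tm M" T]
      by (intro exI[of _ T] exI[of _ 0]) (auto simp: of_tm_simps)
  next
    case False
    with Suc have q: "q < num_states M" by simp
    let ?s = "map (reads T) [0..<num_tapes M]"
    let ?r = "delta M q ?s"
    have b: "reads T j < num_symbols M" if "j < num_tapes M" for j
      using Suc.prems(1)[OF that] by (simp add: reads_def read_tape_def)
    then have "length ?s = num_tapes M" "set ?s \<subseteq> {..<num_symbols M}" by auto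
    with M q have r: "length (snd ?r) = num_tapes M" "fst ?r \<le> num_states M"
      "fst ` set (snd ?r) \<subseteq> {..<num_symbols M}"
      unfolding wf_tm_def by blast+
    let ?T = "acts T (snd (trans (of_tm M) q (reads T)))"
    have m: "map (\<lambda>x. read_tape (T x)) [0..<num_tapes M] = ?s" by (simp add: reads_def)
    have st: "tm_step M (q, map T [0..<num_tapes M]) = (fst ?r, map ?T [0..<num_tapes M])"
      using q r b by (auto simp: tm_step_def Let_def acts_def of_tm_simps comp_def m
          intro!: nth_equalityI)
    have "fst (snd ?r ! j) < num_symbols M" if "j < num_tapes M" for j
    proof -
      have "snd ?r ! j \<in> set (snd ?r)" using that r(1) by simp
      then show ?thesis using r(3) by blast
    qed
    then have "fst (?T j) p < num_symbols M" if "j < num_tapes M" for j p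
      using that b Suc.prems(1)[OF that, of p] by (auto simp: acts_def act_tape_def of_tm_simps)
    from Suc.IH[of ?T "fst ?r", OF this r(2)] Suc.prems(3) st
    obtain T' t' where "t' \<le> t" "exec (of_tm M) (fst ?r) ?T T' t'" "ts = map T' [0..<num_tapes M]"
      by (auto simp: funpow_Suc_right simp del: funpow.simps)
    moreover have "fst (trans (of_tm M) q (reads T)) = fst ?r" using b by (simp add: of_tm_simps)
    ultimately show ?thesis using q exec_step[of q "of_tm M" T T' t']
      by (intro exI[of _ T'] exI[of _ "Suc t'"]) (simp add: of_tm_simps(1))
  qed
qed

lemma of_tm_outputs:
  assumes M: "wf_tm M" and "outputs_within M x y t"
  shows "\<exists>T'. \<exists>t'\<le>t. exec (of_tm M) 0 (init_tapes x) T' t' \<and> fst (T' 1) = inscription y"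
proof -
  have k: "num_tapes M \<ge> 2" "num_symbols M \<ge> 3" using M by (auto simp: wf_tm_def)
  let ?c = "(tm_step M ^^ t) (init_config M x)"
  have c: "fst ?c = num_states M" "fst (snd ?c ! 1) = inscription y"
    using assms(2) by (auto simp: outputs_within_def Let_def)
  have e: "(tm_step M ^^ t) (0, map (init_tapes x) [0..<num_tapes M]) = (num_states M, snd ?c)"
    using c(1) init_config_eq[of M x] k by (metis prod.collapse Suc_1 Suc_leD One_nat_def)
  have "fst (init_tapes x j) p < num_symbols M" for j p
    using k by (auto simp: init_tapes_def inscription_def)
  from of_tm_exec[OF M this _ e] obtain T' t' where
    "t' \<le> t" "exec (of_tm M) 0 (init_tapes x) T' t'" "snd ?c = map T' [0..<num_tapes M]" by auto
  then show ?thesis using c k by auto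
qed

text \<open>A head advances at most one cell per step and changes only the scanned cell, so
  everything from distance \<open>t\<close> to the right on is out of reach. The resulting bound of
  output lengths by running times is what composing polynomial bounds requires.\<close>

lemma exec_far:
  assumes "exec m q T T' t"
  shows "snd (T' j) \<le> snd (T j) + int t \<and>
    (\<forall>p \<ge> snd (T j) + int t. fst (T' j) p = fst (T j) p)"
  using assms
proof (induction rule: exec.induct)
  case (exec_step q T T' t)
  let ?a = "snd (trans m q (reads T)) j"
  have "snd (acts T (snd (trans m q (reads T))) j) \<le> snd (T j) + 1"
    by (cases "snd ?a") (auto simp: acts_def act_tape_def)
  then show ?case using exec_step.IH by (auto simp: acts_def act_tape_def)
qed auto

lemma outputs_length:
  assumes "wf_tm M" "outputs_within M x y t"
  shows "length y \<le> t"
proof (rule ccontr)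
  assume "\<not> length y \<le> t"
  moreover obtain T' t' where t: "t' \<le> t" "exec (of_tm M) 0 (init_tapes x) T' t'"
    "fst (T' 1) = inscription y" using of_tm_outputs[OF assms] by blast
  ultimately show False using exec_far[OF t(2), of 1]
    by (auto simp: init_tapes_def inscription_def dest!: spec[of _ "int t"] split: if_splits)
qed

section \<open>Sequential composition of Turing machines\<close>

fun dir_code :: "direction \<Rightarrow> nat" where
  "dir_code MoveLeft = 1" | "dir_code Stay = 2" | "dir_code MoveRight = 3"

definition undo :: "nat \<Rightarrow> direction" where
  "undo c = (if c = 1 then MoveRight else if c = 3 then MoveLeft else Stay)"

text \<open>
  Tape \<open>i < k\<close> of \<open>m\<close> becomes tape \<open>\<pi> i\<close>. The moves on tape \<open>1\<close> of \<open>m\<close> are recorded on tape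
  \<open>lg\<close>: after halting, this is the only way to find back to the beginning of the output, since the
  head may be in a blank region on either side of it.
\<close>

definition lift :: "nat \<Rightarrow> (nat \<Rightarrow> nat) \<Rightarrow> nat \<Rightarrow> machine \<Rightarrow> machine" where
  "lift k \<pi> lg m = Machine (states m) (\<lambda>q s.
     let r = trans m q (\<lambda>i. s (\<pi> i))
     in (fst r, \<lambda>j. if j = lg then (dir_code (snd (snd r 1)), MoveRight)
                    else if j \<in> \<pi> ` {..<k} then snd r (inv_into {..<k} \<pi> j)
                    else (s j, Stay)))"

lemma lift_simps:
  "states (lift k \<pi> lg m) = states m"
  "trans (lift k \<pi> lg m) q s =
     (fst (trans m q (\<lambda>i. s (\<pi> i))),
      \<lambda>j. if j = lg then (dir_code (snd (snd (trans m q (\<lambda>i. s (\<pi> i))) 1)), MoveRight)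
          else if j \<in> \<pi> ` {..<k} then snd (trans m q (\<lambda>i. s (\<pi> i))) (inv_into {..<k} \<pi> j)
          else (s j, Stay))"
  by (simp_all add: lift_def Let_def)

lemma wf_lift:
  assumes m: "wf_m k S m" and \<pi>: "inj_on \<pi> {..<k}" "\<And>i. i < k \<Longrightarrow> \<pi> i < K" and S: "4 \<le> S"
    and k: "1 < k"
  shows "wf_m K S (lift k \<pi> lg m)"
proof (rule wf_mI)
  fix q :: nat and s s' :: "nat \<Rightarrow> nat" assume q: "q < states (lift k \<pi> lg m)" and s: "\<And>j. j < K \<Longrightarrow> s j = s' j"
  have "s (\<pi> i) = s' (\<pi> i)" if "i < k" for i using s \<pi>(2) that by simp
  note l = wf_m_local[OF m, of q "\<lambda>i. s (\<pi> i)" "\<lambda>i. s' (\<pi> i)", OF _ this]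
  show "fst (trans (lift k \<pi> lg m) q s) = fst (trans (lift k \<pi> lg m) q s') \<and>
        (\<forall>j<K. snd (trans (lift k \<pi> lg m) q s) j = snd (trans (lift k \<pi> lg m) q s') j)"
    using l q s \<pi> k by (auto simp: lift_simps)
next
  fix q :: nat and s :: "nat \<Rightarrow> nat" assume q: "q < states (lift k \<pi> lg m)" and s: "\<And>j. j < K \<Longrightarrow> s j < S"
  have d: "dir_code x < S" for x using S by (cases x) auto
  have "s (\<pi> i) < S" if "i < k" for i using s \<pi>(2) that by simp
  note l = wf_m_bound[OF m, of q "\<lambda>i. s (\<pi> i)", OF _ this]
  show "fst (trans (lift k \<pi> lg m) q s) \<le> states (lift k \<pi> lg m) \<and>
        (\<forall>j<K. fst (snd (trans (lift k \<pi> lg m) q s) j) < S)"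
    using q s l \<pi>(1) d by (auto simp: lift_simps)
qed

text \<open>The list \<open>ds\<close> of moves on tape 1 of \<open>m\<close> appears twice, as the
  displacement of that head and as the inscription of the log; \<open>runs_rewind\<close> needs
  exactly this link.\<close>

lemma lift_exec:
  assumes "exec m q U U' t" and m: "wf_m k S m" and \<pi>: "inj_on \<pi> {..<k}" "lg \<notin> \<pi> ` {..<k}"
    and k: "1 < k" and "\<And>i. i < k \<Longrightarrow> T (\<pi> i) = U i"
  shows "\<exists>T' ds. exec (lift k \<pi> lg m) q T T' t \<and> (\<forall>i<k. T' (\<pi> i) = U' i) \<and>
    (\<forall>j. j \<noteq> lg \<longrightarrow> j \<notin> \<pi> ` {..<k} \<longrightarrow> T' j = T j) \<and> length ds = t \<and>
    snd (U' 1) = fold move ds (snd (U 1)) \<and>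
    T' lg = fold (\<lambda>d t. act_tape t (dir_code d, MoveRight)) ds (T lg)"
  using assms(1,6)
proof (induction arbitrary: T rule: exec.induct)
  case (exec_halt U)
  then show ?case using exec.exec_halt[of "lift k \<pi> lg m" T]
    by (intro exI[of _ T] exI[of _ "[]"]) (auto simp: lift_simps)
next
  case (exec_step q U U' t)
  let ?l = "lift k \<pi> lg m"
  let ?a = "snd (trans m q (reads U))"
  let ?T = "acts T (snd (trans ?l q (reads T)))"
  have q: "q < states ?l" using exec_step by (simp add: lift_simps)
  have "reads T (\<pi> i) = reads U i" if "i < k" for i
    using exec_step.prems[OF that] by (simp add: reads_def)
  note l = wf_m_local[OF m, of q "\<lambda>i. reads T (\<pi> i)" "reads U", OF _ this]
  have f: "fst (trans ?l q (reads T)) = fst (trans m q (reads U))"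
    using l(1) exec_step.hyps by (simp add: lift_simps)
  have "?T (\<pi> i) = acts U ?a i" if "i < k" for i
    using l(2)[of i] exec_step that \<pi> by (auto simp: lift_simps acts_def)
  from exec_step.IH[OF this] obtain T' ds where *:
    "exec ?l (fst (trans m q (reads U))) ?T T' t" "\<And>i. i < k \<Longrightarrow> T' (\<pi> i) = U' i"
    "\<And>j. j \<noteq> lg \<Longrightarrow> j \<notin> \<pi> ` {..<k} \<Longrightarrow> T' j = ?T j" "length ds = t"
    "snd (U' 1) = fold move ds (snd (acts U ?a 1))"
    "T' lg = fold (\<lambda>d t. act_tape t (dir_code d, MoveRight)) ds (?T lg)" by blast
  have "?T lg = act_tape (T lg) (dir_code (snd (?a 1)), MoveRight)"
    using l(2)[of 1] exec_step.hyps k by (simp add: lift_simps acts_def)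
  moreover have "?T j = T j" if "j \<noteq> lg" "j \<notin> \<pi> ` {..<k}" for j
    using that by (simp add: lift_simps acts_def act_tape_def reads_def read_tape_def)
  moreover have "snd (acts U ?a 1) = move (snd (?a 1)) (snd (U 1))"
    by (simp add: acts_def act_tape_def)
  ultimately show ?case using * exec.exec_step[OF q, of T T' t] f
    by (intro exI[of _ T'] exI[of _ "snd (?a 1) # ds"]) auto
qed

text \<open>The log head stands behind the last entry, hence the extra step to the left. Codes of
  moves are nonzero, so the blank in front of the log ends the loop.\<close>

definition rewind :: "nat \<Rightarrow> nat \<Rightarrow> machine" where
  "rewind p lg =
     seq (act (\<lambda>s j. (s j, if j = lg then MoveLeft else Stay)))
       (loop lg (\<lambda>c. c \<noteq> 0)
         (act (\<lambda>s j. (s j, if j = lg then MoveLeft else if j = p then undo (s lg) else Stay))))"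

lemma wf_rewind:
  assumes "lg < K" shows "wf_m K S (rewind p lg)"
  unfolding rewind_def using assms by (intro wf_seq wf_loop wf_act) auto

definition log_tape :: "direction list \<Rightarrow> int \<Rightarrow> nat" where
  "log_tape ds i = (if 0 \<le> i \<and> i < int (length ds) then dir_code (ds ! nat i) else 0)"

lemma fold_log_tape:
  "fold (\<lambda>d t. act_tape t (dir_code d, MoveRight)) ds (\<lambda>_. 0, 0) = (log_tape ds, int (length ds))"
proof (induction ds rule: rev_induct)
  case (snoc d ds)
  then show ?case
    by (auto simp: act_tape_def log_tape_def fun_eq_iff nth_append nat_less_iff)
qed (auto simp: log_tape_def)

lemma move_undo: "move (undo (dir_code d)) (move d p) = p"
  by (cases d) (auto simp: undo_def)

lemma runs_rewind:
  assumes p: "p \<noteq> lg" and T: "T lg = (log_tape ds, int (length ds))" "snd (T p) = fold move ds h"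
  shows "\<exists>T'. runs (rewind p lg) T T' (2 * length ds + 2) \<and> T' p = (fst (T p), h) \<and>
    (\<forall>j. j \<noteq> p \<longrightarrow> j \<noteq> lg \<longrightarrow> T' j = T j)"
proof -
  let ?n = "length ds"
  define R where "R i = T(lg := (log_tape ds, int (?n - i) - 1),
      p := (fst (T p), fold move (take (?n - i) ds) h))" for i
  have dc: "dir_code d \<noteq> 0" for d by (cases d) auto
  let ?b = "act (\<lambda>s j. (s j, if j = lg then MoveLeft else if j = p then undo (s lg) else Stay))"
  have step: "reads (R i) lg \<noteq> 0 \<and> runs ?b (R i) (R (Suc i)) 1" if i: "i < ?n" for i
  proof
    have l: "reads (R i) lg = dir_code (ds ! (?n - Suc i))"
    proof -
      have "int (?n - i) - 1 = int (?n - Suc i)" using i by simp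
      then show ?thesis using i p
        by (simp add: R_def reads_def read_tape_def log_tape_def del: of_nat_diff)
    qed
    then show "reads (R i) lg \<noteq> 0" using dc by simp
    have "take (?n - i) ds = take (?n - Suc i) ds @ [ds ! (?n - Suc i)]"
      using i by (metis Suc_diff_Suc diff_less length_greater_0_conv list.size(3) not_less0
          take_Suc_conv_app_nth zero_less_Suc)
    then have "acts (R i) (\<lambda>j. (reads (R i) j, if j = lg then MoveLeft
        else if j = p then undo (reads (R i) lg) else Stay)) = R (Suc i)"
      using i p unfolding l
      by (auto simp: R_def acts_def act_tape_def reads_def read_tape_def fun_eq_iff move_undo)
    then show "runs ?b (R i) (R (Suc i)) 1"
      using runs_act[of "\<lambda>s j. (s j, if j = lg then MoveLeft else if j = p then undo (s lg) else Stay)"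
          "R i"] by simp
  qed
  have "\<not> reads (R ?n) lg \<noteq> 0"
    using p by (auto simp: R_def reads_def read_tape_def log_tape_def)
  from runs_loop_iter[of ?n "\<lambda>c. c \<noteq> 0" R lg ?b 1, OF step this]
  have "runs (loop lg (\<lambda>c. c \<noteq> 0) ?b) (R 0) (R ?n) (?n * (1 + 1) + 1)" .
  moreover have "acts T (\<lambda>j. (reads T j, if j = lg then MoveLeft else Stay)) = R 0"
    using T p by (auto simp: R_def acts_def act_tape_def reads_def read_tape_def fun_eq_iff
        prod_eq_iff)
  then have "runs (act (\<lambda>s j. (s j, if j = lg then MoveLeft else Stay))) T (R 0) 1"
    using runs_act[of "\<lambda>s j. (s j, if j = lg then MoveLeft else Stay)" T] by simp
  ultimately have "runs (rewind p lg) T (R ?n) (1 + (?n * (1 + 1) + 1))"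
    unfolding rewind_def by (intro runs_seq)
  then show ?thesis using p
    by (intro exI[of _ "R ?n"]) (auto simp: R_def elim!: runs_mono)
qed

text \<open>
  Tape \<open>i\<close> of \<open>M1\<close> is tape \<open>3 i\<close>; tape \<open>0\<close> of \<open>M2\<close> is the output tape of \<open>M1\<close>, its tape \<open>1\<close> is
  the output tape of the whole machine. The log tapes are \<open>2\<close> and \<open>5\<close>.
\<close>

definition right_tape :: "nat \<Rightarrow> nat" where
  "right_tape i = (if i = 0 then 3 else 3 * i - 2)"

text \<open>Residues modulo 3 separate the tapes of \<open>M1\<close>, the tapes of
  \<open>M2\<close> other than its input, and the logs, whatever the numbers of tapes. Only
  \<open>M1\<close> is rewound: the final output counts as an inscription, wherever its head
  is.\<close>

definition comp_tm :: "tm \<Rightarrow> tm \<Rightarrow> tm" where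
  "comp_tm M1 M2 =
     (let k1 = num_tapes M1; k2 = num_tapes M2
      in to_tm (3 * (k1 + k2)) (num_symbols M1 + num_symbols M2)
        (seq (seq (lift k1 (\<lambda>i. 3 * i) 2 (of_tm M1)) (rewind 3 2))
          (lift k2 right_tape 5 (of_tm M2))))"

lemma inj_right_tape: "inj_on right_tape A"
  by (auto simp: inj_on_def right_tape_def split: if_splits) arith+

lemma right_tape_neq: "right_tape i \<noteq> 2" "right_tape i \<noteq> 5"
  by (auto simp: right_tape_def) arith+

lemma comp_wf_m:
  assumes "wf_tm M1" "wf_tm M2"
  shows "wf_m (3 * (num_tapes M1 + num_tapes M2)) (num_symbols M1 + num_symbols M2)
    (seq (seq (lift (num_tapes M1) (\<lambda>i. 3 * i) 2 (of_tm M1)) (rewind 3 2))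
          (lift (num_tapes M2) right_tape 5 (of_tm M2)))"
  using assms by (intro wf_seq wf_rewind wf_lift wf_of_tm inj_right_tape)
    (auto simp: wf_tm_def inj_on_def right_tape_def)

lemma wf_comp_tm:
  assumes "wf_tm M1" "wf_tm M2"
  shows "wf_tm (comp_tm M1 M2)"
  unfolding comp_tm_def Let_def using assms
  by (intro wf_to_tm comp_wf_m) (auto simp: wf_tm_def)

text \<open>Serves two purposes: a second machine can read the output of the first, and in the
  hardness proof the head returns to the answer bit.\<close>

lemma lift_rewind:
  assumes M: "wf_tm M" and o: "outputs_within M x y t"
    and \<pi>: "inj_on \<pi> {..<num_tapes M}" "lg \<notin> \<pi> ` {..<num_tapes M}"
    and T: "\<And>i. i < num_tapes M \<Longrightarrow> T (\<pi> i) = init_tapes x i" "T lg = (inscription [], 0)"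
  shows "\<exists>T'. runs (seq (lift (num_tapes M) \<pi> lg (of_tm M)) (rewind (\<pi> 1) lg)) T T' (3 * t + 2) \<and>
    T' (\<pi> 1) = (inscription y, 0) \<and>
    (\<forall>j. j \<noteq> lg \<longrightarrow> j \<notin> \<pi> ` {..<num_tapes M} \<longrightarrow> T' j = T j)"
proof -
  have k: "1 < num_tapes M" using M by (auto simp: wf_tm_def)
  obtain U' t' where U: "t' \<le> t" "exec (of_tm M) 0 (init_tapes x) U' t'" "fst (U' 1) = inscription y"
    using of_tm_outputs[OF M o] by blast
  from lift_exec[OF U(2) wf_of_tm[OF M order_refl] \<pi> k T(1)] obtain T1 ds where T1:
    "exec (lift (num_tapes M) \<pi> lg (of_tm M)) 0 T T1 t'" "\<And>i. i < num_tapes M \<Longrightarrow> T1 (\<pi> i) = U' i"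
    "\<And>j. j \<noteq> lg \<Longrightarrow> j \<notin> \<pi> ` {..<num_tapes M} \<Longrightarrow> T1 j = T j" "length ds = t'"
    "snd (U' 1) = fold move ds (snd (init_tapes x 1))"
    "T1 lg = fold (\<lambda>d t. act_tape t (dir_code d, MoveRight)) ds (T lg)" by blast
  have "inscription [] = (\<lambda>_. 0)" by (auto simp: inscription_def)
  then have "T1 lg = (log_tape ds, int (length ds))" using T1(6) T(2) fold_log_tape by simp
  moreover have "snd (T1 (\<pi> 1)) = fold move ds 0"
    using T1(2)[OF k] T1(5) by (simp add: init_tapes_def)
  moreover have "\<pi> 1 \<noteq> lg" using \<pi>(2) k by auto
  ultimately obtain T2 where T2: "runs (rewind (\<pi> 1) lg) T1 T2 (2 * length ds + 2)"
    "T2 (\<pi> 1) = (fst (T1 (\<pi> 1)), 0)" "\<And>j. j \<noteq> \<pi> 1 \<Longrightarrow> j \<noteq> lg \<Longrightarrow> T2 j = T1 j"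
    using runs_rewind[of "\<pi> 1" lg T1 ds 0] by blast
  have "runs (lift (num_tapes M) \<pi> lg (of_tm M)) T T1 t" using T1(1) U(1) by (auto simp: runs_def)
  from runs_seq[OF this T2(1)]
  have "runs (seq (lift (num_tapes M) \<pi> lg (of_tm M)) (rewind (\<pi> 1) lg)) T T2 (3 * t + 2)"
    using T1(4) U(1) by (auto elim: runs_mono)
  moreover have "T2 (\<pi> 1) = (inscription y, 0)" using T2(2) T1(2)[OF k] U(3) by simp
  moreover have "T2 j = T j" if "j \<noteq> lg" "j \<notin> \<pi> ` {..<num_tapes M}" for j
    using that T2(3)[of j] T1(3)[of j] k by auto
  ultimately show ?thesis by blast
qed

theorem comp_tm_outputs:
  assumes M: "wf_tm M1" "wf_tm M2" and o: "outputs_within M1 x y t1" "outputs_within M2 y z t2"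
  shows "outputs_within (comp_tm M1 M2) x z (3 * t1 + t2 + 2)"
proof -
  let ?k1 = "num_tapes M1" and ?k2 = "num_tapes M2"
  have k: "1 < ?k1" "1 < ?k2" using M by (auto simp: wf_tm_def)
  have "\<exists>T'. runs (seq (lift ?k1 (\<lambda>i. 3 * i) 2 (of_tm M1)) (rewind (3 * 1) 2))
      (init_tapes x) T' (3 * t1 + 2) \<and> T' (3 * 1) = (inscription y, 0) \<and>
      (\<forall>j. j \<noteq> 2 \<longrightarrow> j \<notin> (\<lambda>i. 3 * i) ` {..<?k1} \<longrightarrow> T' j = init_tapes x j)"
    using M(1) o(1) by (intro lift_rewind) (auto simp: inj_on_def init_tapes_def, presburger)
  then obtain T where T: "runs (seq (lift ?k1 (\<lambda>i. 3 * i) 2 (of_tm M1)) (rewind 3 2))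
      (init_tapes x) T (3 * t1 + 2)" "T 3 = (inscription y, 0)"
      "\<And>j. j \<noteq> 2 \<Longrightarrow> j \<notin> (\<lambda>i. 3 * i) ` {..<?k1} \<Longrightarrow> T j = init_tapes x j"
    by auto
  obtain U' t' where U: "t' \<le> t2" "exec (of_tm M2) 0 (init_tapes y) U' t'"
    "fst (U' 1) = inscription z"
    using of_tm_outputs[OF M(2) o(2)] by blast
  have "T (right_tape i) = init_tapes y i" for i
  proof (cases "i = 0")
    case False
    then have "right_tape i \<notin> (\<lambda>i. 3 * i) ` {..<?k1}" "right_tape i \<noteq> 0"
      by (auto simp: right_tape_def) arith+
    then show ?thesis using False T(3)[of "right_tape i"] right_tape_neq[of i]
      by (simp add: init_tapes_def)
  qed (simp add: right_tape_def T(2) init_tapes_def)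
  from lift_exec[OF U(2) wf_of_tm[OF M(2) order_refl] inj_right_tape _ k(2) this, of 5]
  obtain T' where T': "exec (lift ?k2 right_tape 5 (of_tm M2)) 0 T T' t'"
    "\<And>i. i < ?k2 \<Longrightarrow> T' (right_tape i) = U' i" using right_tape_neq(2) by force
  have "runs (lift ?k2 right_tape 5 (of_tm M2)) T T' t2" using T'(1) U(1) by (auto simp: runs_def)
  from runs_seq[OF T(1) this]
  have "runs (seq (seq (lift ?k1 (\<lambda>i. 3 * i) 2 (of_tm M1)) (rewind 3 2))
      (lift ?k2 right_tape 5 (of_tm M2))) (init_tapes x) T' (3 * t1 + t2 + 2)"
    by (simp add: ac_simps)
  moreover have "fst (T' 1) = inscription z" using T'(2)[OF k(2)] U(3) by (simp add: right_tape_def)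
  ultimately show ?thesis unfolding comp_tm_def Let_def
    using comp_wf_m[OF M] k by (intro to_tm_outputs) auto
qed

section \<open>Counter programs\<close>

text \<open>
  A counter with value \<open>v\<close> is a tape whose head is on cell \<open>v - 1\<close>; cell \<open>-1\<close> carries the marker
  \<open>3\<close>. The head on the input tape is a counter as well.
\<close>

definition counter_tape :: "bool list \<Rightarrow> nat \<Rightarrow> tape" where
  "counter_tape w v = ((inscription w)(-1 := 3), int v - 1)"

text \<open>Tape 1 is the output with the head behind it, so a valuation \<sigma> matters only away
  from index 1, as \<open>rep_cong\<close> says.\<close>

definition rep :: "bool list \<Rightarrow> (nat \<Rightarrow> nat) \<Rightarrow> bool list \<Rightarrow> nat \<Rightarrow> tape" where
  "rep w \<sigma> out = (\<lambda>j. if j = 1 then (inscription out, int (length out))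
     else counter_tape (if j = 0 then w else []) (\<sigma> j))"

text \<open>The marker \<open>3\<close> stands on cell \<open>-1\<close> only, where a counter of
  value 0 has its head: the test for zero reads a single symbol.\<close>

lemma reads_rep_zero: "j \<noteq> 1 \<Longrightarrow> reads (rep w \<sigma> out) j = 3 \<longleftrightarrow> \<sigma> j = 0"
  by (auto simp: reads_def read_tape_def rep_def counter_tape_def inscription_def)

lemma rep_cong: "(\<And>j. j \<noteq> 1 \<Longrightarrow> \<sigma> j = \<sigma>' j) \<Longrightarrow> rep w \<sigma> out = rep w \<sigma>' out"
  by (auto simp: rep_def)

definition inc :: "nat \<Rightarrow> machine" where
  "inc j = act (\<lambda>s i. (s i, if i = j then MoveRight else Stay))"

text \<open>Staying on the marker yields the truncated subtraction of natural numbers.\<close>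

definition dec :: "nat \<Rightarrow> machine" where
  "dec j = act (\<lambda>s i. (s i, if i = j \<and> s j \<noteq> 3 then MoveLeft else Stay))"

definition emit :: "bool \<Rightarrow> machine" where
  "emit b = act (\<lambda>s i. if i = 1 then (if b then 2 else 1, MoveRight) else (s i, Stay))"

lemma runs_inc:
  assumes "j \<noteq> 1"
  shows "runs (inc j) (rep w \<sigma> out) (rep w (\<sigma>(j := Suc (\<sigma> j))) out) 1"
proof -
  have "acts (rep w \<sigma> out) (\<lambda>i. (reads (rep w \<sigma> out) i, if i = j then MoveRight else Stay)) =
      rep w (\<sigma>(j := Suc (\<sigma> j))) out"
    using assms by (auto simp: fun_eq_iff acts_def act_tape_def reads_def read_tape_def rep_def
        counter_tape_def)
  then show ?thesis
    using runs_act[of "\<lambda>s i. (s i, if i = j then MoveRight else Stay)" "rep w \<sigma> out"]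
    by (simp add: inc_def)
qed

lemma runs_dec:
  assumes "j \<noteq> 1"
  shows "runs (dec j) (rep w \<sigma> out) (rep w (\<sigma>(j := \<sigma> j - 1)) out) 1"
proof -
  have "acts (rep w \<sigma> out)
      (\<lambda>i. (reads (rep w \<sigma> out) i, if i = j \<and> reads (rep w \<sigma> out) j \<noteq> 3 then MoveLeft else Stay)) =
      rep w (\<sigma>(j := \<sigma> j - 1)) out"
    using assms unfolding reads_rep_zero[OF assms]
    by (auto simp: fun_eq_iff acts_def act_tape_def reads_def read_tape_def rep_def
        counter_tape_def)
  then show ?thesis
    using runs_act[of "\<lambda>s i. (s i, if i = j \<and> s j \<noteq> 3 then MoveLeft else Stay)" "rep w \<sigma> out"]
    by (simp add: dec_def)
qed

lemma inscription_snoc: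
  "(inscription out)(int (length out) := if b then 2 else 1) = inscription (out @ [b])"
  by (auto simp: inscription_def fun_eq_iff nth_append nat_less_iff)

lemma runs_emit: "runs (emit b) (rep w \<sigma> out) (rep w \<sigma> (out @ [b])) 1"
proof -
  have "acts (rep w \<sigma> out)
      (\<lambda>i. if i = 1 then (if b then 2 else 1, MoveRight) else (reads (rep w \<sigma> out) i, Stay)) =
      rep w \<sigma> (out @ [b])"
    by (auto simp: fun_eq_iff acts_def act_tape_def reads_def read_tape_def rep_def
        inscription_snoc[symmetric])
  then show ?thesis
    using runs_act[of "\<lambda>s i. if i = 1 then (if b then 2 else 1, MoveRight) else (s i, Stay)"
        "rep w \<sigma> out"]
    by (simp add: emit_def)
qed

definition down :: "nat \<Rightarrow> machine \<Rightarrow> machine" where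
  "down j m = loop j (\<lambda>c. c \<noteq> 3) (seq (dec j) m)"

text \<open>\<open>S i\<close> gives the other counters and \<open>f i\<close> the output after
  \<open>i\<close> rounds; the body sees the counter already decremented, hence
  \<open>n - Suc i\<close>.\<close>

lemma runs_down:
  assumes j: "j \<noteq> 1"
    and b: "\<And>i. i < n \<Longrightarrow> runs m (rep w ((S i)(j := n - Suc i)) (f i))
        (rep w ((S (Suc i))(j := n - Suc i)) (f (Suc i))) b"
    and T: "T = rep w ((S 0)(j := n)) (f 0)" "T' = rep w ((S n)(j := 0)) (f n)"
    and t: "n * (b + 2) + 1 \<le> t"
  shows "runs (down j m) T T' t"
proof -
  have "runs (loop j (\<lambda>c. c \<noteq> 3) (seq (dec j) m)) (rep w ((S 0)(j := n - 0)) (f 0))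
      (rep w ((S n)(j := n - n)) (f n)) (n * ((1 + b) + 1) + 1)"
  proof (rule runs_loop_iter, intro conjI)
    fix i assume i: "i < n"
    show "reads (rep w ((S i)(j := n - i)) (f i)) j \<noteq> 3" using i reads_rep_zero[OF j] by simp
    have "runs (dec j) (rep w ((S i)(j := n - i)) (f i)) (rep w ((S i)(j := n - Suc i)) (f i)) 1"
      using runs_dec[OF j, of w "(S i)(j := n - i)" "f i"] by simp
    from runs_seq[OF this b[OF i]]
    show "runs (seq (dec j) m) (rep w ((S i)(j := n - i)) (f i))
        (rep w ((S (Suc i))(j := n - Suc i)) (f (Suc i))) (1 + b)" .
  qed (use reads_rep_zero[OF j] in simp)
  then show ?thesis using T t by (auto simp: down_def elim: runs_mono)
qed

definition transfer :: "nat \<Rightarrow> nat \<Rightarrow> machine" where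
  "transfer j l = down j (inc l)"

lemma runs_transfer:
  assumes "j \<noteq> 1" "l \<noteq> 1" "j \<noteq> l"
  shows "runs (transfer j l) (rep w \<sigma> out) (rep w (\<sigma>(j := 0, l := \<sigma> l + \<sigma> j)) out) (3 * \<sigma> j + 1)"
  unfolding transfer_def
proof (rule runs_down[where S = "\<lambda>i. \<sigma>(l := \<sigma> l + i)" and n = "\<sigma> j" and f = "\<lambda>_. out" and b = 1])
  fix i
  show "runs (inc l) (rep w (\<sigma>(l := \<sigma> l + i, j := \<sigma> j - Suc i)) out)
     (rep w (\<sigma>(l := \<sigma> l + Suc i, j := \<sigma> j - Suc i)) out) 1"
    using runs_inc[OF assms(2), of w "\<sigma>(l := \<sigma> l + i, j := \<sigma> j - Suc i)" out] assms(3)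
    by (simp add: fun_upd_twist)
qed (use assms in \<open>auto simp: fun_upd_twist\<close>)

text \<open>Reading a counter destroys it, so the value goes to the target and to the scratch
  counter \<open>u\<close>, from which it is restored.\<close>

definition copy :: "nat \<Rightarrow> nat \<Rightarrow> nat \<Rightarrow> machine" where
  "copy j l u = seq (down j (seq (inc l) (inc u))) (transfer u j)"

lemma runs_copy:
  assumes "j \<noteq> 1" "l \<noteq> 1" "u \<noteq> 1" "j \<noteq> l" "u \<noteq> l" "u \<noteq> j" "\<sigma> u = 0"
  shows "runs (copy j l u) (rep w \<sigma> out) (rep w (\<sigma>(l := \<sigma> l + \<sigma> j)) out) (7 * \<sigma> j + 2)"
proof -
  have "runs (down j (seq (inc l) (inc u))) (rep w \<sigma> out)
      (rep w (\<sigma>(l := \<sigma> l + \<sigma> j, u := \<sigma> j, j := 0)) out) (4 * \<sigma> j + 1)"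
  proof (rule runs_down[where S = "\<lambda>i. \<sigma>(l := \<sigma> l + i, u := i)" and n = "\<sigma> j" and f = "\<lambda>_. out" and b = 2])
    fix i
    let ?s = "\<sigma>(l := \<sigma> l + i, u := i, j := \<sigma> j - Suc i)"
    from runs_seq[OF runs_inc[OF assms(2), of w ?s out]
        runs_inc[OF assms(3), of w "?s(l := Suc (?s l))" out]]
    show "runs (seq (inc l) (inc u)) (rep w ?s out)
      (rep w (\<sigma>(l := \<sigma> l + Suc i, u := Suc i, j := \<sigma> j - Suc i)) out) 2"
      using assms by (simp add: fun_upd_twist numeral_2_eq_2)
  qed (use assms in \<open>auto intro!: rep_cong\<close>)
  from runs_seq[OF this runs_transfer[of u j w _ out]]
  have "runs (copy j l u) (rep w \<sigma> out)
      (rep w (\<sigma>(l := \<sigma> l + \<sigma> j, u := \<sigma> j, j := 0, u := 0, j := 0 + \<sigma> j)) out)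
      (4 * \<sigma> j + 1 + (3 * \<sigma> j + 1))"
    using assms unfolding copy_def by simp
  moreover have "\<sigma>(l := \<sigma> l + \<sigma> j, u := \<sigma> j, j := 0, u := 0, j := 0 + \<sigma> j) = \<sigma>(l := \<sigma> l + \<sigma> j)"
    using assms by (auto simp: fun_eq_iff)
  ultimately show ?thesis by (simp add: algebra_simps)
qed

definition clear :: "nat \<Rightarrow> machine" where
  "clear j = down j skip"

lemma runs_clear:
  assumes "j \<noteq> 1"
  shows "runs (clear j) (rep w \<sigma> out) (rep w (\<sigma>(j := 0)) out) (2 * \<sigma> j + 1)"
  unfolding clear_def
  by (rule runs_down[where S = "\<lambda>i. \<sigma>" and n = "\<sigma> j" and f = "\<lambda>_. out" and b = 0])
    (use assms runs_skip in auto)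

definition monus :: "nat \<Rightarrow> nat \<Rightarrow> machine" where
  "monus j l = down j (dec l)"

lemma runs_monus:
  assumes "j \<noteq> 1" "l \<noteq> 1" "j \<noteq> l"
  shows "runs (monus j l) (rep w \<sigma> out) (rep w (\<sigma>(j := 0, l := \<sigma> l - \<sigma> j)) out) (3 * \<sigma> j + 1)"
  unfolding monus_def
proof (rule runs_down[where S = "\<lambda>i. \<sigma>(l := \<sigma> l - i)" and n = "\<sigma> j" and f = "\<lambda>_. out" and b = 1])
  fix i
  show "runs (dec l) (rep w (\<sigma>(l := \<sigma> l - i, j := \<sigma> j - Suc i)) out)
     (rep w (\<sigma>(l := \<sigma> l - Suc i, j := \<sigma> j - Suc i)) out) 1"
    using runs_dec[OF assms(2), of w "\<sigma>(l := \<sigma> l - i, j := \<sigma> j - Suc i)" out] assms(3)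
    by (simp add: fun_upd_twist)
qed (use assms in \<open>auto simp: fun_upd_twist\<close>)

definition times :: "nat \<Rightarrow> machine" where
  "times d = seq (down (Suc d) (copy (d + 2) d (d + 3))) (clear (d + 2))"

lemma runs_times:
  assumes d: "d \<ge> 2" and z: "\<sigma> d = 0" "\<sigma> (d + 3) = 0"
  shows "runs (times d) (rep w \<sigma> out)
    (rep w (\<sigma>(d := \<sigma> (Suc d) * \<sigma> (d + 2), Suc d := 0, d + 2 := 0)) out)
    (\<sigma> (Suc d) * (7 * \<sigma> (d + 2) + 4) + 2 * \<sigma> (d + 2) + 2)"
proof -
  let ?a = "\<sigma> (Suc d)" and ?b = "\<sigma> (d + 2)"
  have "runs (down (Suc d) (copy (d + 2) d (d + 3))) (rep w \<sigma> out)
      (rep w (\<sigma>(d := ?a * ?b, Suc d := 0)) out) (?a * (7 * ?b + 4) + 1)"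
  proof (rule runs_down[where S = "\<lambda>i. \<sigma>(d := i * ?b)" and n = ?a and f = "\<lambda>_. out" and b = "7 * ?b + 2"])
    fix i
    let ?s = "\<sigma>(d := i * ?b, Suc d := ?a - Suc i)"
    show "runs (copy (d + 2) d (d + 3)) (rep w ?s out)
       (rep w (\<sigma>(d := Suc i * ?b, Suc d := ?a - Suc i)) out) (7 * ?b + 2)"
      using runs_copy[of "d + 2" d "d + 3" ?s w out] d z
      by (simp add: fun_upd_twist add.commute)
  qed (use z d in \<open>auto simp: algebra_simps intro!: rep_cong\<close>)
  from runs_seq[OF this runs_clear[of "d + 2" w _ out]]
  show ?thesis using d unfolding times_def by (simp add: add.assoc)
qed

section \<open>Compilation of arithmetic expressions\<close>

datatype exp = Const nat | Var nat | Len | Add exp exp | Sub exp exp | Mul exp exp | Bit exp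

primrec eval :: "bool list \<Rightarrow> (nat \<Rightarrow> nat) \<Rightarrow> exp \<Rightarrow> nat" where
  "eval w \<sigma> (Const n) = n"
| "eval w \<sigma> (Var j) = \<sigma> j"
| "eval w \<sigma> Len = length w"
| "eval w \<sigma> (Add a b) = eval w \<sigma> a + eval w \<sigma> b"
| "eval w \<sigma> (Sub a b) = eval w \<sigma> a - eval w \<sigma> b"
| "eval w \<sigma> (Mul a b) = eval w \<sigma> a * eval w \<sigma> b"
| "eval w \<sigma> (Bit a) = of_bool (eval w \<sigma> a < length w \<and> w ! eval w \<sigma> a)"

primrec ok_exp :: "nat \<Rightarrow> exp \<Rightarrow> bool" where
  "ok_exp d (Const n) = True"
| "ok_exp d (Var j) = (2 \<le> j \<and> j < d)"
| "ok_exp d Len = True"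
| "ok_exp d (Add a b) = (ok_exp d a \<and> ok_exp d b)"
| "ok_exp d (Sub a b) = (ok_exp d a \<and> ok_exp d b)"
| "ok_exp d (Mul a b) = (ok_exp d a \<and> ok_exp d b)"
| "ok_exp d (Bit a) = ok_exp d a"

lemma eval_cong:
  "ok_exp d e \<Longrightarrow> (\<And>j. 2 \<le> j \<Longrightarrow> j < d \<Longrightarrow> \<sigma> j = \<sigma>' j) \<Longrightarrow> eval w \<sigma> e = eval w \<sigma>' e"
  by (induction e) auto

lemma ok_exp_mono: "ok_exp d e \<Longrightarrow> d \<le> d' \<Longrightarrow> ok_exp d' e"
  by (induction e) auto

lemma eval_upd: "ok_exp d e \<Longrightarrow> d \<le> j \<Longrightarrow> eval w (\<sigma>(j := v)) e = eval w \<sigma> e"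
  by (rule eval_cong) auto

primrec incs :: "nat \<Rightarrow> nat \<Rightarrow> machine" where
  "incs 0 d = skip"
| "incs (Suc n) d = seq (inc d) (incs n d)"

text \<open>Stack discipline: code for depth \<open>d\<close> leaves its value in counter
  \<open>d\<close>, takes scratch counters only from \<open>d\<close> on and restores the input
  head. A product accumulates in counter \<open>d\<close>, so its operands go to
  \<open>d + 1\<close> and \<open>d + 2\<close>. For \<open>Len\<close> the input head runs to the
  first blank, where its counter is one too large.\<close>

primrec cexp :: "exp \<Rightarrow> nat \<Rightarrow> machine" where
  "cexp (Const n) d = incs n d"
| "cexp (Var j) d = copy j d (Suc d)"
| "cexp Len d = seq (loop 0 (\<lambda>c. c \<noteq> 0) (inc 0)) (seq (transfer 0 d) (dec d))"
| "cexp (Add a b) d = seq (cexp a d) (seq (cexp b (Suc d)) (transfer (Suc d) d))"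
| "cexp (Sub a b) d = seq (cexp a d) (seq (cexp b (Suc d)) (monus (Suc d) d))"
| "cexp (Mul a b) d = seq (cexp a (Suc d)) (seq (cexp b (d + 2)) (times d))"
| "cexp (Bit a) d = seq (cexp a (Suc d)) (seq (transfer (Suc d) 0) (seq (inc 0)
     (seq (cond 0 (\<lambda>c. c = 2) (inc d) skip) (clear 0))))"

text \<open>Closure under sum, product and composition replaces explicit polynomials in the time
  analysis.\<close>

definition poly_bounded :: "(nat \<Rightarrow> nat) \<Rightarrow> bool" where
  "poly_bounded f \<longleftrightarrow> (\<exists>p :: nat poly. \<forall>m. f m \<le> poly p m)"

lemma poly_nat_mono: "x \<le> y \<Longrightarrow> poly (p :: nat poly) x \<le> poly p y"
  by (induction p) (auto intro!: add_mono mult_mono)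

lemma poly_bounded_const: "poly_bounded (\<lambda>m. c)"
  unfolding poly_bounded_def by (intro exI[of _ "[:c:]"]) simp

lemma poly_bounded_id: "poly_bounded (\<lambda>m. m)"
  unfolding poly_bounded_def by (intro exI[of _ "[:0, 1:]"]) simp

lemma poly_bounded_add: "poly_bounded f \<Longrightarrow> poly_bounded g \<Longrightarrow> poly_bounded (\<lambda>m. f m + g m)"
  unfolding poly_bounded_def by (metis add_mono poly_add)

lemma poly_bounded_mult: "poly_bounded f \<Longrightarrow> poly_bounded g \<Longrightarrow> poly_bounded (\<lambda>m. f m * g m)"
  unfolding poly_bounded_def by (metis mult_le_mono poly_mult)

lemma poly_bounded_comp:
  assumes "poly_bounded f" "poly_bounded g"
  shows "poly_bounded (\<lambda>m. f (g m))"
proof -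
  obtain p q where "\<forall>m. f m \<le> poly p m" "\<forall>m. g m \<le> poly q m"
    using assms by (auto simp: poly_bounded_def)
  then have "f (g m) \<le> poly (pcompose p q) m" for m
    using poly_nat_mono[of "g m" "poly q m" p] le_trans[of "f (g m)" "poly p (g m)"]
    by (auto simp: poly_pcompose)
  then show ?thesis by (auto simp: poly_bounded_def)
qed

lemmas poly_bounded_intros =
  poly_bounded_const poly_bounded_id poly_bounded_add poly_bounded_mult

text \<open>The calling convention of compiled code: input head on the marker, scratch counters
  empty, and a common bound \<open>m\<close> on all values, in terms of which time is
  measured.\<close>

definition clean :: "nat \<Rightarrow> nat \<Rightarrow> (nat \<Rightarrow> nat) \<Rightarrow> bool" where
  "clean d m \<sigma> \<longleftrightarrow> \<sigma> 0 = 0 \<and> (\<forall>j\<ge>d. \<sigma> j = 0) \<and> (\<forall>j. \<sigma> j \<le> m)"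

lemma clean_upd: "clean d m \<sigma> \<Longrightarrow> d \<ge> 2 \<Longrightarrow> v \<le> u \<Longrightarrow> clean (Suc d) (m + u) (\<sigma>(d := v))"
  by (auto simp: clean_def) (meson le_add1 le_trans)+

lemma clean_Suc: "clean d m \<sigma> \<Longrightarrow> clean (Suc d) m \<sigma>"
  by (auto simp: clean_def)

lemma runs_incs: "d \<noteq> 1 \<Longrightarrow> runs (incs n d) (rep w \<sigma> out) (rep w (\<sigma>(d := \<sigma> d + n)) out) n"
proof (induction n arbitrary: \<sigma>)
  case (Suc n)
  let ?s = "\<sigma>(d := Suc (\<sigma> d))"
  have "?s(d := ?s d + n) = \<sigma>(d := \<sigma> d + Suc n)" by auto
  then show ?case using runs_seq[OF runs_inc[OF Suc.prems, of w \<sigma> out] Suc.IH[OF Suc.prems, of ?s]]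
    unfolding incs.simps by (metis plus_1_eq_Suc)
qed (simp add: runs_skip)

lemma runs_Len:
  assumes d: "d \<ge> 2" and z: "\<sigma> 0 = 0" "\<sigma> d = 0"
  shows "runs (cexp Len d) (rep w \<sigma> out) (rep w (\<sigma>(d := length w)) out) (5 * length w + 8)"
proof -
  \<comment> \<open>A counter of value \<open>v\<close> is at cell \<open>v - 1\<close>, so the
    first blank, cell \<open>length w\<close>, is reached at value
    \<open>length w + 1\<close>.\<close>
  let ?n = "Suc (length w)"
  have "runs (loop 0 (\<lambda>c. c \<noteq> 0) (inc 0)) (rep w (\<sigma>(0 := 0)) out) (rep w (\<sigma>(0 := ?n)) out)
      (?n * (1 + 1) + 1)"
  proof (rule runs_loop_iter[where S = "\<lambda>i. rep w (\<sigma>(0 := i)) out"], intro conjI)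
    fix i assume "i < ?n"
    then show "reads (rep w (\<sigma>(0 := i)) out) 0 \<noteq> 0"
      by (auto simp: reads_def read_tape_def rep_def counter_tape_def inscription_def)
    show "runs (inc 0) (rep w (\<sigma>(0 := i)) out) (rep w (\<sigma>(0 := Suc i)) out) 1"
      using runs_inc[of 0 w "\<sigma>(0 := i)" out] by simp
  qed (simp add: reads_def read_tape_def rep_def counter_tape_def inscription_def)
  from runs_seq[OF this runs_seq[OF runs_transfer[of 0 d w "\<sigma>(0 := ?n)" out]
        runs_dec[of d w _ out]]]
  have "runs (cexp Len d) (rep w (\<sigma>(0 := 0)) out)
      (rep w (\<sigma>(0 := ?n, 0 := 0, d := ?n, d := length w)) out) (5 * length w + 8)"
    using d z by (simp add: add.commute)
  moreover have "\<sigma>(0 := ?n, 0 := 0, d := ?n, d := length w) = \<sigma>(d := length w)" "\<sigma>(0 := 0) = \<sigma>"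
    using z d by (auto simp: fun_eq_iff)
  ultimately show ?thesis by simp
qed

text \<open>The input head is used as a counter: cell \<open>v\<close> is scanned at value
  \<open>v + 1\<close>, which explains \<open>inc 0\<close>, and beyond the input the blank answers
  false.\<close>

lemma runs_Bit:
  assumes d: "d \<ge> 2" and z: "\<sigma> 0 = 0" "\<sigma> d = 0"
  shows "runs (seq (transfer (Suc d) 0) (seq (inc 0)
     (seq (cond 0 (\<lambda>c. c = 2) (inc d) skip) (clear 0)))) (rep w (\<sigma>(Suc d := v)) out)
    (rep w (\<sigma>(Suc d := 0, d := of_bool (v < length w \<and> w ! v))) out) (5 * v + 7)"
proof -
  let ?b = "v < length w \<and> w ! v"
  have "runs (transfer (Suc d) 0) (rep w (\<sigma>(Suc d := v)) out) (rep w (\<sigma>(Suc d := 0, 0 := v)) out)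
      (3 * v + 1)"
    using runs_transfer[of "Suc d" 0 w "\<sigma>(Suc d := v)" out] d z by simp
  moreover have "runs (inc 0) (rep w (\<sigma>(Suc d := 0, 0 := v)) out)
      (rep w (\<sigma>(Suc d := 0, 0 := Suc v)) out) 1"
    using runs_inc[of 0 w "\<sigma>(Suc d := 0, 0 := v)" out] by simp
  moreover have "runs (cond 0 (\<lambda>c. c = 2) (inc d) skip) (rep w (\<sigma>(Suc d := 0, 0 := Suc v)) out)
      (rep w (\<sigma>(Suc d := 0, 0 := Suc v, d := of_bool ?b)) out) (Suc 1)"
  proof -
    have r: "reads (rep w (\<sigma>(Suc d := 0, 0 := Suc v)) out) 0 = 2 \<longleftrightarrow> ?b"
      by (auto simp: reads_def read_tape_def rep_def counter_tape_def inscription_def)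
    show ?thesis
    proof (cases ?b)
      case True
      then show ?thesis using r d z runs_inc[of d w "\<sigma>(Suc d := 0, 0 := Suc v)" out]
        by (intro runs_cond_True) auto
    next
      case False
      then have "\<sigma>(Suc d := 0, 0 := Suc v, d := of_bool ?b) = \<sigma>(Suc d := 0, 0 := Suc v)"
        using z d by (auto simp: fun_eq_iff)
      then show ?thesis using r False runs_skip by (intro runs_cond_False) auto
    qed
  qed
  moreover have "runs (clear 0) (rep w (\<sigma>(Suc d := 0, 0 := Suc v, d := of_bool ?b)) out)
      (rep w (\<sigma>(Suc d := 0, d := of_bool ?b)) out) (2 * Suc v + 1)"
  proof -
    have "\<sigma>(Suc d := 0, 0 := Suc v, d := of_bool ?b, 0 := 0) = \<sigma>(Suc d := 0, d := of_bool ?b)"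
      using z d by (auto simp: fun_eq_iff)
    then show ?thesis
      using runs_clear[of 0 w "\<sigma>(Suc d := 0, 0 := Suc v, d := of_bool ?b)" out] d by simp
  qed
  ultimately have "runs (seq (transfer (Suc d) 0) (seq (inc 0)
     (seq (cond 0 (\<lambda>c. c = 2) (inc d) skip) (clear 0)))) (rep w (\<sigma>(Suc d := v)) out)
    (rep w (\<sigma>(Suc d := 0, d := of_bool ?b)) out) ((3 * v + 1) + (1 + (Suc 1 + (2 * Suc v + 1))))"
    by (intro runs_seq)
  then show ?thesis by (rule runs_mono) simp
qed

text \<open>One function bounds both value and time, since the value of a subexpression becomes a
  counter content, and thus a cost, for the code that follows.\<close>

definition computes :: "exp \<Rightarrow> nat \<Rightarrow> (nat \<Rightarrow> nat) \<Rightarrow> bool" where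
  "computes e d B \<longleftrightarrow> (\<forall>w \<sigma> out m. clean d m \<sigma> \<longrightarrow> length w \<le> m \<longrightarrow> eval w \<sigma> e \<le> B m \<and>
     runs (cexp e d) (rep w \<sigma> out) (rep w (\<sigma>(d := eval w \<sigma> e)) out) (B m))"

lemma computesD:
  assumes "computes e d B" "clean d m \<sigma>" "length w \<le> m"
  shows "eval w \<sigma> e \<le> B m"
    and "runs (cexp e d) (rep w \<sigma> out) (rep w (\<sigma>(d := eval w \<sigma> e)) out) (B m)"
  using assms unfolding computes_def by blast+

lemma computesI:
  assumes "\<And>w \<sigma> out m. clean d m \<sigma> \<Longrightarrow> length w \<le> m \<Longrightarrow> eval w \<sigma> e \<le> B m \<and>
     runs (cexp e d) (rep w \<sigma> out) (rep w (\<sigma>(d := eval w \<sigma> e)) out) (B m)"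
  shows "computes e d B"
  using assms unfolding computes_def by blast

text \<open>The second operand is evaluated while the first occupies a counter, hence the bound
  \<open>B2 (m + B1 m)\<close>; the nesting depth is fixed, so composing such bounds stays
  polynomial.\<close>

lemma cexp_computes:
  "d \<ge> 2 \<Longrightarrow> ok_exp d e \<Longrightarrow> \<exists>B. poly_bounded B \<and> computes e d B"
proof (induction e arbitrary: d)
  case (Const n)
  have "computes (Const n) d (\<lambda>m. n)"
  proof (rule computesI)
    fix w \<sigma> out m assume "clean d m \<sigma>"
    then have "\<sigma> d = 0" by (simp add: clean_def)
    then show "eval w \<sigma> (Const n) \<le> n \<and>
        runs (cexp (Const n) d) (rep w \<sigma> out) (rep w (\<sigma>(d := eval w \<sigma> (Const n))) out) n"
      using runs_incs[of d n w \<sigma> out] Const.prems by simp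
  qed
  then show ?case using poly_bounded_const by blast
next
  case (Var j)
  have "computes (Var j) d (\<lambda>m. 7 * m + 2)"
  proof (rule computesI)
    fix w \<sigma> out m assume "clean d m \<sigma>"
    then have "\<sigma> j \<le> m" "\<sigma> d = 0" "\<sigma> (Suc d) = 0" by (auto simp: clean_def)
    then show "eval w \<sigma> (Var j) \<le> 7 * m + 2 \<and> runs (cexp (Var j) d) (rep w \<sigma> out)
        (rep w (\<sigma>(d := eval w \<sigma> (Var j))) out) (7 * m + 2)"
      using runs_copy[of j d "Suc d" \<sigma> w out] Var.prems by (auto elim!: runs_mono)
  qed
  moreover have "poly_bounded (\<lambda>m. 7 * m + 2)" by (intro poly_bounded_intros)
  ultimately show ?case by blast
next
  case Len
  have "computes Len d (\<lambda>m. 5 * m + 8)"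
  proof (rule computesI)
    fix w :: "bool list" and \<sigma> out m assume c: "clean d m \<sigma>" "length w \<le> m"
    have "runs (cexp Len d) (rep w \<sigma> out) (rep w (\<sigma>(d := length w)) out) (5 * m + 8)"
      by (rule runs_mono[OF runs_Len]) (use c Len.prems in \<open>auto simp: clean_def\<close>)
    then show "eval w \<sigma> Len \<le> 5 * m + 8 \<and>
        runs (cexp Len d) (rep w \<sigma> out) (rep w (\<sigma>(d := eval w \<sigma> Len)) out) (5 * m + 8)"
      using c unfolding eval.simps by linarith
  qed
  moreover have "poly_bounded (\<lambda>m. 5 * m + 8)" by (intro poly_bounded_intros)
  ultimately show ?case by blast
next
  case (Add a b)
  then obtain B1 where B1: "poly_bounded B1" "computes a d B1" by auto
  have "ok_exp (Suc d) b" using Add.prems ok_exp_mono[of d b "Suc d"] by simp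
  then obtain B2 where B2: "poly_bounded B2" "computes b (Suc d) B2"
    using Add.IH(2)[of "Suc d"] Add.prems by auto
  let ?B = "\<lambda>m. B1 m + (B2 (m + B1 m) + (3 * B2 (m + B1 m) + 1))"
  have "computes (Add a b) d ?B"
  proof (rule computesI)
    fix w :: "bool list" and \<sigma> out m assume c: "clean d m \<sigma>" "length w \<le> m"
    let ?x = "eval w \<sigma> a" and ?y = "eval w \<sigma> b"
    note r1 = computesD[OF B1(2) c]
    have e: "eval w (\<sigma>(d := ?x)) b = ?y" using Add.prems by (intro eval_upd[of d]) auto
    have "clean (Suc d) (m + B1 m) (\<sigma>(d := ?x))" using clean_upd r1 c Add.prems by auto
    note r2 = computesD[OF B2(2) this trans_le_add1[OF c(2)], unfolded e]
    have "\<sigma>(d := ?x, Suc d := ?y, Suc d := 0, d := ?x + ?y) = \<sigma>(d := ?x + ?y)"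
      using c by (auto simp: fun_eq_iff clean_def)
    then have r3: "runs (transfer (Suc d) d) (rep w (\<sigma>(d := ?x, Suc d := ?y)) out)
        (rep w (\<sigma>(d := ?x + ?y)) out) (3 * B2 (m + B1 m) + 1)"
      using runs_transfer[of "Suc d" d w "\<sigma>(d := ?x, Suc d := ?y)" out] r2(1) Add.prems
      by (auto elim: runs_mono)
    have "eval w \<sigma> (Add a b) \<le> ?B m" using r1(1) r2(1) by simp
    moreover have "runs (cexp (Add a b) d) (rep w \<sigma> out)
        (rep w (\<sigma>(d := eval w \<sigma> (Add a b))) out) (?B m)"
      unfolding cexp.simps eval.simps by (rule runs_seq[OF r1(2) runs_seq[OF r2(2) r3]])
    ultimately show "eval w \<sigma> (Add a b) \<le> ?B m \<and> runs (cexp (Add a b) d) (rep w \<sigma> out)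
        (rep w (\<sigma>(d := eval w \<sigma> (Add a b))) out) (?B m)" ..
  qed
  moreover have "poly_bounded ?B" by (intro poly_bounded_intros B1(1) poly_bounded_comp[OF B2(1)])
  ultimately show ?case by blast
next
  case (Sub a b)
  then obtain B1 where B1: "poly_bounded B1" "computes a d B1" by auto
  have "ok_exp (Suc d) b" using Sub.prems ok_exp_mono[of d b "Suc d"] by simp
  then obtain B2 where B2: "poly_bounded B2" "computes b (Suc d) B2"
    using Sub.IH(2)[of "Suc d"] Sub.prems by auto
  let ?B = "\<lambda>m. B1 m + (B2 (m + B1 m) + (3 * B2 (m + B1 m) + 1))"
  have "computes (Sub a b) d ?B"
  proof (rule computesI)
    fix w :: "bool list" and \<sigma> out m assume c: "clean d m \<sigma>" "length w \<le> m"
    let ?x = "eval w \<sigma> a" and ?y = "eval w \<sigma> b"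
    note r1 = computesD[OF B1(2) c]
    have e: "eval w (\<sigma>(d := ?x)) b = ?y" using Sub.prems by (intro eval_upd[of d]) auto
    have "clean (Suc d) (m + B1 m) (\<sigma>(d := ?x))" using clean_upd r1 c Sub.prems by auto
    note r2 = computesD[OF B2(2) this trans_le_add1[OF c(2)], unfolded e]
    have "\<sigma>(d := ?x, Suc d := ?y, Suc d := 0, d := ?x - ?y) = \<sigma>(d := ?x - ?y)"
      using c by (auto simp: fun_eq_iff clean_def)
    then have r3: "runs (monus (Suc d) d) (rep w (\<sigma>(d := ?x, Suc d := ?y)) out)
        (rep w (\<sigma>(d := ?x - ?y)) out) (3 * B2 (m + B1 m) + 1)"
      using runs_monus[of "Suc d" d w "\<sigma>(d := ?x, Suc d := ?y)" out] r2(1) Sub.prems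
      by (auto elim: runs_mono)
    have "eval w \<sigma> (Sub a b) \<le> ?B m" using r1(1) r2(1) by simp
    moreover have "runs (cexp (Sub a b) d) (rep w \<sigma> out)
        (rep w (\<sigma>(d := eval w \<sigma> (Sub a b))) out) (?B m)"
      unfolding cexp.simps eval.simps by (rule runs_seq[OF r1(2) runs_seq[OF r2(2) r3]])
    ultimately show "eval w \<sigma> (Sub a b) \<le> ?B m \<and> runs (cexp (Sub a b) d) (rep w \<sigma> out)
        (rep w (\<sigma>(d := eval w \<sigma> (Sub a b))) out) (?B m)" ..
  qed
  moreover have "poly_bounded ?B" by (intro poly_bounded_intros B1(1) poly_bounded_comp[OF B2(1)])
  ultimately show ?case by blast
next
  case (Mul a b)
  have ok: "ok_exp (Suc d) a" "ok_exp (d + 2) b"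
    using Mul.prems ok_exp_mono[of d _ "Suc d"] ok_exp_mono[of d _ "d + 2"] by auto
  from Mul.IH(1)[of "Suc d"] Mul.prems ok obtain B1
    where B1: "poly_bounded B1" "computes a (Suc d) B1" by auto
  from Mul.IH(2)[of "d + 2"] Mul.prems ok obtain B2
    where B2: "poly_bounded B2" "computes b (d + 2) B2" by auto
  let ?C = "\<lambda>m. B1 m * (7 * B2 (m + B1 m) + 4) + 2 * B2 (m + B1 m) + 2"
  let ?B = "\<lambda>m. B1 m + (B2 (m + B1 m) + ?C m)"
  have "computes (Mul a b) d ?B"
  proof (rule computesI)
    fix w :: "bool list" and \<sigma> out m assume c: "clean d m \<sigma>" "length w \<le> m"
    let ?x = "eval w \<sigma> a" and ?y = "eval w \<sigma> b"
    note r1 = computesD[OF B1(2) clean_Suc[OF c(1)] c(2)]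
    have e: "eval w (\<sigma>(Suc d := ?x)) b = ?y" using Mul.prems by (intro eval_upd[of d]) auto
    have "clean (d + 2) (m + B1 m) (\<sigma>(Suc d := ?x))"
      using clean_upd[OF clean_Suc[OF c(1)]] r1 Mul.prems by auto
    note r2 = computesD[OF B2(2) this trans_le_add1[OF c(2)], unfolded e]
    have le: "?x * (7 * ?y + 4) + 2 * ?y + 2 \<le> ?C m"
      using r1(1) r2(1) by (intro add_mono mult_mono) auto
    have "\<sigma>(Suc d := ?x, d + 2 := ?y, d := ?x * ?y, Suc d := 0, d + 2 := 0) = \<sigma>(d := ?x * ?y)"
      using c by (auto simp: fun_eq_iff clean_def)
    then have "runs (times d) (rep w (\<sigma>(Suc d := ?x, d + 2 := ?y)) out)
        (rep w (\<sigma>(d := ?x * ?y)) out) (?x * (7 * ?y + 4) + 2 * ?y + 2)"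
      using runs_times[of d "\<sigma>(Suc d := ?x, d + 2 := ?y)" w out] c Mul.prems
      by (simp add: clean_def)
    from runs_mono[OF this le] have r3: "runs (times d) (rep w (\<sigma>(Suc d := ?x, d + 2 := ?y)) out)
        (rep w (\<sigma>(d := ?x * ?y)) out) (?C m)" .
    have "?x * ?y \<le> ?C m"
      using le by (rule order.trans[rotated]) (simp add: algebra_simps)
    then have "eval w \<sigma> (Mul a b) \<le> ?B m" by simp
    moreover have "runs (cexp (Mul a b) d) (rep w \<sigma> out)
        (rep w (\<sigma>(d := eval w \<sigma> (Mul a b))) out) (?B m)"
      unfolding cexp.simps eval.simps by (rule runs_seq[OF r1(2) runs_seq[OF r2(2) r3]])
    ultimately show "eval w \<sigma> (Mul a b) \<le> ?B m \<and> runs (cexp (Mul a b) d) (rep w \<sigma> out)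
        (rep w (\<sigma>(d := eval w \<sigma> (Mul a b))) out) (?B m)" ..
  qed
  moreover have "poly_bounded ?B" by (intro poly_bounded_intros B1(1) poly_bounded_comp[OF B2(1)])
  ultimately show ?case by blast
next
  case (Bit a)
  have "ok_exp (Suc d) a" using Bit.prems ok_exp_mono[of d a "Suc d"] by simp
  then obtain B1 where B1: "poly_bounded B1" "computes a (Suc d) B1"
    using Bit.IH[of "Suc d"] Bit.prems by auto
  let ?B = "\<lambda>m. B1 m + (5 * B1 m + 7)"
  have "computes (Bit a) d ?B"
  proof (rule computesI)
    fix w :: "bool list" and \<sigma> out m assume c: "clean d m \<sigma>" "length w \<le> m"
    let ?x = "eval w \<sigma> a"
    note r1 = computesD[OF B1(2) clean_Suc[OF c(1)] c(2)]
    have z: "\<sigma>(Suc d := 0) = \<sigma>" "\<sigma> 0 = 0" "\<sigma> d = 0" using c by (auto simp: clean_def)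
    have "runs (seq (transfer (Suc d) 0) (seq (inc 0)
        (seq (cond 0 (\<lambda>c. c = 2) (inc d) skip) (clear 0)))) (rep w (\<sigma>(Suc d := ?x)) out)
      (rep w (\<sigma>(d := eval w \<sigma> (Bit a))) out) (5 * ?x + 7)"
      using runs_Bit[of d \<sigma> w ?x out] Bit.prems z by simp
    then have r2: "runs (seq (transfer (Suc d) 0) (seq (inc 0)
        (seq (cond 0 (\<lambda>c. c = 2) (inc d) skip) (clear 0)))) (rep w (\<sigma>(Suc d := ?x)) out)
      (rep w (\<sigma>(d := eval w \<sigma> (Bit a))) out) (5 * B1 m + 7)"
      by (rule runs_mono) (use r1(1) in simp)
    have "eval w \<sigma> (Bit a) \<le> ?B m" by simp
    moreover have "runs (cexp (Bit a) d) (rep w \<sigma> out)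
        (rep w (\<sigma>(d := eval w \<sigma> (Bit a))) out) (?B m)"
      unfolding cexp.simps by (rule runs_seq[OF r1(2) r2])
    ultimately show "eval w \<sigma> (Bit a) \<le> ?B m \<and> runs (cexp (Bit a) d) (rep w \<sigma> out)
        (rep w (\<sigma>(d := eval w \<sigma> (Bit a))) out) (?B m)" ..
  qed
  moreover have "poly_bounded ?B" by (intro poly_bounded_intros B1(1))
  ultimately show ?case by blast
qed

section \<open>Binary output of a counter\<close>

text \<open>Counter \<open>d + 2\<close> flips between 0 and 1; each return to 0 adds one to the
  quotient in \<open>d + 1\<close>, and what is left in \<open>d + 2\<close> is the parity.\<close>

definition halve :: "nat \<Rightarrow> machine" where
  "halve d = down d (cond (d + 2) (\<lambda>c. c \<noteq> 3) (seq (dec (d + 2)) (inc (Suc d))) (inc (d + 2)))"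

lemma runs_halve:
  assumes d: "d \<ge> 2" and z: "\<sigma> (Suc d) = 0" "\<sigma> (d + 2) = 0"
  shows "runs (halve d) (rep w \<sigma> out)
    (rep w (\<sigma>(d := 0, Suc d := \<sigma> d div 2, d + 2 := \<sigma> d mod 2)) out) (5 * \<sigma> d + 1)"
  unfolding halve_def
proof (rule runs_down[where S = "\<lambda>i. \<sigma>(Suc d := i div 2, d + 2 := i mod 2)" and n = "\<sigma> d"
      and f = "\<lambda>_. out" and b = 3])
  fix i
  let ?s = "\<sigma>(Suc d := i div 2, d + 2 := i mod 2, d := \<sigma> d - Suc i)"
  have r: "reads (rep w ?s out) (d + 2) \<noteq> 3 \<longleftrightarrow> odd i"
    using d reads_rep_zero[of "d + 2" w ?s out] by (simp add: odd_iff_mod_2_eq_one)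
  show "runs (cond (d + 2) (\<lambda>c. c \<noteq> 3) (seq (dec (d + 2)) (inc (Suc d))) (inc (d + 2)))
     (rep w ?s out)
     (rep w (\<sigma>(Suc d := Suc i div 2, d + 2 := Suc i mod 2, d := \<sigma> d - Suc i)) out) 3"
  proof (cases "odd i")
    case True
    have "runs (seq (dec (d + 2)) (inc (Suc d))) (rep w ?s out)
        (rep w (?s(d + 2 := 0, Suc d := Suc (i div 2))) out) (1 + 1)"
      using runs_seq[OF runs_dec[of "d + 2" w ?s out] runs_inc[of "Suc d" w _ out]] True d
      by (simp add: odd_iff_mod_2_eq_one)
    moreover have "?s(d + 2 := 0, Suc d := Suc (i div 2)) =
        \<sigma>(Suc d := Suc i div 2, d + 2 := Suc i mod 2, d := \<sigma> d - Suc i)"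
      using True by (auto simp: fun_eq_iff odd_iff_mod_2_eq_one elim: oddE)
    ultimately have "runs (seq (dec (d + 2)) (inc (Suc d))) (rep w ?s out)
        (rep w (\<sigma>(Suc d := Suc i div 2, d + 2 := Suc i mod 2, d := \<sigma> d - Suc i)) out) (1 + 1)"
      by simp
    then show ?thesis using r True
      by (intro runs_mono[OF runs_cond_True[where P = "\<lambda>c. c \<noteq> 3"]]) auto
  next
    case False
    have "runs (inc (d + 2)) (rep w ?s out) (rep w (?s(d + 2 := 1)) out) 1"
      using runs_inc[of "d + 2" w ?s out] False d by (simp add: odd_iff_mod_2_eq_one)
    moreover have "?s(d + 2 := 1) =
        \<sigma>(Suc d := Suc i div 2, d + 2 := Suc i mod 2, d := \<sigma> d - Suc i)"
      using False by (auto simp: fun_eq_iff elim: evenE)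
    ultimately have "runs (inc (d + 2)) (rep w ?s out)
        (rep w (\<sigma>(Suc d := Suc i div 2, d + 2 := Suc i mod 2, d := \<sigma> d - Suc i)) out) 1"
      by simp
    then show ?thesis using r False
      by (intro runs_mono[OF runs_cond_False[where P = "\<lambda>c. c \<noteq> 3"]]) auto
  qed
qed (use d z in \<open>auto intro!: rep_cong\<close>)

definition print_digit :: "nat \<Rightarrow> machine" where
  "print_digit d = seq (emit True) (seq (halve d) (seq (cond (d + 2) (\<lambda>c. c \<noteq> 3)
     (seq (emit True) (dec (d + 2))) (emit False)) (transfer (Suc d) d)))"

lemma runs_print_digit:
  assumes d: "d \<ge> 2" and z: "\<sigma> (Suc d) = 0" "\<sigma> (d + 2) = 0"
  shows "runs (print_digit d) (rep w \<sigma> out)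
    (rep w (\<sigma>(d := \<sigma> d div 2)) (out @ [True, odd (\<sigma> d)])) (8 * \<sigma> d + 6)"
proof -
  let ?v = "\<sigma> d"
  let ?s = "\<sigma>(d := 0, Suc d := ?v div 2, d + 2 := ?v mod 2)"
  have "runs (emit True) (rep w \<sigma> out) (rep w \<sigma> (out @ [True])) 1" by (rule runs_emit)
  moreover have "runs (halve d) (rep w \<sigma> (out @ [True])) (rep w ?s (out @ [True])) (5 * ?v + 1)"
    using runs_halve[OF d z] .
  moreover have "runs (cond (d + 2) (\<lambda>c. c \<noteq> 3) (seq (emit True) (dec (d + 2))) (emit False))
      (rep w ?s (out @ [True])) (rep w (\<sigma>(d := 0, Suc d := ?v div 2)) (out @ [True, odd ?v])) 3"
  proof (cases "odd ?v")
    case True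
    have "runs (seq (emit True) (dec (d + 2))) (rep w ?s (out @ [True]))
        (rep w (?s(d + 2 := 0)) (out @ [True, True])) (1 + 1)"
      using runs_seq[OF runs_emit[of True w ?s "out @ [True]"] runs_dec[of "d + 2" w]] True d
      by (simp add: odd_iff_mod_2_eq_one)
    moreover have "?s(d + 2 := 0) = \<sigma>(d := 0, Suc d := ?v div 2)"
      using z by (auto simp: fun_eq_iff)
    ultimately show ?thesis using True d reads_rep_zero[of "d + 2" w ?s "out @ [True]"]
      by (auto simp: odd_iff_mod_2_eq_one intro!: runs_mono[OF runs_cond_True])
  next
    case False
    have "?s = \<sigma>(d := 0, Suc d := ?v div 2)"
      using z False by (auto simp: fun_eq_iff)
    then show ?thesis using False d reads_rep_zero[of "d + 2" w ?s "out @ [True]"]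
        runs_emit[of False w ?s "out @ [True]"]
      by (auto intro!: runs_mono[OF runs_cond_False])
  qed
  moreover have "runs (transfer (Suc d) d) (rep w (\<sigma>(d := 0, Suc d := ?v div 2)) (out @ [True, odd ?v]))
      (rep w (\<sigma>(d := ?v div 2)) (out @ [True, odd ?v])) (3 * ?v + 1)"
  proof -
    have "\<sigma>(d := 0, Suc d := 0, d := ?v div 2) = \<sigma>(d := ?v div 2)"
      using z by (auto simp: fun_eq_iff)
    then show ?thesis
      using runs_transfer[of "Suc d" d w "\<sigma>(d := 0, Suc d := ?v div 2)" "out @ [True, odd ?v]"] d
      by (auto elim!: runs_mono)
  qed
  ultimately have "runs (print_digit d) (rep w \<sigma> out) (rep w (\<sigma>(d := ?v div 2)) (out @ [True, odd ?v]))
      (1 + ((5 * ?v + 1) + (3 + (3 * ?v + 1))))"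
    unfolding print_digit_def by (intro runs_seq)
  then show ?thesis by (rule runs_mono) simp
qed

definition print_nat :: "nat \<Rightarrow> machine" where
  "print_nat d = seq (loop d (\<lambda>c. c \<noteq> 3) (print_digit d)) (emit False)"

lemma runs_print_nat:
  assumes d: "d \<ge> 2" and z: "\<sigma> d = 0" "\<sigma> (Suc d) = 0" "\<sigma> (d + 2) = 0"
  shows "runs (print_nat d) (rep w (\<sigma>(d := v)) out) (rep w \<sigma> (out @ enc_nat v))
    (v * (8 * v + 7) + 2)"
proof -
  have "runs (loop d (\<lambda>c. c \<noteq> 3) (print_digit d)) (rep w (\<sigma>(d := v)) out)
    (rep w (\<sigma>(d := 0)) (out @ concat (map (\<lambda>b. [True, b]) (bin_digits v)))) (v * (8 * v + 7) + 1)"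
  proof (induction v arbitrary: out rule: less_induct)
    case (less v)
    show ?case
    proof (cases "v = 0")
      case True
      have "runs (loop d (\<lambda>c. c \<noteq> 3) (print_digit d)) (rep w (\<sigma>(d := 0)) out)
          (rep w (\<sigma>(d := 0)) out) 1"
        using d reads_rep_zero[of d w "\<sigma>(d := 0)" out] by (intro runs_loop_False) simp
      then show ?thesis unfolding True by (simp add: bin_digits.simps[of 0] del: fun_upd_apply)
    next
      case False
      then have lt: "v div 2 < v" by simp
      have "runs (print_digit d) (rep w (\<sigma>(d := v)) out)
          (rep w (\<sigma>(d := v div 2)) (out @ [True, odd v])) (8 * v + 6)"
        using runs_print_digit[of d "\<sigma>(d := v)" w out] d z by simp
      moreover have "reads (rep w (\<sigma>(d := v)) out) d \<noteq> 3"
        using False d reads_rep_zero[of d w "\<sigma>(d := v)" out] by simp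
      ultimately have r: "runs (loop d (\<lambda>c. c \<noteq> 3) (print_digit d)) (rep w (\<sigma>(d := v)) out)
          (rep w (\<sigma>(d := 0))
            ((out @ [True, odd v]) @ concat (map (\<lambda>b. [True, b]) (bin_digits (v div 2)))))
          ((8 * v + 6) + ((v div 2) * (8 * (v div 2) + 7) + 1) + 1)"
        using less[OF lt, of "out @ [True, odd v]"] by (intro runs_loop_True)
      \<comment> \<open>As \<open>v div 2\<close> is at most \<open>v - 1\<close>, all later rounds
        together cost at most \<open>v - 1\<close> times the allowance \<open>8 * v + 7\<close> of
        the present one.\<close>
      have "(v div 2) * (8 * (v div 2) + 7) \<le> (v - 1) * (8 * v + 7)"
        using lt by (intro mult_mono) auto
      moreover have "v * (8 * v + 7) = (8 * v + 7) + (v - 1) * (8 * v + 7)"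
        using False by (cases v) (auto simp: algebra_simps)
      ultimately have "(8 * v + 6) + ((v div 2) * (8 * (v div 2) + 7) + 1) + 1 \<le> v * (8 * v + 7) + 1"
        by simp
      moreover have "bin_digits v = odd v # bin_digits (v div 2)"
        using False by (simp add: bin_digits.simps[of v])
      ultimately show ?thesis using runs_mono[OF r] by (simp del: fun_upd_apply)
    qed
  qed
  moreover have "\<sigma>(d := 0) = \<sigma>" using z by auto
  ultimately have "runs (loop d (\<lambda>c. c \<noteq> 3) (print_digit d)) (rep w (\<sigma>(d := v)) out)
    (rep w \<sigma> (out @ concat (map (\<lambda>b. [True, b]) (bin_digits v)))) (v * (8 * v + 7) + 1)" by simp
  from runs_seq[OF this runs_emit[of False]] show ?thesis
    by (simp add: print_nat_def enc_nat_def enc_list_def)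
qed

section \<open>A printing language\<close>

datatype stmt = Out bool | OutNat exp | Then stmt stmt | Test exp stmt stmt | For exp stmt

text \<open>
  The loop at depth \<open>d\<close> binds variable \<open>d\<close>; variable \<open>d + 1\<close> counts the remaining iterations.
\<close>

primrec sem :: "bool list \<Rightarrow> nat \<Rightarrow> (nat \<Rightarrow> nat) \<Rightarrow> stmt \<Rightarrow> bool list" where
  "sem w d \<sigma> (Out b) = [b]"
| "sem w d \<sigma> (OutNat e) = enc_nat (eval w \<sigma> e)"
| "sem w d \<sigma> (Then a b) = sem w d \<sigma> a @ sem w d \<sigma> b"
| "sem w d \<sigma> (Test e a b) = (if eval w \<sigma> e \<noteq> 0 then sem w d \<sigma> a else sem w d \<sigma> b)"
| "sem w d \<sigma> (For e a) = concat (map (\<lambda>i. sem w (d + 2) (\<sigma>(d := i, Suc d := eval w \<sigma> e - Suc i)) a)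
     [0..<eval w \<sigma> e])"

primrec ok_stmt :: "nat \<Rightarrow> stmt \<Rightarrow> bool" where
  "ok_stmt d (Out b) = True"
| "ok_stmt d (OutNat e) = ok_exp d e"
| "ok_stmt d (Then a b) = (ok_stmt d a \<and> ok_stmt d b)"
| "ok_stmt d (Test e a b) = (ok_exp d e \<and> ok_stmt d a \<and> ok_stmt d b)"
| "ok_stmt d (For e a) = (ok_exp d e \<and> ok_stmt (d + 2) a)"

text \<open>\<open>For\<close> evaluates its bound directly into \<open>d + 1\<close>, which then
  counts down while \<open>d\<close> counts up. In \<open>Test\<close> only the branch for a nonzero
  value has to empty counter \<open>d\<close>.\<close>

primrec cstmt :: "stmt \<Rightarrow> nat \<Rightarrow> machine" where
  "cstmt (Out b) d = emit b"
| "cstmt (OutNat e) d = seq (cexp e d) (print_nat d)"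
| "cstmt (Then a b) d = seq (cstmt a d) (cstmt b d)"
| "cstmt (Test e a b) d =
     seq (cexp e d) (cond d (\<lambda>c. c \<noteq> 3) (seq (clear d) (cstmt a d)) (cstmt b d))"
| "cstmt (For e a) d =
     seq (cexp e (Suc d)) (seq (down (Suc d) (seq (cstmt a (d + 2)) (inc d))) (clear d))"

definition prints :: "stmt \<Rightarrow> nat \<Rightarrow> (nat \<Rightarrow> nat) \<Rightarrow> bool" where
  "prints s d B \<longleftrightarrow> (\<forall>w \<sigma> out m. clean d m \<sigma> \<longrightarrow> length w \<le> m \<longrightarrow>
     runs (cstmt s d) (rep w \<sigma> out) (rep w \<sigma> (out @ sem w d \<sigma> s)) (B m))"

lemma printsD:
  assumes "prints s d B" "clean d m \<sigma>" "length w \<le> m"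
  shows "runs (cstmt s d) (rep w \<sigma> out) (rep w \<sigma> (out @ sem w d \<sigma> s)) (B m)"
  using assms unfolding prints_def by blast

lemma printsI:
  assumes "\<And>w \<sigma> out m. clean d m \<sigma> \<Longrightarrow> length w \<le> m \<Longrightarrow>
     runs (cstmt s d) (rep w \<sigma> out) (rep w \<sigma> (out @ sem w d \<sigma> s)) (B m)"
  shows "prints s d B"
  using assms unfolding prints_def by blast

text \<open>Inside a loop the two new counters are at most the number of iterations, which
  \<open>B0 m\<close> bounds; so the body runs under the bound \<open>m + B0 m\<close> and is
  repeated at most \<open>B0 m\<close> times.\<close>

lemma cstmt_prints:
  "d \<ge> 2 \<Longrightarrow> ok_stmt d s \<Longrightarrow> \<exists>B. poly_bounded B \<and> prints s d B"
proof (induction s arbitrary: d)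
  case (Out b)
  have "prints (Out b) d (\<lambda>m. 1)" unfolding prints_def cstmt.simps sem.simps
    by (intro allI impI runs_emit)
  then show ?case using poly_bounded_const by blast
next
  case (OutNat e)
  then obtain B1 where B1: "poly_bounded B1" "computes e d B1"
    using cexp_computes[of d e] by auto
  let ?B = "\<lambda>m. B1 m + (B1 m * (8 * B1 m + 7) + 2)"
  have "prints (OutNat e) d ?B"
  proof (rule printsI)
    fix w :: "bool list" and \<sigma> out m assume c: "clean d m \<sigma>" "length w \<le> m"
    let ?v = "eval w \<sigma> e"
    note r1 = computesD[OF B1(2) c]
    have "?v * (8 * ?v + 7) + 2 \<le> B1 m * (8 * B1 m + 7) + 2"
      using r1(1) by (intro add_mono mult_mono) auto
    moreover have "runs (print_nat d) (rep w (\<sigma>(d := ?v)) out) (rep w \<sigma> (out @ enc_nat ?v))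
        (?v * (8 * ?v + 7) + 2)"
      using runs_print_nat[of d \<sigma> w ?v out] c OutNat.prems by (simp add: clean_def)
    ultimately have "runs (print_nat d) (rep w (\<sigma>(d := ?v)) out) (rep w \<sigma> (out @ enc_nat ?v))
        (B1 m * (8 * B1 m + 7) + 2)" using runs_mono by blast
    from runs_seq[OF r1(2) this]
    show "runs (cstmt (OutNat e) d) (rep w \<sigma> out) (rep w \<sigma> (out @ sem w d \<sigma> (OutNat e))) (?B m)"
      unfolding cstmt.simps sem.simps .
  qed
  moreover have "poly_bounded ?B" by (intro poly_bounded_intros B1(1))
  ultimately show ?case by blast
next
  case (Then a b)
  from Then.IH(1)[of d] Then.prems obtain B1 where B1: "poly_bounded B1" "prints a d B1" by auto
  from Then.IH(2)[of d] Then.prems obtain B2 where B2: "poly_bounded B2" "prints b d B2" by auto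
  have "prints (Then a b) d (\<lambda>m. B1 m + B2 m)"
  proof (rule printsI)
    fix w :: "bool list" and \<sigma> out m assume c: "clean d m \<sigma>" "length w \<le> m"
    from runs_seq[OF printsD[OF B1(2) c] printsD[OF B2(2) c]]
    show "runs (cstmt (Then a b) d) (rep w \<sigma> out) (rep w \<sigma> (out @ sem w d \<sigma> (Then a b)))
      (B1 m + B2 m)" by simp
  qed
  moreover have "poly_bounded (\<lambda>m. B1 m + B2 m)" by (intro poly_bounded_intros B1(1) B2(1))
  ultimately show ?case by blast
next
  case (Test e a b)
  from Test.prems obtain B0 where B0: "poly_bounded B0" "computes e d B0"
    using cexp_computes[of d e] by auto
  from Test.IH(1)[of d] Test.prems obtain B1 where B1: "poly_bounded B1" "prints a d B1" by auto
  from Test.IH(2)[of d] Test.prems obtain B2 where B2: "poly_bounded B2" "prints b d B2" by auto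
  let ?B = "\<lambda>m. B0 m + (2 * B0 m + B1 m + B2 m + 2)"
  have "prints (Test e a b) d ?B"
  proof (rule printsI)
    fix w :: "bool list" and \<sigma> out m assume c: "clean d m \<sigma>" "length w \<le> m"
    let ?v = "eval w \<sigma> e"
    note r0 = computesD[OF B0(2) c]
    have z: "\<sigma>(d := 0) = \<sigma>" using c by (auto simp: clean_def)
    have r: "reads (rep w (\<sigma>(d := ?v)) out) d \<noteq> 3 \<longleftrightarrow> ?v \<noteq> 0"
      using reads_rep_zero[of d w "\<sigma>(d := ?v)" out] Test.prems by simp
    have "runs (cond d (\<lambda>c. c \<noteq> 3) (seq (clear d) (cstmt a d)) (cstmt b d))
        (rep w (\<sigma>(d := ?v)) out) (rep w \<sigma> (out @ sem w d \<sigma> (Test e a b)))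
        (2 * B0 m + B1 m + B2 m + 2)"
    proof (cases "?v = 0")
      case False
      have "runs (clear d) (rep w (\<sigma>(d := ?v)) out) (rep w \<sigma> out) (2 * ?v + 1)"
        using runs_clear[of d w "\<sigma>(d := ?v)" out] Test.prems z by simp
      from runs_seq[OF this printsD[OF B1(2) c]]
      have "runs (cond d (\<lambda>c. c \<noteq> 3) (seq (clear d) (cstmt a d)) (cstmt b d))
          (rep w (\<sigma>(d := ?v)) out) (rep w \<sigma> (out @ sem w d \<sigma> a)) (Suc (2 * ?v + 1 + B1 m))"
        using r False by (intro runs_cond_True) auto
      then show ?thesis using False r0(1) by (auto elim!: runs_mono)
    next
      case True
      have "runs (cond d (\<lambda>c. c \<noteq> 3) (seq (clear d) (cstmt a d)) (cstmt b d))
          (rep w \<sigma> out) (rep w \<sigma> (out @ sem w d \<sigma> b)) (Suc (B2 m))"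
        using r True z printsD[OF B2(2) c] by (intro runs_cond_False) auto
      then show ?thesis using True z by (auto elim!: runs_mono)
    qed
    from runs_seq[OF r0(2) this]
    show "runs (cstmt (Test e a b) d) (rep w \<sigma> out) (rep w \<sigma> (out @ sem w d \<sigma> (Test e a b))) (?B m)"
      unfolding cstmt.simps .
  qed
  moreover have "poly_bounded ?B" by (intro poly_bounded_intros B0(1) B1(1) B2(1))
  ultimately show ?case by blast
next
  case (For e a)
  from For.prems obtain B0 where B0: "poly_bounded B0" "computes e (Suc d) B0"
    using cexp_computes[of "Suc d" e] ok_exp_mono[of d e "Suc d"] by auto
  from For.IH[of "d + 2"] For.prems obtain B1
    where B1: "poly_bounded B1" "prints a (d + 2) B1" by auto
  let ?b = "\<lambda>m. B1 (m + B0 m) + 1"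
  let ?B = "\<lambda>m. B0 m + ((B0 m * (?b m + 2) + 1) + (2 * B0 m + 1))"
  have "prints (For e a) d ?B"
  proof (rule printsI)
    fix w :: "bool list" and \<sigma> out m assume c: "clean d m \<sigma>" "length w \<le> m"
    let ?n = "eval w \<sigma> e"
    note r0 = computesD[OF B0(2) clean_Suc[OF c(1)] c(2)]
    have z: "\<sigma> d = 0" "\<sigma> (Suc d) = 0" using c by (auto simp: clean_def)
    define f where "f i = sem w (d + 2) (\<sigma>(d := i, Suc d := ?n - Suc i)) a" for i
    define g where "g i = out @ concat (map f [0..<i])" for i
    have g: "g ?n = out @ sem w d \<sigma> (For e a)" by (simp add: g_def f_def[abs_def])
    have r1: "runs (down (Suc d) (seq (cstmt a (d + 2)) (inc d))) (rep w (\<sigma>(Suc d := ?n)) out)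
        (rep w (\<sigma>(d := ?n)) (g ?n)) (B0 m * (?b m + 2) + 1)"
    proof (rule runs_down[where S = "\<lambda>i. \<sigma>(d := i)" and n = ?n and f = g and b = "?b m"])
      fix i assume i: "i < ?n"
      let ?s = "\<sigma>(d := i, Suc d := ?n - Suc i)"
      have "clean (d + 2) (m + B0 m) ?s"
        using c i r0(1)[of] For.prems by (auto simp: clean_def trans_le_add1)
      from runs_seq[OF printsD[OF B1(2) this trans_le_add1[OF c(2)], of "g i"] runs_inc[of d w ?s]]
        For.prems
      have "runs (seq (cstmt a (d + 2)) (inc d)) (rep w ?s (g i))
          (rep w (?s(d := Suc i)) (g i @ f i)) (?b m)" by (simp add: f_def)
      moreover have "g i @ f i = g (Suc i)" by (simp add: g_def)
      moreover have "?s(d := Suc i) = \<sigma>(d := Suc i, Suc d := ?n - Suc i)"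
        by (simp add: fun_upd_twist)
      ultimately show "runs (seq (cstmt a (d + 2)) (inc d)) (rep w ?s (g i))
          (rep w (\<sigma>(d := Suc i, Suc d := ?n - Suc i)) (g (Suc i))) (?b m)" by simp
    next
      show "?n * (?b m + 2) + 1 \<le> B0 m * (?b m + 2) + 1"
        using r0(1) by (intro add_mono mult_mono) auto
      show "rep w (\<sigma>(Suc d := ?n)) out = rep w (\<sigma>(d := 0, Suc d := ?n)) (g 0)"
        using z by (auto simp: g_def intro!: rep_cong)
      show "rep w (\<sigma>(d := ?n)) (g ?n) = rep w (\<sigma>(d := ?n, Suc d := 0)) (g ?n)"
        using z by (auto intro!: rep_cong)
    qed (use For.prems in auto)
    have "\<sigma>(d := 0) = \<sigma>" using z by auto
    then have "runs (clear d) (rep w (\<sigma>(d := ?n)) (g ?n)) (rep w \<sigma> (g ?n)) (2 * ?n + 1)"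
      using runs_clear[of d w "\<sigma>(d := ?n)" "g ?n"] For.prems by simp
    then have r2: "runs (clear d) (rep w (\<sigma>(d := ?n)) (g ?n)) (rep w \<sigma> (g ?n)) (2 * B0 m + 1)"
      by (rule runs_mono) (use r0(1) in simp)
    show "runs (cstmt (For e a) d) (rep w \<sigma> out) (rep w \<sigma> (out @ sem w d \<sigma> (For e a))) (?B m)"
      using runs_seq[OF r0(2) runs_seq[OF r1 r2]] unfolding cstmt.simps g .
  qed
  moreover have "poly_bounded ?B" by (intro poly_bounded_intros B0(1) poly_bounded_comp[OF B1(1)])
  ultimately show ?case by blast
qed

section \<open>Finiteness of compiled programs\<close>

lemma wf_inc: "wf_m K 4 (inc j)"
  unfolding inc_def by (intro wf_act) auto

lemma wf_dec: "wf_m K 4 (dec j)"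
  unfolding dec_def by (intro wf_act) auto

lemma wf_emit: "wf_m K 4 (emit b)"
  unfolding emit_def by (intro wf_act) auto

lemma wf_incs: "wf_m K 4 (incs n j)"
  by (induction n) (auto intro: wf_skip wf_seq wf_inc)

lemma wf_down: "wf_m K 4 m \<Longrightarrow> j < K \<Longrightarrow> wf_m K 4 (down j m)"
  unfolding down_def by (intro wf_loop wf_seq wf_dec)

lemma wf_counter_ops:
  "j < K \<Longrightarrow> wf_m K 4 (transfer j l)"
  "j < K \<Longrightarrow> wf_m K 4 (clear j)"
  "j < K \<Longrightarrow> wf_m K 4 (monus j l)"
  "j < K \<Longrightarrow> u < K \<Longrightarrow> wf_m K 4 (copy j l u)"
  "d + 3 < K \<Longrightarrow> wf_m K 4 (times d)"
  "d + 2 < K \<Longrightarrow> wf_m K 4 (print_nat d)"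
  unfolding transfer_def clear_def monus_def copy_def times_def print_nat_def print_digit_def halve_def
  by (auto intro!: wf_down wf_skip wf_seq wf_inc wf_dec wf_loop wf_cond wf_emit)

text \<open>How many tapes are needed depends on the program; the claim for all larger
  \<open>K\<close> lets its parts agree on a common number.\<close>

lemma wf_cexp: "\<exists>K0. \<forall>K\<ge>K0. wf_m K 4 (cexp e d)"
proof (induction e arbitrary: d)
  case (Add a b)
  then obtain K1 K2 where "\<forall>K\<ge>K1. wf_m K 4 (cexp a d)" "\<forall>K\<ge>K2. wf_m K 4 (cexp b (Suc d))" by blast
  then show ?case
    by (intro exI[of _ "K1 + K2 + d + 2"]) (auto intro!: wf_seq wf_counter_ops)
next
  case (Sub a b)
  then obtain K1 K2 where "\<forall>K\<ge>K1. wf_m K 4 (cexp a d)" "\<forall>K\<ge>K2. wf_m K 4 (cexp b (Suc d))" by blast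
  then show ?case
    by (intro exI[of _ "K1 + K2 + d + 2"]) (auto intro!: wf_seq wf_counter_ops)
next
  case (Mul a b)
  then obtain K1 K2 where "\<forall>K\<ge>K1. wf_m K 4 (cexp a (Suc d))" "\<forall>K\<ge>K2. wf_m K 4 (cexp b (d + 2))"
    by blast
  then show ?case
    by (intro exI[of _ "K1 + K2 + d + 4"]) (auto intro!: wf_seq wf_counter_ops)
next
  case (Bit a)
  then obtain K1 where "\<forall>K\<ge>K1. wf_m K 4 (cexp a (Suc d))" by blast
  then show ?case
    by (intro exI[of _ "K1 + d + 4"])
      (auto intro!: wf_seq wf_counter_ops wf_cond wf_inc wf_skip)
next
  case (Const n)
  then show ?case by (auto intro: wf_incs)
next
  case (Var j)
  then show ?case by (intro exI[of _ "j + d + 2"]) (auto intro!: wf_counter_ops)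
next
  case Len
  then show ?case by (intro exI[of _ 1]) (auto intro!: wf_seq wf_counter_ops wf_loop wf_inc wf_dec)
qed

lemma wf_cstmt: "\<exists>K0. \<forall>K\<ge>K0. wf_m K 4 (cstmt s d)"
proof (induction s arbitrary: d)
  case (Out b)
  then show ?case by (auto intro: wf_emit)
next
  case (OutNat e)
  obtain K1 where "\<forall>K\<ge>K1. wf_m K 4 (cexp e d)" using wf_cexp by blast
  then show ?case
    by (intro exI[of _ "K1 + d + 3"]) (auto intro!: wf_seq wf_counter_ops)
next
  case (Then a b)
  then obtain K1 K2 where "\<forall>K\<ge>K1. wf_m K 4 (cstmt a d)" "\<forall>K\<ge>K2. wf_m K 4 (cstmt b d)" by blast
  then show ?case by (intro exI[of _ "K1 + K2"]) (auto intro!: wf_seq)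
next
  case (Test e a b)
  then obtain K1 K2 where "\<forall>K\<ge>K1. wf_m K 4 (cstmt a d)" "\<forall>K\<ge>K2. wf_m K 4 (cstmt b d)" by blast
  moreover obtain K3 where "\<forall>K\<ge>K3. wf_m K 4 (cexp e d)" using wf_cexp by blast
  ultimately show ?case
    by (intro exI[of _ "K1 + K2 + K3 + d + 1"]) (auto intro!: wf_seq wf_counter_ops wf_cond)
next
  case (For e a)
  then obtain K1 where "\<forall>K\<ge>K1. wf_m K 4 (cstmt a (d + 2))" by blast
  moreover obtain K3 where "\<forall>K\<ge>K3. wf_m K 4 (cexp e (Suc d))" using wf_cexp by blast
  ultimately show ?case
    by (intro exI[of _ "K1 + K3 + d + 2"]) (auto intro!: wf_seq wf_counter_ops wf_down wf_inc)
qed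

definition poly_time :: "(bool list \<Rightarrow> bool list) \<Rightarrow> bool" where
  "poly_time f \<longleftrightarrow>
     (\<exists>M (p :: nat poly). wf_tm M \<and> (\<forall>x. outputs_within M x (f x) (poly p (length x))))"

text \<open>Turns every tape except the output into a counter of value 0, by one step to the left
  and writing the marker there.\<close>

definition prepare :: machine where
  "prepare = seq (act (\<lambda>s j. (s j, if j = 1 then Stay else MoveLeft)))
     (act (\<lambda>s j. (if j = 1 then s j else 3, Stay)))"

lemma runs_prepare: "runs prepare (init_tapes x) (rep x (\<lambda>_. 0) []) 2"
proof -
  let ?f = "\<lambda>s j. (s j, if j = 1 then Stay else MoveLeft)"
  let ?g = "\<lambda>s j. (if j = 1 then s j else 3, Stay)"
  let ?T = "acts (init_tapes x) (?f (reads (init_tapes x)))"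
  have "acts ?T (?g (reads ?T)) = rep x (\<lambda>_. 0) []"
    by (auto simp: fun_eq_iff acts_def act_tape_def reads_def read_tape_def init_tapes_def rep_def
        counter_tape_def inscription_def)
  then show ?thesis
    using runs_seq[OF runs_act[of ?f "init_tapes x"] runs_act[of ?g ?T]]
    unfolding prepare_def by (simp add: numeral_2_eq_2)
qed

theorem poly_time_sem:
  assumes "ok_stmt 2 s"
  shows "poly_time (\<lambda>w. sem w 2 (\<lambda>_. 0) s)"
proof -
  obtain K0 where K0: "\<forall>K\<ge>K0. wf_m K 4 (cstmt s 2)" using wf_cstmt by blast
  obtain B where B: "poly_bounded B" "prints s 2 B" using cstmt_prints[of 2 s] assms by auto
  have "poly_bounded (\<lambda>m. 2 + B m)" by (intro poly_bounded_intros B(1))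
  then obtain p :: "nat poly" where p: "\<And>m. 2 + B m \<le> poly p m" by (auto simp: poly_bounded_def)
  let ?m = "seq prepare (cstmt s 2)"
  let ?K = "K0 + 2"
  have wf: "wf_m ?K 4 ?m" unfolding prepare_def using K0 by (intro wf_seq wf_act) auto
  have "outputs_within (to_tm ?K 4 ?m) w (sem w 2 (\<lambda>_. 0) s) (poly p (length w))" for w
  proof (rule to_tm_outputs[OF wf])
    have "runs (cstmt s 2) (rep w (\<lambda>_. 0) []) (rep w (\<lambda>_. 0) (sem w 2 (\<lambda>_. 0) s)) (B (length w))"
      using printsD[OF B(2), of "length w" "\<lambda>_. 0" w "[]"] by (simp add: clean_def)
    from runs_seq[OF runs_prepare this] p
    show "runs ?m (init_tapes w) (rep w (\<lambda>_. 0) (sem w 2 (\<lambda>_. 0) s)) (poly p (length w))"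
      by (auto elim: runs_mono)
  qed (auto simp: rep_def)
  moreover have "wf_tm (to_tm ?K 4 ?m)" using wf by (intro wf_to_tm) auto
  ultimately show ?thesis unfolding poly_time_def by blast
qed

section \<open>Finite state transducers\<close>

text \<open>Parsing a prefix code carries a state from bit to bit, whereas the printing language has
  loop counters as its only variables; hence this second kind of program.\<close>

primrec transduce :: "(nat \<Rightarrow> bool \<Rightarrow> nat \<times> bool option) \<Rightarrow> nat \<Rightarrow> bool list \<Rightarrow> bool list" where
  "transduce \<delta> q [] = []"
| "transduce \<delta> q (b # x) =
     (case snd (\<delta> q b) of None \<Rightarrow> [] | Some c \<Rightarrow> [c]) @ transduce \<delta> (fst (\<delta> q b)) x"

definition transducer :: "nat \<Rightarrow> (nat \<Rightarrow> bool \<Rightarrow> nat \<times> bool option) \<Rightarrow> machine" where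
  "transducer n \<delta> = Machine n (\<lambda>q s.
     if s 0 = 0 then (n, stay s)
     else (fst (\<delta> q (s 0 = 2)), \<lambda>j.
       if j = 0 then (s 0, MoveRight)
       else if j = 1 then (case snd (\<delta> q (s 0 = 2)) of None \<Rightarrow> (s 1, Stay)
         | Some c \<Rightarrow> (if c then 2 else 1, MoveRight))
       else (s j, Stay)))"

lemma transducer_simps:
  "states (transducer n \<delta>) = n"
  "trans (transducer n \<delta>) q s = (if s 0 = 0 then (n, stay s)
     else (fst (\<delta> q (s 0 = 2)), \<lambda>j.
       if j = 0 then (s 0, MoveRight)
       else if j = 1 then (case snd (\<delta> q (s 0 = 2)) of None \<Rightarrow> (s 1, Stay)
         | Some c \<Rightarrow> (if c then 2 else 1, MoveRight))
       else (s j, Stay)))"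
  by (simp_all add: transducer_def)

lemma transducer_exec:
  assumes \<delta>: "\<And>q b. q < n \<Longrightarrow> fst (\<delta> q b) < n"
  shows "q < n \<Longrightarrow> T 0 = (inscription (x @ y), int (length x)) \<Longrightarrow>
    T 1 = (inscription out, int (length out)) \<Longrightarrow>
    \<exists>T'. exec (transducer n \<delta>) q T T' (Suc (length y)) \<and>
      fst (T' 1) = inscription (out @ transduce \<delta> q y)"
proof (induction y arbitrary: q T x out)
  case Nil
  have "reads T 0 = 0" using Nil by (simp add: reads_def read_tape_def inscription_def)
  then have "exec (transducer n \<delta>) q T T (Suc 0)"
    using Nil exec_halt[of "transducer n \<delta>" T]
    by (intro exec_step) (auto simp: transducer_simps)
  then show ?case using Nil by (intro exI[of _ T]) auto
next
  case (Cons b y)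
  let ?m = "transducer n \<delta>"
  have r: "reads T 0 = (if b then 2 else 1)"
    using Cons.prems by (simp add: reads_def read_tape_def inscription_def)
  let ?q = "fst (\<delta> q b)"
  let ?o = "out @ (case snd (\<delta> q b) of None \<Rightarrow> [] | Some c \<Rightarrow> [c])"
  let ?T = "acts T (snd (trans ?m q (reads T)))"
  have tr: "trans ?m q (reads T) = (?q, \<lambda>j.
       if j = 0 then (reads T 0, MoveRight)
       else if j = 1 then (case snd (\<delta> q b) of None \<Rightarrow> (reads T 1, Stay)
         | Some c \<Rightarrow> (if c then 2 else 1, MoveRight))
       else (reads T j, Stay))"
  proof -
    have "(reads T 0 = 2) = b" "(reads T 0 = 0) = False" using r by auto
    then show ?thesis unfolding transducer_simps by (simp only: if_False)
  qed
  have "?T 0 = (inscription ((x @ [b]) @ y), int (length (x @ [b])))"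
    using Cons.prems
    by (simp add: tr acts_def act_tape_def reads_def read_tape_def)
  moreover have "?T 1 = (inscription ?o, int (length ?o))"
  proof (cases "snd (\<delta> q b)")
    case None
    then show ?thesis using Cons.prems
      by (simp add: tr acts_def act_tape_def reads_def read_tape_def)
  next
    case (Some c)
    then show ?thesis using Cons.prems inscription_snoc[of out c]
      by (simp add: tr acts_def act_tape_def)
  qed
  moreover have q: "q < n" "?q < n" using \<delta> Cons.prems by auto
  ultimately obtain T' where "exec ?m ?q ?T T' (Suc (length y))"
    "fst (T' 1) = inscription (?o @ transduce \<delta> ?q y)"
    using Cons.IH[of ?q ?T "x @ [b]" ?o] by blast
  moreover have "fst (trans ?m q (reads T)) = ?q" using r by (simp add: transducer_simps)
  ultimately show ?case using q exec_step[of q ?m T T' "Suc (length y)"]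
    by (intro exI[of _ T']) (simp add: transducer_simps(1))
qed

theorem poly_time_transduce:
  assumes \<delta>: "\<And>q b. q < n \<Longrightarrow> fst (\<delta> q b) < n" and "0 < n"
  shows "poly_time (transduce \<delta> 0)"
proof -
  have wf: "wf_m 2 3 (transducer n \<delta>)"
  proof (rule wf_mI)
    fix q :: nat and s s' :: "nat \<Rightarrow> nat" assume "\<And>j. j < 2 \<Longrightarrow> s j = s' j"
    then have "s 0 = s' 0" "s 1 = s' 1" by auto
    then show "fst (trans (transducer n \<delta>) q s) = fst (trans (transducer n \<delta>) q s') \<and>
        (\<forall>j<2. snd (trans (transducer n \<delta>) q s) j = snd (trans (transducer n \<delta>) q s') j)"
      by (auto simp: transducer_simps less_2_cases_iff split: option.split)
  next
    fix q :: nat and s :: "nat \<Rightarrow> nat"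
    assume "q < states (transducer n \<delta>)" "\<And>j. j < 2 \<Longrightarrow> s j < 3"
    then have "q < n" "s 0 < 3" "s 1 < 3" by (auto simp: transducer_simps)
    then show "fst (trans (transducer n \<delta>) q s) \<le> states (transducer n \<delta>) \<and>
        (\<forall>j<2. fst (snd (trans (transducer n \<delta>) q s) j) < 3)"
      using \<delta>[of q] by (auto simp: transducer_simps less_imp_le less_2_cases_iff split: option.split)
  qed
  have "outputs_within (to_tm 2 3 (transducer n \<delta>)) x (transduce \<delta> 0 x) (poly [:1, 1:] (length x))" for x
  proof -
    obtain T' where "exec (transducer n \<delta>) 0 (init_tapes x) T' (Suc (length x))"
      "fst (T' 1) = inscription (transduce \<delta> 0 x)"
      using transducer_exec[of n \<delta> 0 "init_tapes x" "[]" x "[]", OF \<delta>] \<open>0 < n\<close>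
      by (auto simp: init_tapes_def)
    then show ?thesis by (intro to_tm_outputs[OF wf, of x T']) (auto simp: runs_def)
  qed
  moreover have "wf_tm (to_tm 2 3 (transducer n \<delta>))" using wf by (intro wf_to_tm) auto
  ultimately show ?thesis unfolding poly_time_def by blast
qed

section \<open>P is contained in NP\<close>

lemma class_P_iff: "A \<in> class_P \<longleftrightarrow> poly_time (\<lambda>x. [x \<in> A])"
  by (simp add: class_P_def poly_time_def)

lemma outputs_within_mono:
  assumes "outputs_within M x y t" "t \<le> t'"
  shows "outputs_within M x y t'"
proof -
  let ?c = "(tm_step M ^^ t) (init_config M x)"
  have "(tm_step M ^^ t') (init_config M x) = (tm_step M ^^ (t' - t)) ?c"
    using assms(2) by (metis comp_apply funpow_add le_add_diff_inverse2)
  then show ?thesis using assms(1) halted_steps[of ?c M] by (auto simp: outputs_within_def Let_def)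
qed

lemma poly_time_comp:
  assumes "poly_time f" "poly_time g"
  shows "poly_time (\<lambda>x. g (f x))"
proof -
  obtain M1 and p1 :: "nat poly" where M1: "wf_tm M1" "\<And>x. outputs_within M1 x (f x) (poly p1 (length x))"
    using assms(1) by (auto simp: poly_time_def)
  obtain M2 and p2 :: "nat poly" where M2: "wf_tm M2" "\<And>x. outputs_within M2 x (g x) (poly p2 (length x))"
    using assms(2) by (auto simp: poly_time_def)
  let ?p = "3 * p1 + pcompose p2 p1 + 2"
  have "outputs_within (comp_tm M1 M2) x (g (f x)) (poly ?p (length x))" for x
  proof -
    have "length (f x) \<le> poly p1 (length x)" using outputs_length[OF M1] .
    then have "poly p2 (length (f x)) \<le> poly p2 (poly p1 (length x))" by (rule poly_nat_mono)
    then have "outputs_within M2 (f x) (g (f x)) (poly p2 (poly p1 (length x)))"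
      using M2(2)[of "f x"] outputs_within_mono by blast
    from comp_tm_outputs[OF M1(1) M2(1) M1(2) this] show ?thesis
      by (simp add: poly_pcompose)
  qed
  then show ?thesis using wf_comp_tm[OF M1(1) M2(1)] unfolding poly_time_def by blast
qed

lemma class_P_vimage: "poly_time f \<Longrightarrow> A \<in> class_P \<Longrightarrow> {x. f x \<in> A} \<in> class_P"
  using poly_time_comp[of f "\<lambda>x. [x \<in> A]"] by (simp add: class_P_iff)

text \<open>States \<open>1\<close> and \<open>2\<close> remember the first bit of a pair, state \<open>3\<close> follows the separator.\<close>

definition undouble :: "nat \<Rightarrow> bool \<Rightarrow> nat \<times> bool option" where
  "undouble q b =
     (if q = 0 then (if b then 1 else 2, None)
      else if q = 1 \<and> b then (0, Some True)
      else if q = 2 \<and> \<not> b then (0, Some False)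
      else (3, None))"

lemma transduce_undouble: "transduce undouble 0 (pair_word x []) = x"
proof (induction x)
  case (Cons b x)
  then show ?case by (cases b) (auto simp: pair_word_def undouble_def)
qed (simp add: pair_word_def undouble_def)

lemma P_subset_NP: "class_P \<subseteq> class_NP"
proof
  fix A assume "A \<in> class_P"
  have "poly_time (transduce undouble 0)"
    by (rule poly_time_transduce[of 4]) (auto simp: undouble_def)
  from class_P_vimage[OF this \<open>A \<in> class_P\<close>]
  have R: "{z. transduce undouble 0 z \<in> A} \<in> class_P" .
  \<comment> \<open>The polynomial 0 admits the empty witness only; the transducer then recovers
    \<open>x\<close> from the pair.\<close>
  have "x \<in> A \<longleftrightarrow> (\<exists>y. length y \<le> poly 0 (length x) \<and>
      pair_word x y \<in> {z. transduce undouble 0 z \<in> A})" for x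
    by (auto simp: transduce_undouble)
  then show "A \<in> class_NP" using R unfolding class_NP_def by blast
qed

section \<open>Recognizing solutions of zero energy\<close>

text \<open>
  The transducer prints the bits \<open>F \<kappa> e \<noteq> 0\<close> and then, in the same order, the bits
  \<open>M \<kappa> e 0 \<noteq> 0\<close> of an encoded solution: a rational is nonzero iff the second bit of its code is
  set. States below \<open>10\<close> read the flows, those from \<open>10\<close> to \<open>19\<close> the layout, the others the split,
  where \<open>22\<close> to \<open>28\<close> treat the entry of mode \<open>0\<close> and \<open>29\<close> to \<open>34\<close> all others.
\<close>

definition next_True :: "nat list" where
  "next_True = [1, 2, 3, 4, 5, 4, 7, 6, 40, 40, 11, 12, 13, 12, 40, 40, 40, 40, 40, 40,
     21, 22, 23, 24, 25, 26, 25, 28, 27, 30, 31, 32, 31, 34, 33]"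

definition next_False :: "nat list" where
  "next_False = [10, 0, 3, 6, 5, 6, 1, 6, 40, 40, 20, 10, 11, 12, 40, 40, 40, 40, 40, 40,
     40, 20, 21, 24, 27, 26, 27, 29, 27, 21, 31, 33, 31, 29, 33]"

definition parse :: "nat \<Rightarrow> bool \<Rightarrow> nat \<times> bool option" where
  "parse q b =
     (if q < 35 then (if b then next_True else next_False) ! q else 40,
      if q \<in> {3, 24} then Some b else None)"

lemma parse_bound: "fst (parse q b) < 41"
proof (cases "q < 35")
  case True
  have "\<forall>x \<in> set next_True. x < 41" "\<forall>x \<in> set next_False. x < 41"
    by (simp_all add: next_True_def next_False_def)
  moreover have "length next_True = 35" "length next_False = 35"
    by (simp_all add: next_True_def next_False_def)
  ultimately show ?thesis using True nth_mem by (auto simp: parse_def)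
qed (simp add: parse_def)

lemma parse_simps [simp]:
  "parse 0 b = (if b then 1 else 10, None)"
  "parse (Suc 0) b = (if b then 2 else 0, None)"
  "parse 2 b = (3, None)"
  "parse 3 b = (if b then 4 else 6, Some b)"
  "parse 4 b = (5, None)"
  "parse 5 b = (if b then 4 else 6, None)"
  "parse 6 b = (if b then 7 else 1, None)"
  "parse 7 b = (6, None)"
  "parse 10 b = (if b then 11 else 20, None)"
  "parse 11 b = (if b then 12 else 10, None)"
  "parse 12 b = (if b then 13 else 11, None)"
  "parse 13 b = (12, None)"
  "parse 20 b = (if b then 21 else 40, None)"
  "parse 21 b = (if b then 22 else 20, None)"
  "parse 22 b = (if b then 23 else 21, None)"
  "parse 23 b = (24, None)"
  "parse 24 b = (if b then 25 else 27, Some b)"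
  "parse 25 b = (26, None)"
  "parse 26 b = (if b then 25 else 27, None)"
  "parse 27 b = (if b then 28 else 29, None)"
  "parse 28 b = (27, None)"
  "parse 29 b = (if b then 30 else 21, None)"
  "parse 30 b = (31, None)"
  "parse 31 b = (if b then 32 else 33, None)"
  "parse 32 b = (31, None)"
  "parse 33 b = (if b then 34 else 29, None)"
  "parse 34 b = (33, None)"
  by (simp_all add: parse_def next_True_def next_False_def)

text \<open>State \<open>q\<close> expects the flag in front of an element: \<open>True\<close>
  leads to the parser \<open>qa\<close> of one element, which has to return to \<open>q\<close>, and
  \<open>False\<close> leaves the list.\<close>

lemma transduce_enc_list:
  assumes "\<delta> q True = (qa, None)" "\<delta> q False = (qb, None)"
    and "\<And>x r. x \<in> set xs \<Longrightarrow> transduce \<delta> qa (f x @ r) = g x @ transduce \<delta> q r"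
  shows "transduce \<delta> q (enc_list f xs @ r) = concat (map g xs) @ transduce \<delta> qb r"
  using assms(3)
proof (induction xs)
  case (Cons x xs)
  then show ?case using assms(1) by (simp add: enc_list_def)
qed (simp add: enc_list_def assms)

lemma transduce_enc_nat:
  assumes "\<And>b. parse q b = (if b then qa else qb, None)" "\<And>b. parse qa b = (q, None)"
  shows "transduce parse q (enc_nat n @ r) = transduce parse qb r"
  unfolding enc_nat_def
  by (subst transduce_enc_list[where qa = qa and qb = qb and g = "\<lambda>_. []"]) (auto simp: assms)

text \<open>A number is nonzero iff its digit list is nonempty, that is, iff the first flag of its
  code is \<open>True\<close>; this flag alone is passed on.\<close>

lemma transduce_enc_nat_first:
  assumes "\<And>b. parse q b = (if b then qa else qb, Some b)" "\<And>b. parse qa b = (qc, None)"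
    "\<And>b. parse qc b = (if b then qa else qb, None)"
  shows "transduce parse q (enc_nat n @ r) = (n \<noteq> 0) # transduce parse qb r"
proof (cases "n = 0")
  case True
  then show ?thesis by (simp add: enc_nat_def enc_list_def bin_digits.simps[of 0] assms)
next
  case False
  then have "enc_nat n = True # odd n # enc_nat (n div 2)"
    by (simp add: enc_nat_def enc_list_def bin_digits.simps[of n])
  then show ?thesis using False assms transduce_enc_nat[of qc qa qb "n div 2" r] by simp
qed

lemma nonzero_quotient: "nat \<bar>fst (quotient_of r)\<bar> \<noteq> 0 \<longleftrightarrow> r \<noteq> 0"
proof
  assume "nat \<bar>fst (quotient_of r)\<bar> \<noteq> 0" then show "r \<noteq> 0" by auto
next
  assume "r \<noteq> 0"
  then show "nat \<bar>fst (quotient_of r)\<bar> \<noteq> 0"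
    by (metis Fract_of_int_eq abs_eq_0 divide_eq_0_iff eq_nat_nat_iff nat_0 abs_ge_zero order_refl
        of_int_0 prod.collapse quotient_of_div)
qed

lemma enc_rat_alt:
  "enc_rat r = (fst (quotient_of r) < 0) #
     enc_nat (nat \<bar>fst (quotient_of r)\<bar>) @ enc_nat (nat (snd (quotient_of r)))"
proof -
  have "snd (quotient_of r) > 0" by (simp add: quotient_of_denom_pos')
  then show ?thesis by (auto simp: enc_rat_def split: prod.split)
qed

lemma parse_rat_flow:
  "transduce parse 2 (enc_rat c @ r) = (c \<noteq> 0) # transduce parse 1 r"
  using nonzero_quotient[of c]
  by (simp add: enc_rat_alt transduce_enc_nat_first[where qa = 4 and qb = 6 and qc = 5]
      transduce_enc_nat[where qa = 7 and qb = "Suc 0"])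

lemma parse_rat_first:
  "transduce parse 23 (enc_rat c @ r) = (c \<noteq> 0) # transduce parse 29 r"
  using nonzero_quotient[of c]
  by (simp add: enc_rat_alt transduce_enc_nat_first[where qa = 25 and qb = 27 and qc = 26]
      transduce_enc_nat[where qa = 28 and qb = 29])

lemma parse_rat_other:
  "transduce parse 30 (enc_rat c @ r) = transduce parse 29 r"
  by (simp add: enc_rat_alt transduce_enc_nat[where qa = 32 and qb = 33]
      transduce_enc_nat[where qa = 34 and qb = 29])

lemma parse_split_entry:
  "transduce parse 22 (enc_list (\<lambda>i. enc_rat (g i)) (i # is) @ r) =
     (g i \<noteq> 0) # transduce parse 21 r"
proof -
  have "transduce parse 29 (enc_list (\<lambda>i. enc_rat (g i)) is @ r) = transduce parse 21 r"
    by (subst transduce_enc_list[where qa = 30 and qb = 21 and g = "\<lambda>_. []"])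
      (auto simp: parse_rat_other)
  moreover have "transduce parse 22 (enc_list (\<lambda>i. enc_rat (g i)) (i # is) @ r) =
      transduce parse 23 (enc_rat (g i) @ enc_list (\<lambda>i. enc_rat (g i)) is @ r)"
    by (simp add: enc_list_def)
  ultimately show ?thesis by (simp add: parse_rat_first)
qed

definition flow_flags where
  "flow_flags I F = concat (map (\<lambda>\<kappa>. map (\<lambda>e. F \<kappa> e \<noteq> (0 :: rat)) (edge_list I)) (commodity_list I))"

lemma transduce_solution:
  "transduce parse 0 (enc_solution I F L M) =
     flow_flags I F @ flow_flags I (\<lambda>\<kappa> e. M \<kappa> e 0)"
proof -
  have conc: "concat (map (\<lambda>x. [h x]) xs) = map h xs" for h :: "'b \<Rightarrow> bool" and xs
    by (induction xs) auto
  have 1: "transduce parse 0 (enc_list (\<lambda>\<kappa>. enc_list (\<lambda>e. enc_rat (F \<kappa> e)) (edge_list I))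
      (commodity_list I) @ r) = flow_flags I F @ transduce parse 10 r" for r
    unfolding flow_flags_def
  proof (rule transduce_enc_list[where ?qa.0 = 1])
    fix \<kappa> r
    show "transduce parse 1 (enc_list (\<lambda>e. enc_rat (F \<kappa> e)) (edge_list I) @ r) =
        map (\<lambda>e. F \<kappa> e \<noteq> 0) (edge_list I) @ transduce parse 0 r"
      by (subst transduce_enc_list[where qa = 2 and qb = 0 and g = "\<lambda>e. [F \<kappa> e \<noteq> 0]"])
        (auto simp: parse_rat_flow conc)
  qed simp_all
  have 2: "transduce parse 10 (enc_list (\<lambda>e. enc_list (\<lambda>i. enc_nat (L e i)) [1..<Suc (num_modes I)])
      (edge_list I) @ r) = transduce parse 20 r" for r
  proof (subst transduce_enc_list[where qa = 11 and qb = 20 and g = "\<lambda>_. []"])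
    fix e r
    show "transduce parse 11 (enc_list (\<lambda>i. enc_nat (L e i)) [1..<Suc (num_modes I)] @ r) =
        [] @ transduce parse 10 r"
      by (subst transduce_enc_list[where qa = 12 and qb = 10 and g = "\<lambda>_. []"])
        (auto simp: transduce_enc_nat[where qa = 13 and qb = 11])
  qed (auto)
  have 3: "transduce parse 20 (enc_list (\<lambda>\<kappa>. enc_list (\<lambda>e. enc_list (\<lambda>i. enc_rat (M \<kappa> e i))
      [0..<Suc (num_modes I)]) (edge_list I)) (commodity_list I) @ r) =
      flow_flags I (\<lambda>\<kappa> e. M \<kappa> e 0) @ transduce parse 40 r" for r
    unfolding flow_flags_def
  proof (rule transduce_enc_list[where ?qa.0 = 21])
    fix \<kappa> r
    show "transduce parse 21 (enc_list (\<lambda>e. enc_list (\<lambda>i. enc_rat (M \<kappa> e i))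
        [0..<Suc (num_modes I)]) (edge_list I) @ r) =
        map (\<lambda>e. M \<kappa> e 0 \<noteq> 0) (edge_list I) @ transduce parse 20 r"
      by (subst transduce_enc_list[where qa = 22 and qb = 20 and g = "\<lambda>e. [M \<kappa> e 0 \<noteq> 0]"])
        (auto simp: upt_conv_Cons[of 0 "Suc (num_modes I)"] parse_split_entry conc
          simp del: upt_Suc)
  qed simp_all
  show ?thesis unfolding enc_solution_def using 1 2 3[of "[]"] by simp
qed

section \<open>The zero test on the extracted bits\<close>

abbreviation If_equal :: "exp \<Rightarrow> exp \<Rightarrow> stmt \<Rightarrow> stmt \<Rightarrow> stmt" where
  "If_equal a b s t \<equiv> Test (Add (Sub a b) (Sub b a)) t s"

text \<open>The input consists of two words of equal length. Without division, this length is found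
  by testing \<open>2 * h = Len\<close> for each \<open>h\<close> in a loop. Something is printed
  exactly at common bits, so the answer lies in whether the output is empty.\<close>

definition common_bit :: stmt where
  "common_bit = For (Add Len (Const 1)) (If_equal (Mul (Const 2) (Var 2)) Len
     (For (Var 2) (Test (Mul (Bit (Var 4)) (Bit (Add (Var 2) (Var 4)))) (Out True)
        (For (Const 0) (Out True))))
     (For (Const 0) (Out True)))"

lemma sem_For_Nil: "sem w d \<sigma> (For e a) = [] \<longleftrightarrow>
    (\<forall>i < eval w \<sigma> e. sem w (d + 2) (\<sigma>(d := i, Suc d := eval w \<sigma> e - Suc i)) a = [])"
  by auto

lemma sem_If_Nil: "sem w d \<sigma> (Test e (Out True) (For (Const 0) (Out True))) = [] \<longleftrightarrow> eval w \<sigma> e = 0"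
  by simp

lemma sem_common_bit:
  assumes "length xs = length ys"
  shows "sem (xs @ ys) 2 (\<lambda>_. 0) common_bit = [] \<longleftrightarrow> \<not> (\<exists>i < length xs. xs ! i \<and> ys ! i)"
proof -
  let ?w = "xs @ ys"
  define f where "f = For (Var 2) (Test (Mul (Bit (Var 4)) (Bit (Add (Var 2) (Var 4)))) (Out True)
        (For (Const 0) (Out True)))"
  have f: "sem ?w 4 \<sigma> f = [] \<longleftrightarrow>
      (\<forall>i < \<sigma> 2. \<not> (i < length ?w \<and> ?w ! i \<and> \<sigma> 2 + i < length ?w \<and> ?w ! (\<sigma> 2 + i)))" for \<sigma>
    unfolding f_def sem_For_Nil sem_If_Nil eval.simps by auto
  have h: "2 * h - length ?w + (length ?w - 2 * h) = 0 \<longleftrightarrow> h = length xs" for h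
    using assms by auto
  define g where "g = If_equal (Mul (Const 2) (Var 2)) Len f (For (Const 0) (Out True))"
  have g: "sem ?w 4 \<sigma> g = [] \<longleftrightarrow> (\<sigma> 2 = length xs \<longrightarrow> sem ?w 4 \<sigma> f = [])" for \<sigma>
    using h[of "\<sigma> 2"] by (simp add: g_def)
  have "sem ?w 2 (\<lambda>_. 0) common_bit = [] \<longleftrightarrow> (\<forall>h < Suc (length ?w). h = length xs \<longrightarrow>
      sem ?w 4 ((\<lambda>_. 0)(2 := h, 3 := length ?w - h)) f = [])"
    unfolding common_bit_def f_def[symmetric] g_def[symmetric] sem_For_Nil by (simp add: g)
  also have "\<dots> \<longleftrightarrow> (\<forall>i < length xs. \<not> (xs ! i \<and> ys ! i))"
    unfolding f using assms by (auto simp: nth_append)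
  finally show ?thesis by blast
qed

definition is_empty :: stmt where "is_empty = Test Len (Out False) (Out True)"

lemma sem_is_empty: "sem w 2 \<sigma> is_empty = [w = []]"
  by (simp add: is_empty_def)

text \<open>Both flag lists run through the same list of commodity-edge pairs, so equal positions
  belong to equal pairs.\<close>

lemma nth_flow_flags:
  "(\<exists>i < length (flow_flags I F). flow_flags I F ! i \<and> flow_flags I G ! i) \<longleftrightarrow>
     (\<exists>\<kappa> \<in> set (commodity_list I). \<exists>e \<in> set (edge_list I). F \<kappa> e \<noteq> 0 \<and> G \<kappa> e \<noteq> 0)"
proof -
  define P where "P = concat (map (\<lambda>\<kappa>. map (Pair \<kappa>) (edge_list I)) (commodity_list I))"
  have ff: "flow_flags I H = map (\<lambda>x. H (fst x) (snd x) \<noteq> 0) P" for H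
    by (simp add: flow_flags_def P_def map_concat comp_def)
  have "(\<exists>i < length (flow_flags I F). flow_flags I F ! i \<and> flow_flags I G ! i) \<longleftrightarrow>
      (\<exists>i < length P. F (fst (P ! i)) (snd (P ! i)) \<noteq> 0 \<and> G (fst (P ! i)) (snd (P ! i)) \<noteq> 0)"
    unfolding ff by auto
  also have "\<dots> \<longleftrightarrow> (\<exists>x \<in> set P. F (fst x) (snd x) \<noteq> 0 \<and> G (fst x) (snd x) \<noteq> 0)"
    by (metis in_set_conv_nth)
  also have "\<dots> \<longleftrightarrow> (\<exists>\<kappa> \<in> set (commodity_list I). \<exists>e \<in> set (edge_list I). F \<kappa> e \<noteq> 0 \<and> G \<kappa> e \<noteq> 0)"
    by (auto simp: P_def)
  finally show ?thesis .
qed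

lemma length_flow_flags: "length (flow_flags I F) = length (flow_flags I G)"
  by (simp add: flow_flags_def length_concat comp_def)

text \<open>A loop prints in every round and cannot give a single verdict on all of them; a second
  pass turns emptiness of the first output into one bit.\<close>

definition zero_check :: "bool list \<Rightarrow> bool list" where
  "zero_check x = sem (sem (transduce parse 0 x) 2 (\<lambda>_. 0) common_bit) 2 (\<lambda>_. 0) is_empty"

lemma zero_check_solution:
  "zero_check (enc_solution I F L M) =
     [\<forall>\<kappa> \<in> set (commodity_list I). \<forall>e \<in> set (edge_list I). F \<kappa> e = 0 \<or> M \<kappa> e 0 = 0]"
  unfolding zero_check_def sem_is_empty transduce_solution
    sem_common_bit[OF length_flow_flags] nth_flow_flags by auto

lemma poly_time_zero_check: "poly_time zero_check"
  unfolding zero_check_def[abs_def]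
proof (rule poly_time_comp[where f = "\<lambda>x. sem (transduce parse 0 x) 2 (\<lambda>_. 0) common_bit"],
    rule poly_time_comp[where f = "transduce parse 0"])
  show "poly_time (transduce parse 0)" by (rule poly_time_transduce[OF parse_bound]) simp
  show "poly_time (\<lambda>w. sem w 2 (\<lambda>_. 0) common_bit)"
    by (rule poly_time_sem) (simp add: common_bit_def)
  show "poly_time (\<lambda>w. sem w 2 (\<lambda>_. 0) is_empty)"
    by (rule poly_time_sem) (simp add: is_empty_def)
qed

section \<open>Set cover as a modal split problem\<close>

text \<open>
  Vertex \<open>0\<close> is the source of all demands, one unit for each element in \<open>X\<close>; an element is reached
  either directly or through a set in \<open>U\<close>. Public transport is free of energy, and the budget pays
  for one edge into every element and for \<open>b\<close> edges into sets.
\<close>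

definition cover_msp :: "nat \<Rightarrow> nat set \<Rightarrow> (nat \<times> nat) set \<Rightarrow> nat \<Rightarrow> msp" where
  "cover_msp n X E b = \<lparr>num_vertices = n, edges = E, weight = (\<lambda>_. 1),
     budget = of_nat (card X + b), demand = (\<lambda>(u, v). if u = 0 \<and> v \<in> X then 1 else 0),
     num_modes = 1, tau = (\<lambda>_. 0), eta = (\<lambda>i. if i = 0 then 1 else 0),
     cost = (\<lambda>i. if i = 0 then 0 else 1), cap = (\<lambda>i. if i = 0 then 1 else of_nat n),
     time_bound = None\<rparr>"

locale cover =
  fixes n b :: nat and U X :: "nat set" and E :: "(nat \<times> nat) set"
  assumes U: "U \<subseteq> {0<..<n}" and X: "X \<subseteq> {0<..<n}" and disj: "U \<inter> X = {}" and n: "0 < n"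
    and E_sub: "E \<subseteq> {0} \<times> (U \<union> X) \<union> U \<times> X" and E_sup: "{0} \<times> U \<subseteq> E"
begin

abbreviation "I \<equiv> cover_msp n X E b"

text \<open>A direct edge \<open>(0, x)\<close> covers \<open>x\<close> without any set: it takes
  the place of an edge from a set, and the budget provides one edge into \<open>x\<close> in any
  case.\<close>

definition covers :: "nat set \<Rightarrow> bool" where
  "covers S \<longleftrightarrow> S \<subseteq> U \<and> (\<forall>x\<in>X. (0, x) \<in> E \<or> (\<exists>u\<in>S. (u, x) \<in> E))"

lemma fin: "finite U" "finite X" "finite E"
proof -
  show "finite U" "finite X" using U X finite_subset by blast+
  then show "finite E" using E_sub by (meson finite.emptyI finite_SigmaI finite_UnI finite_insert finite_subset)
qed

lemma I_simps:
  "num_vertices I = n" "edges I = E" "weight I e = 1" "budget I = of_nat (card X + b)"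
  "num_modes I = 1" "eta I 0 = 1" "eta I (Suc 0) = 0" "cost I (Suc 0) = 1"
  "cap I (Suc 0) = of_nat n" "time_bound I = None" "vertices I = {..<n}"
  by (simp_all add: cover_msp_def vertices_def)

lemma demand_I: "demand I (u, v) = (if u = 0 \<and> v \<in> X then 1 else 0)"
  by (simp add: cover_msp_def)

lemma commodities_I: "commodities I = {0} \<times> X"
  using n X by (auto simp: commodities_def I_simps demand_I split: if_splits)

lemma edge_cases: "(u, v) \<in> E \<Longrightarrow> u = 0 \<and> v \<in> U \<union> X \<or> u \<in> U \<and> v \<in> X"
  using E_sub by blast

lemma instance_I: "msp_instance I"
proof -
  have "E \<subseteq> {..<n} \<times> {..<n}"
    using n U X edge_cases by (fastforce dest: subsetD)
  then show ?thesis using n X by (auto simp: msp_instance_def cover_msp_def vertices_def)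
qed

text \<open>The product of \<open>total_flow\<close> and \<open>total_split\<close> is the plain sum
  also on an edge without flow, where nonnegativity makes each summand 0; so the convention for the
  quotient disappears.\<close>

lemma energy_I:
  assumes "\<And>\<kappa> e. \<kappa> \<in> commodities I \<Longrightarrow> e \<in> E \<Longrightarrow> 0 \<le> F \<kappa> e"
  shows "energy I F L M = (\<Sum>e\<in>E. \<Sum>\<kappa>\<in>commodities I. F \<kappa> e * M \<kappa> e 0)"
  unfolding energy_def I_simps
proof (rule sum.cong)
  fix e assume e: "e \<in> E"
  have fc: "finite (commodities I)" by (simp add: commodities_I fin)
  have "total_flow I F e * total_split I F M e 0 = (\<Sum>\<kappa>\<in>commodities I. F \<kappa> e * M \<kappa> e 0)"
  proof (cases "total_flow I F e > 0")
    case False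
    moreover have "0 \<le> total_flow I F e" unfolding total_flow_def using assms e by (intro sum_nonneg)
    ultimately have "(\<Sum>\<kappa>\<in>commodities I. F \<kappa> e) = 0" by (simp add: total_flow_def)
    then have "\<forall>\<kappa>\<in>commodities I. F \<kappa> e = 0"
      using assms e fc by (subst (asm) sum_nonneg_eq_0_iff) auto
    then show ?thesis by (simp add: total_flow_def)
  qed (simp add: total_split_def)
  then show "real 1 * (of_rat 1 * total_flow I F e * total_split I F M e 0 +
      (\<Sum>i = 1..1. of_rat (eta I i) * real (L e i))) = (\<Sum>\<kappa>\<in>commodities I. F \<kappa> e * M \<kappa> e 0)"
    by (simp add: I_simps)
qed simp

lemma admissible_nonneg:
  assumes "admissible I F L M" "\<kappa> \<in> commodities I" "e \<in> E"
  shows "0 \<le> F \<kappa> e" "0 \<le> F \<kappa> e * M \<kappa> e 0"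
  using assms
  by (auto simp: admissible_def feasible_def is_flow_def feasible_split_def is_modal_split_def I_simps
      intro!: mult_nonneg_nonneg)

lemma energy_zero_iff:
  assumes "admissible I F L M"
  shows "energy I F L M = 0 \<longleftrightarrow> (\<forall>\<kappa>\<in>commodities I. \<forall>e\<in>E. F \<kappa> e = 0 \<or> M \<kappa> e 0 = 0)"
proof -
  have fc: "finite (commodities I)" by (simp add: commodities_I fin)
  have "energy I F L M = (\<Sum>e\<in>E. \<Sum>\<kappa>\<in>commodities I. F \<kappa> e * M \<kappa> e 0)"
    by (rule energy_I) (rule admissible_nonneg[OF assms])
  also have "\<dots> = 0 \<longleftrightarrow> (\<forall>e\<in>E. (\<Sum>\<kappa>\<in>commodities I. F \<kappa> e * M \<kappa> e 0) = 0)"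
    using fin admissible_nonneg[OF assms] by (intro sum_nonneg_eq_0_iff sum_nonneg) auto
  also have "\<dots> \<longleftrightarrow> (\<forall>e\<in>E. \<forall>\<kappa>\<in>commodities I. F \<kappa> e * M \<kappa> e 0 = 0)"
    using fc admissible_nonneg[OF assms] by (intro ball_cong refl sum_nonneg_eq_0_iff) auto
  finally show ?thesis by auto
qed

lemma energy_nonneg:
  assumes "admissible I F L M"
  shows "0 \<le> energy I F L M"
proof -
  have "energy I F L M = (\<Sum>e\<in>E. \<Sum>\<kappa>\<in>commodities I. F \<kappa> e * M \<kappa> e 0)"
    by (rule energy_I) (rule admissible_nonneg[OF assms])
  then show ?thesis using admissible_nonneg[OF assms] by (auto intro!: sum_nonneg)
qed

section \<open>Solutions of zero energy and small covers\<close>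

text \<open>Zero energy forces all flow onto public transport, hence a vehicle onto every edge with
  flow. Each element has such an edge into it and, if this comes from a set, conservation provides
  another from the source to that set. The edges into elements consume \<open>card X\<close> of the
  budget, which leaves \<open>b\<close> for the sets.\<close>

lemma zero_energy_imp_cover:
  assumes adm: "admissible I F L M"
    and z: "\<And>\<kappa> e. \<kappa> \<in> commodities I \<Longrightarrow> e \<in> E \<Longrightarrow> F \<kappa> e = 0 \<or> M \<kappa> e 0 = 0"
  shows "\<exists>S. covers S \<and> card S \<le> b"
proof -
  have flow: "is_flow I \<kappa> (F \<kappa>)" if "\<kappa> \<in> commodities I" for \<kappa>
    using adm that by (auto simp: admissible_def feasible_def)
  define used where "used = {e \<in> E. L e 1 > 0}"
  have used: "e \<in> used" if k: "\<kappa> \<in> commodities I" and e: "e \<in> E" and pos: "F \<kappa> e > 0" for \<kappa> e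
  proof -
    have "\<forall>\<kappa>\<in>commodities I. (\<Sum>i=0..1. M \<kappa> e i) = 1 \<and> 0 \<le> M \<kappa> e 1"
      using adm e by (auto simp: admissible_def feasible_def feasible_split_def is_modal_split_def I_simps)
    moreover have "M \<kappa> e 0 = 0" using z[OF k e] pos by simp
    ultimately have M1: "M \<kappa> e 1 = 1" "\<forall>\<kappa>\<in>commodities I. 0 \<le> M \<kappa> e 1" using k by auto
    have "F \<kappa> e * M \<kappa> e 1 \<le> (\<Sum>\<kappa>\<in>commodities I. F \<kappa> e * M \<kappa> e 1)"
      using k M1(2) admissible_nonneg(1)[OF adm _ e]
      by (intro member_le_sum mult_nonneg_nonneg) (auto simp: commodities_I fin)
    also have "\<dots> \<le> real n * real (L e 1)"
      using adm e by (auto simp: admissible_def feasible_def feasible_split_def I_simps)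
    finally have "L e 1 > 0" using M1 pos by (cases "L e 1") auto
    then show ?thesis using e by (simp add: used_def)
  qed
  have "(\<Sum>e\<in>E. real (L e 1)) \<le> real (card X + b)"
    using adm by (simp add: admissible_def feasible_def feasible_layout_def I_simps of_rat_add)
  then have "(\<Sum>e\<in>E. L e 1) \<le> card X + b" by (simp flip: of_nat_sum of_nat_add)
  moreover have "card used \<le> (\<Sum>e\<in>E. L e 1)"
  proof -
    have "card used = (\<Sum>e\<in>used. 1)" by simp
    also have "\<dots> \<le> (\<Sum>e\<in>used. L e 1)" by (intro sum_mono) (auto simp: used_def)
    also have "\<dots> \<le> (\<Sum>e\<in>E. L e 1)" using fin by (intro sum_mono2) (auto simp: used_def)
    finally show ?thesis .
  qed
  ultimately have cu: "card used \<le> card X + b" by simp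
  have pred: "\<exists>u. (u, x) \<in> used \<and> (u \<noteq> 0 \<longrightarrow> (0, u) \<in> used)" if x: "x \<in> X" for x
  proof -
    let ?k = "(0, x)"
    let ?f = "F ?k"
    have k: "?k \<in> commodities I" using x by (simp add: commodities_I)
    have nn: "\<And>e. e \<in> E \<Longrightarrow> 0 \<le> ?f e" using admissible_nonneg(1)[OF adm k] .
    have x': "x < n" "x \<noteq> 0" using X x by auto
    have "(\<Sum>e | e \<in> E \<and> snd e = x. ?f e) - (\<Sum>e | e \<in> E \<and> fst e = x. ?f e) = 1"
      using flow[OF k] x x' by (auto simp: is_flow_def I_simps demand_I)
    moreover have "0 \<le> (\<Sum>e | e \<in> E \<and> fst e = x. ?f e)" using nn by (intro sum_nonneg) auto
    ultimately have "(\<Sum>e | e \<in> E \<and> snd e = x. ?f e) \<noteq> 0" by linarith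
    then obtain e where e: "e \<in> E" "snd e = x" "?f e \<noteq> 0"
      by (metis (mono_tags, lifting) mem_Collect_eq sum.neutral)
    then have e': "(fst e, x) \<in> used" using used[OF k] nn[of e] by (metis less_eq_real_def prod.collapse)
    show ?thesis
    proof (cases "fst e = 0")
      case False
      let ?u = "fst e"
      have "?u \<in> U" using edge_cases[of ?u x] e False by (metis prod.collapse)
      then have u: "?u \<in> U" "?u < n" "?u \<noteq> x" using U x disj by auto
      then have "(\<Sum>e | e \<in> E \<and> snd e = ?u. ?f e) - (\<Sum>e | e \<in> E \<and> fst e = ?u. ?f e) = 0"
        using flow[OF k] False by (auto simp: is_flow_def I_simps)
      moreover have "?f e \<le> (\<Sum>e | e \<in> E \<and> fst e = ?u. ?f e)"
        using e nn fin by (intro member_le_sum) auto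
      ultimately have "(\<Sum>e | e \<in> E \<and> snd e = ?u. ?f e) \<noteq> 0" using e nn[of e] by simp
      then obtain e2 where e2: "e2 \<in> E" "snd e2 = ?u" "?f e2 \<noteq> 0"
        by (metis (mono_tags, lifting) mem_Collect_eq sum.neutral)
      then have "e2 \<in> used" using used[OF k] nn[of e2] by (metis less_eq_real_def)
      moreover have "e2 = (0, ?u)" using e2 u E_sub disj by (cases e2) auto
      ultimately show ?thesis using e' by blast
    qed (use e' in auto)
  qed
  then obtain p where p: "\<And>x. x \<in> X \<Longrightarrow> (p x, x) \<in> used \<and> (p x \<noteq> 0 \<longrightarrow> (0, p x) \<in> used)" by metis
  define S where "S = {u \<in> U. (0, u) \<in> used}"
  have "covers S" unfolding covers_def S_def
  proof (intro conjI ballI)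
    fix x assume x: "x \<in> X"
    have "(p x, x) \<in> E" using p[OF x] by (simp add: used_def)
    moreover from this have "p x = 0 \<or> p x \<in> U" using E_sub by auto
    ultimately show "(0, x) \<in> E \<or> (\<exists>u\<in>{u \<in> U. (0, u) \<in> used}. (u, x) \<in> E)"
      using p[OF x] by auto
  qed auto
  moreover have "card S \<le> b"
  proof -
    \<comment> \<open>As \<open>U\<close> and \<open>X\<close> are disjoint, no edge into a set is
      counted again as an edge into an element.\<close>
    have "card (Pair (0 :: nat) ` S) + card ((\<lambda>x. (p x, x)) ` X) = card (Pair 0 ` S \<union> (\<lambda>x. (p x, x)) ` X)"
      using fin disj by (intro card_Un_disjoint[symmetric]) (auto simp: S_def)
    also have "\<dots> \<le> card used" using p fin by (intro card_mono) (auto simp: S_def used_def)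
    finally have "card S + card X \<le> card used" by (simp add: card_image inj_on_def)
    then show ?thesis using cu by simp
  qed
  ultimately show ?thesis by blast
qed

text \<open>Each element gets a path of one or two edges; paths through the same set share its edge
  from the source, which gives the bound \<open>card S + card X\<close>.\<close>

lemma path_flow:
  assumes S: "covers S"
  shows "\<exists>P. (\<forall>x\<in>X. P x \<subseteq> E \<and> is_flow I (0, x) (\<lambda>e. of_bool (e \<in> P x))) \<and>
    card (\<Union>x\<in>X. P x) \<le> card S + card X"
proof -
  have "\<exists>u. (u = 0 \<or> u \<in> S) \<and> (u, x) \<in> E" if "x \<in> X" for x
    using S that unfolding covers_def by blast
  then obtain p where p: "\<And>x. x \<in> X \<Longrightarrow> (p x = 0 \<or> p x \<in> S) \<and> (p x, x) \<in> E" by metis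
  have SU: "S \<subseteq> U" using S by (simp add: covers_def)
  have fS: "finite S" using SU fin finite_subset by blast
  define P where "P x = (if p x = 0 then {(0, x)} else {(0, p x), (p x, x)})" for x
  have PE: "P x \<subseteq> E" if "x \<in> X" for x
    using p[OF that] SU E_sup by (auto simp: P_def)
  have "is_flow I (0, x) (\<lambda>e. of_bool (e \<in> P x))" if x: "x \<in> X" for x
    unfolding is_flow_def I_simps
  proof (intro conjI ballI)
    fix v assume "v \<in> {..<n}"
    have in_out: "(\<Sum>e | e \<in> E \<and> f e = v. of_bool (e \<in> P x)) = real (card {e \<in> P x. f e = v})"
      for f :: "nat \<times> nat \<Rightarrow> nat"
    proof -
      have "(\<Sum>e | e \<in> E \<and> f e = v. of_bool (e \<in> P x)) = (\<Sum>e | e \<in> P x \<and> f e = v. (1 :: real))"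
        using fin PE[OF x] by (intro sum.mono_neutral_cong_right) auto
      then show ?thesis by simp
    qed
    have ne: "x \<noteq> 0" "p x \<noteq> x" using x X p[OF x] SU disj by auto
    have sets: "{e \<in> {(0, x)}. snd e = v} = (if v = x then {(0, x)} else {})"
      "{e \<in> {(0, x)}. fst e = v} = (if v = 0 then {(0, x)} else {})"
      "{e \<in> {(0, p x), (p x, x)}. snd e = v} =
        (if v = p x then {(0, p x)} else {}) \<union> (if v = x then {(p x, x)} else {})"
      "{e \<in> {(0, p x), (p x, x)}. fst e = v} =
        (if v = 0 then {(0, p x)} else {}) \<union> (if v = p x then {(p x, x)} else {})"
      by auto
    show "(\<Sum>e | e \<in> E \<and> snd e = v. of_bool (e \<in> P x)) -
        (\<Sum>e | e \<in> E \<and> fst e = v. of_bool (e \<in> P x)) =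
        (if v = snd (0, x) then real (demand I (0, x))
         else if v = fst (0, x) then - real (demand I (0, x)) else 0)"
    proof (cases "p x = 0")
      case True
      then have "P x = {(0, x)}" by (simp add: P_def)
      then show ?thesis unfolding in_out demand_I by (simp only: sets) (use x ne in auto)
    next
      case False
      then have "P x = {(0, p x), (p x, x)}" by (simp add: P_def)
      then show ?thesis unfolding in_out demand_I by (simp only: sets) (use x ne False in auto)
    qed
  qed simp
  moreover have "card (\<Union>x\<in>X. P x) \<le> card S + card X"
  proof -
    have "(\<Union>x\<in>X. P x) \<subseteq> Pair 0 ` S \<union> (\<lambda>x. (p x, x)) ` X"
      using p by (fastforce simp: P_def split: if_splits)
    then have "card (\<Union>x\<in>X. P x) \<le> card (Pair 0 ` S \<union> (\<lambda>x. (p x, x)) ` X)"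
      using fin fS by (intro card_mono) auto
    also have "\<dots> \<le> card (Pair (0 :: nat) ` S) + card ((\<lambda>x. (p x, x)) ` X)" by (rule card_Un_le)
    also have "\<dots> \<le> card S + card X" by (intro add_mono card_image_le fS fin)
    finally show ?thesis .
  qed
  ultimately show ?thesis using PE by blast
qed

text \<open>Private transport everywhere and no vehicles: the cover may be of any size, as it only
  has to make the elements reachable.\<close>

lemma cover_imp_admissible:
  assumes S: "covers S"
  shows "\<exists>F L M. admissible I F L M"
proof -
  obtain P where P: "\<And>x. x \<in> X \<Longrightarrow> is_flow I (0, x) (\<lambda>e. of_bool (e \<in> P x))"
    using path_flow[OF S] by blast
  have "admissible I (\<lambda>\<kappa> e. of_bool (e \<in> P (snd \<kappa>))) (\<lambda>_ _. 0) (\<lambda>_ _ i. of_bool (i = 0))"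
    using P by (auto simp: admissible_def I_simps feasible_def commodities_I feasible_layout_def
        feasible_split_def is_modal_split_def)
  then show ?thesis by blast
qed

lemma cover_imp_zero_energy:
  assumes S: "covers S" "card S \<le> b"
  shows "\<exists>F L M. admissible I F L M \<and> energy I F L M = 0"
proof -
  obtain P where P: "\<And>x. x \<in> X \<Longrightarrow> P x \<subseteq> E"
    "\<And>x. x \<in> X \<Longrightarrow> is_flow I (0, x) (\<lambda>e. of_bool (e \<in> P x))"
    "card (\<Union>x\<in>X. P x) \<le> card S + card X"
    using path_flow[OF S(1)] by blast
  let ?F = "\<lambda>\<kappa> e. of_bool (e \<in> P (snd \<kappa>)) :: real"
  let ?L = "\<lambda>e i. of_bool (e \<in> (\<Union>x\<in>X. P x)) :: nat"
  let ?M = "\<lambda>\<kappa> e i. of_bool (i = 1) :: real"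
  have "(\<Sum>e\<in>E. real (?L e 1)) = real (card (\<Union>x\<in>X. P x))"
  proof -
    have "(\<Sum>e\<in>E. real (?L e 1)) = (\<Sum>e\<in>(\<Union>x\<in>X. P x). 1)"
      using fin P(1) by (intro sum.mono_neutral_cong_right) auto
    then show ?thesis by simp
  qed
  then have "feasible_layout I ?L"
    using P(3) S(2) by (simp add: feasible_layout_def I_simps of_rat_add)
  moreover have "feasible_split I ?F ?L ?M"
    unfolding feasible_split_def is_modal_split_def I_simps
  proof (intro conjI ballI)
    fix e i assume e: "e \<in> E" and i: "i \<in> {1..1 :: nat}"
    \<comment> \<open>The origin of the capacity \<open>n\<close>: there are at most
      \<open>n\<close> commodities of one unit each, so one vehicle suffices on every edge.\<close>
    have "card X \<le> card {..<n}" using X by (intro card_mono) auto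
    then have c: "card (commodities I) \<le> n" by (simp add: commodities_I card_cartesian_product)
    show "(\<Sum>\<kappa>\<in>commodities I. ?F \<kappa> e * ?M \<kappa> e i) \<le> of_rat (cap I i) * real (?L e i)"
    proof (cases "e \<in> (\<Union>x\<in>X. P x)")
      case True
      have "(\<Sum>\<kappa>\<in>commodities I. ?F \<kappa> e * ?M \<kappa> e i) \<le> (\<Sum>\<kappa>\<in>commodities I. 1)"
        by (intro sum_mono) auto
      then show ?thesis using True c i by (simp add: I_simps)
    next
      case False
      then have "(\<Sum>\<kappa>\<in>commodities I. ?F \<kappa> e * ?M \<kappa> e i) = 0"
        by (intro sum.neutral) (auto simp: commodities_I)
      then show ?thesis using False by simp
    qed
  qed auto
  ultimately have adm: "admissible I ?F ?L ?M"
    using P(2) by (auto simp: admissible_def feasible_def commodities_I I_simps(10))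
  then have "energy I ?F ?L ?M = 0" by (subst energy_zero_iff) auto
  then show ?thesis using adm by blast
qed

text \<open>A cover within the budget makes the infimum a minimum of value 0, which no factor can
  enlarge.\<close>

lemma approximation_zero:
  assumes S: "covers S" "card S \<le> b" and apx: "is_approximation I \<alpha> F L M"
  shows "\<forall>\<kappa>\<in>commodities I. \<forall>e\<in>E. F \<kappa> e = 0 \<or> M \<kappa> e 0 = 0"
proof -
  let ?A = "{energy I F L M | F L M. admissible I F L M}"
  have "0 \<in> ?A" using cover_imp_zero_energy[OF S] by force
  moreover have "\<And>x. x \<in> ?A \<Longrightarrow> 0 \<le> x" using energy_nonneg by auto
  ultimately have "opt_energy I = 0" unfolding opt_energy_def by (rule cInf_eq_minimum)
  then have "energy I F L M \<le> 0" "admissible I F L M" using apx by (auto simp: is_approximation_def)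
  then show ?thesis using energy_nonneg energy_zero_iff by (metis order_antisym)
qed

end

section \<open>Clause schemas on a grid\<close>

text \<open>Truth values are natural numbers, every positive one being true: conjunction is a
  product and disjunction a sum.\<close>

definition not_exp :: "exp \<Rightarrow> exp" where "not_exp e = Sub (Const 1) e"
definition eq_exp :: "exp \<Rightarrow> exp \<Rightarrow> exp" where "eq_exp a b = not_exp (Add (Sub a b) (Sub b a))"
definition conj_exp :: "exp list \<Rightarrow> exp" where "conj_exp es = foldr Mul es (Const 1)"
definition disj_exp :: "exp list \<Rightarrow> exp" where "disj_exp es = foldr Add es (Const 0)"

lemma eval_not_exp: "0 < eval w \<sigma> (not_exp e) \<longleftrightarrow> \<not> 0 < eval w \<sigma> e"
  by (auto simp: not_exp_def)

lemma eval_eq_exp: "0 < eval w \<sigma> (eq_exp a b) \<longleftrightarrow> eval w \<sigma> a = eval w \<sigma> b"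
  unfolding eq_exp_def eval_not_exp by auto

lemma eval_conj_exp: "0 < eval w \<sigma> (conj_exp es) \<longleftrightarrow> (\<forall>e\<in>set es. 0 < eval w \<sigma> e)"
  by (induction es) (auto simp: conj_exp_def)

lemma eval_disj_exp: "0 < eval w \<sigma> (disj_exp es) \<longleftrightarrow> (\<exists>e\<in>set es. 0 < eval w \<sigma> e)"
  by (induction es) (auto simp: disj_exp_def)

lemma ok_not_exp [simp]: "ok_exp d (not_exp e) = ok_exp d e" by (simp add: not_exp_def)
lemma ok_eq_exp [simp]: "ok_exp d (eq_exp a b) = (ok_exp d a \<and> ok_exp d b)" by (auto simp: eq_exp_def)
lemma ok_conj_exp [simp]: "ok_exp d (conj_exp es) = (\<forall>e\<in>set es. ok_exp d e)"
  by (induction es) (auto simp: conj_exp_def)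
lemma ok_disj_exp [simp]: "ok_exp d (disj_exp es) = (\<forall>e\<in>set es. ok_exp d e)"
  by (induction es) (auto simp: disj_exp_def)

definition Nop :: stmt where "Nop = For (Const 0) (Out True)"
definition Block :: "stmt list \<Rightarrow> stmt" where "Block ss = foldr Then ss Nop"
definition OutRat :: "exp \<Rightarrow> stmt" where
  "OutRat e = Then (Out False) (Then (OutNat e) (OutNat (Const 1)))"

lemma sem_Nop [simp]: "sem w d \<sigma> Nop = []" by (simp add: Nop_def)
lemma sem_Block [simp]: "sem w d \<sigma> (Block ss) = concat (map (sem w d \<sigma>) ss)"
  by (induction ss) (auto simp: Block_def)

lemma enc_rat_of_nat: "enc_rat (of_nat k) = False # enc_nat k @ enc_nat 1"
proof -
  have "quotient_of (of_nat k) = (int k, 1)"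
    by (simp add: of_nat_rat quotient_of_Fract normalize_def)
  then show ?thesis by (simp add: enc_rat_def)
qed

lemma sem_OutRat [simp]: "sem w d \<sigma> (OutRat e) = enc_rat (of_nat (eval w \<sigma> e))"
  by (simp add: OutRat_def enc_rat_of_nat)

lemma ok_Nop [simp]: "ok_stmt d Nop" by (simp add: Nop_def)
lemma ok_Block [simp]: "ok_stmt d (Block ss) = (\<forall>s\<in>set ss. ok_stmt d s)"
  by (induction ss) (auto simp: Block_def)
lemma ok_OutRat [simp]: "ok_stmt d (OutRat e) = ok_exp d e" by (simp add: OutRat_def)

text \<open>
  A schema consists of a guard and of literals, whose coordinates and guard are expressions in the
  coordinates of the clause, held by the variables \<open>8\<close> and \<open>10\<close>. With \<open>A\<close> propositional variables
  at each place, literal \<open>l < A\<close> is positive and \<open>A + l\<close> is its negation.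
\<close>

type_synonym schema = "exp \<times> (exp \<times> exp \<times> nat) list"

text \<open>Six nested loops enumerate pairs of vertices with three coordinates each. As a loop
  binds two variables, the coordinates are the variables 2, 4, 6 and 8, 10, 12. A clause belongs to
  the second vertex, where its edges end; hence 8 and 10.\<close>

definition place :: "nat \<Rightarrow> nat \<Rightarrow> nat \<Rightarrow> nat" where
  "place a b = (\<lambda>_. 0)(8 := a, 10 := b)"

primrec local_exp :: "exp \<Rightarrow> bool" where
  "local_exp (Const n) = True"
| "local_exp (Var j) = (j = 8 \<or> j = 10)"
| "local_exp Len = True"
| "local_exp (Add a b) = (local_exp a \<and> local_exp b)"
| "local_exp (Sub a b) = (local_exp a \<and> local_exp b)"
| "local_exp (Mul a b) = (local_exp a \<and> local_exp b)"
| "local_exp (Bit a) = local_exp a"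

lemma local_eval: "local_exp e \<Longrightarrow> eval w \<sigma> e = eval w (place (\<sigma> 8) (\<sigma> 10)) e"
  by (induction e) (auto simp: place_def)

lemma local_ok: "local_exp e \<Longrightarrow> 10 < d \<Longrightarrow> ok_exp d e"
  by (induction e) auto

lemma closed_eval: "ok_exp 0 e \<Longrightarrow> eval w \<sigma> e = eval w \<sigma>' e"
  by (rule eval_cong) auto

lemma closed_ok: "ok_exp 0 e \<Longrightarrow> ok_exp d e"
  by (rule ok_exp_mono) auto

text \<open>A loop over numbers is a nest of loops over their mixed-radix digits in the same order;
  this links the printed loops to the encoding.\<close>

lemma concat_upt_mult:
  "concat (map h [0..<m * k]) = concat (map (\<lambda>i. concat (map (\<lambda>j. h (i * k + j)) [0..<k])) [0..<m])"
proof (induction m)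
  case (Suc m)
  have "[0..<Suc m * k] = [0..<m * k] @ map (\<lambda>j. m * k + j) [0..<k]"
    using upt_add_eq_append[of 0 "m * k" k] map_add_upt[of "m * k" k] by (simp add: add.commute)
  then have "concat (map h [0..<Suc m * k]) =
      concat (map h [0..<m * k]) @ concat (map (\<lambda>j. h (m * k + j)) [0..<k])"
    by (simp add: comp_def)
  then show ?case using Suc by simp
qed simp

lemma mixed_radix_less:
  assumes "(a :: nat) < m" "c < k"
  shows "a * k + c < m * k"
proof -
  have "a * k + c < Suc a * k" using assms by simp
  also have "\<dots> \<le> m * k" using assms by (intro mult_le_mono1) simp
  finally show ?thesis .
qed

lemma concat_map_product:
  "concat (map h (List.product xs ys)) = concat (map (\<lambda>x. concat (map (\<lambda>y. h (x, y)) ys)) xs)"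
  by (induction xs) (auto simp: comp_def)

text \<open>The printing program handles a filtered list by testing each candidate in place.\<close>

lemma enc_list_filter:
  "enc_list f (filter P xs) = concat (map (\<lambda>x. if P x then True # f x else []) xs) @ [False]"
  by (induction xs) (auto simp: enc_list_def)

text \<open>\<open>Ta\<close> and \<open>Tb\<close> are the side lengths of the grid, determined by
  the input alone. The coordinates of a literal may leave the grid, and then it does not help its
  clause; \<open>inhabited\<close> ensures that some literal of every active clause stays inside, so
  that all literals together are a cover.\<close>

locale grid =
  fixes Ta Tb :: exp and A :: nat and \<Gamma> :: "schema list"
  assumes closed: "ok_exp 0 Ta" "ok_exp 0 Tb"
    and pos: "\<And>w. 0 < eval w (\<lambda>_. 0) Ta" "\<And>w. 0 < eval w (\<lambda>_. 0) Tb"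
    and schemas: "\<And>g ls. (g, ls) \<in> set \<Gamma> \<Longrightarrow> local_exp g"
      "\<And>g ls ea eb l. (g, ls) \<in> set \<Gamma> \<Longrightarrow> (ea, eb, l) \<in> set ls \<Longrightarrow>
         local_exp ea \<and> local_exp eb \<and> l < 2 * A"
    and inhabited: "\<And>w a b g ls. (g, ls) \<in> set \<Gamma> \<Longrightarrow> a < eval w (\<lambda>_. 0) Ta \<Longrightarrow>
       b < eval w (\<lambda>_. 0) Tb \<Longrightarrow> 0 < eval w (place a b) g \<Longrightarrow>
       \<exists>(ea, eb, l) \<in> set ls. eval w (place a b) ea < eval w (\<lambda>_. 0) Ta \<and>
         eval w (place a b) eb < eval w (\<lambda>_. 0) Tb"
begin

definition "ta w = eval w (\<lambda>_. 0) Ta"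
definition "tb w = eval w (\<lambda>_. 0) Tb"

lemma eval_T: "eval w \<sigma> Ta = ta w" "eval w \<sigma> Tb = tb w"
  unfolding ta_def tb_def using closed closed_eval by blast+

definition satisfied :: "bool list \<Rightarrow> (nat \<Rightarrow> nat \<Rightarrow> nat \<Rightarrow> bool) \<Rightarrow> bool" where
  "satisfied w P \<longleftrightarrow> (\<forall>a < ta w. \<forall>b < tb w. \<forall>(g, ls) \<in> set \<Gamma>. 0 < eval w (place a b) g \<longrightarrow>
     (\<exists>(ea, eb, l) \<in> set ls. eval w (place a b) ea < ta w \<and> eval w (place a b) eb < tb w \<and>
        (if l < A then P (eval w (place a b) ea) (eval w (place a b) eb) l
         else \<not> P (eval w (place a b) ea) (eval w (place a b) eb) (l - A))))"

definition "tautology l = (Const 1, [(Var 8, Var 10, l), (Var 8, Var 10, A + l)])"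

text \<open>
  The elements to be covered are the clauses, including \<open>x \<or> \<not> x\<close> for each variable; the sets are
  the literals. As many sets as there are variables suffice only if they form an assignment.
\<close>

definition "\<Delta> = \<Gamma> @ map tautology [0..<A]"
text \<open>Component 0 is the source at place (0, 0) and an isolated vertex at every other place;
  components 1 to \<open>2 * A\<close> are the literals, those above are the elements.\<close>

definition "C = Suc (2 * A + length \<Delta>)"
definition "n w = ta w * tb w * C"

definition "num w a b c = (a * tb w + b) * C + c"
definition "pa w v = v div C div tb w"
definition "pb w v = v div C mod tb w"
definition "pc (v :: nat) = v mod C"

lemma C_pos: "0 < C" by (simp add: C_def)

lemma schemas_\<Delta>:
  assumes "(g, ls) \<in> set \<Delta>"
  shows "local_exp g" "(ea, eb, l) \<in> set ls \<Longrightarrow> local_exp ea \<and> local_exp eb \<and> l < 2 * A"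
  using assms schemas unfolding \<Delta>_def by (auto simp: tautology_def)

lemma num_decode:
  assumes "b < tb w" "c < C"
  shows "pa w (num w a b c) = a" "pb w (num w a b c) = b" "pc (num w a b c) = c"
  using assms by (simp_all add: num_def pa_def pb_def pc_def)

lemma num_less:
  assumes "a < ta w" "b < tb w" "c < C"
  shows "num w a b c < n w"
  using mixed_radix_less[OF mixed_radix_less[OF assms(1,2)] assms(3)]
  unfolding num_def n_def .

lemma decode_num: "num w (pa w v) (pb w v) (pc v) = v"
  by (simp only: num_def pa_def pb_def pc_def div_mult_mod_eq)

lemma decode_less: "v < n w \<Longrightarrow> pa w v < ta w" "pb w v < tb w" "pc v < C"
proof -
  show "v < n w \<Longrightarrow> pa w v < ta w"
    by (simp add: n_def pa_def less_mult_imp_div_less)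
  show "pb w v < tb w" "pc v < C" using pos C_pos by (simp_all add: pb_def pc_def tb_def)
qed

text \<open>Edges lead from the source to literals, from the source to elements whose guard is false
  at their place, and from literals to the active elements in which they occur. The second kind
  disposes of inactive clauses without disturbing the regular numbering.\<close>

definition edge :: "bool list \<Rightarrow> nat \<Rightarrow> nat \<Rightarrow> nat \<Rightarrow> nat \<Rightarrow> nat \<Rightarrow> nat \<Rightarrow> bool" where
  "edge w a b c a' b' c' \<longleftrightarrow>
     (a = 0 \<and> b = 0 \<and> c = 0 \<and> 0 < c' \<and> c' < Suc (2 * A)) \<or>
     (\<exists>i < length \<Delta>. c' = Suc (2 * A + i) \<and>
        (a = 0 \<and> b = 0 \<and> c = 0 \<and> \<not> 0 < eval w (place a' b') (fst (\<Delta> ! i)) \<or>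
         0 < eval w (place a' b') (fst (\<Delta> ! i)) \<and>
         (\<exists>(ea, eb, l) \<in> set (snd (\<Delta> ! i)). a = eval w (place a' b') ea \<and>
            b = eval w (place a' b') eb \<and> c = Suc l)))"

definition "at_root = [not_exp (Var 2), not_exp (Var 4), not_exp (Var 6)]"

definition "lit_exp = (\<lambda>(ea, eb, l). conj_exp [eq_exp (Var 2) ea, eq_exp (Var 4) eb, eq_exp (Var 6) (Const (Suc l))])"

definition "schema_exp i = conj_exp [eq_exp (Var 12) (Const (Suc (2 * A + i))),
   Add (conj_exp (not_exp (fst (\<Delta> ! i)) # at_root))
       (conj_exp [fst (\<Delta> ! i), disj_exp (map lit_exp (snd (\<Delta> ! i)))])]"

definition "edge_exp = Add (conj_exp (Var 12 # Sub (Const (Suc (2 * A))) (Var 12) # at_root))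
   (disj_exp (map schema_exp [0..<length \<Delta>]))"

lemma eval_edge_exp:
  "0 < eval w \<sigma> edge_exp \<longleftrightarrow> edge w (\<sigma> 2) (\<sigma> 4) (\<sigma> 6) (\<sigma> 8) (\<sigma> 10) (\<sigma> 12)"
proof -
  let ?p = "place (\<sigma> 8) (\<sigma> 10)"
  have r: "(\<forall>e\<in>set at_root. 0 < eval w \<sigma> e) \<longleftrightarrow> \<sigma> 2 = 0 \<and> \<sigma> 4 = 0 \<and> \<sigma> 6 = 0"
    by (auto simp: at_root_def eval_not_exp)
  have add: "0 < eval w \<sigma> (Add a b) \<longleftrightarrow> 0 < eval w \<sigma> a \<or> 0 < eval w \<sigma> b" for a b by auto
  have s: "0 < eval w \<sigma> (schema_exp i) \<longleftrightarrow> \<sigma> 12 = Suc (2 * A + i) \<and>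
      (\<sigma> 2 = 0 \<and> \<sigma> 4 = 0 \<and> \<sigma> 6 = 0 \<and> \<not> 0 < eval w ?p (fst (\<Delta> ! i)) \<or>
       0 < eval w ?p (fst (\<Delta> ! i)) \<and>
       (\<exists>(ea, eb, l) \<in> set (snd (\<Delta> ! i)). \<sigma> 2 = eval w ?p ea \<and> \<sigma> 4 = eval w ?p eb \<and> \<sigma> 6 = Suc l))"
    if "i < length \<Delta>" for i
  proof -
    obtain g ls where gl: "\<Delta> ! i = (g, ls)" by force
    then have m: "(g, ls) \<in> set \<Delta>" using that by (metis nth_mem)
    have "eval w \<sigma> g = eval w ?p g" using local_eval schemas_\<Delta>(1)[OF m] by blast
    moreover have "0 < eval w \<sigma> (lit_exp (ea, eb, l)) \<longleftrightarrow>
        \<sigma> 2 = eval w ?p ea \<and> \<sigma> 4 = eval w ?p eb \<and> \<sigma> 6 = Suc l" if "(ea, eb, l) \<in> set ls" for ea eb l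
      using local_eval[of ea w \<sigma>] local_eval[of eb w \<sigma>] schemas_\<Delta>(2)[OF m that]
      by (simp add: lit_exp_def eval_conj_exp eval_eq_exp)
    then have "(\<exists>x\<in>set ls. 0 < eval w \<sigma> (lit_exp x)) \<longleftrightarrow>
        (\<exists>(ea, eb, l) \<in> set ls. \<sigma> 2 = eval w ?p ea \<and> \<sigma> 4 = eval w ?p eb \<and> \<sigma> 6 = Suc l)"
      by (intro bex_cong) auto
    ultimately have "0 < eval w \<sigma> (conj_exp [g, disj_exp (map lit_exp ls)]) \<longleftrightarrow> 0 < eval w ?p g \<and>
        (\<exists>(ea, eb, l) \<in> set ls. \<sigma> 2 = eval w ?p ea \<and> \<sigma> 4 = eval w ?p eb \<and> \<sigma> 6 = Suc l)"
      by (simp only: eval_conj_exp eval_disj_exp list.set set_map ball_simps bex_simps) simp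
    moreover have "0 < eval w \<sigma> (conj_exp (not_exp g # at_root)) \<longleftrightarrow>
        \<sigma> 2 = 0 \<and> \<sigma> 4 = 0 \<and> \<sigma> 6 = 0 \<and> \<not> 0 < eval w ?p g"
      using r \<open>eval w \<sigma> g = eval w ?p g\<close> by (auto simp only: eval_conj_exp eval_not_exp list.set ball_simps)
    moreover have "0 < eval w \<sigma> (schema_exp i) \<longleftrightarrow> \<sigma> 12 = Suc (2 * A + i) \<and>
        (0 < eval w \<sigma> (conj_exp (not_exp g # at_root)) \<or> 0 < eval w \<sigma> (conj_exp [g, disj_exp (map lit_exp ls)]))"
      unfolding schema_exp_def gl fst_conv snd_conv eval_conj_exp[of _ _ "[_, Add _ _]"]
      by (simp only: list.set ball_simps add eval_eq_exp eval.simps(1,2)) simp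
    ultimately show ?thesis unfolding gl fst_conv snd_conv by (simp only: conj_assoc)
  qed
  have d: "0 < eval w \<sigma> (disj_exp (map schema_exp [0..<length \<Delta>])) \<longleftrightarrow>
      (\<exists>i < length \<Delta>. 0 < eval w \<sigma> (schema_exp i))" by (auto simp: eval_disj_exp)
  have "0 < eval w \<sigma> edge_exp \<longleftrightarrow> (\<sigma> 2 = 0 \<and> \<sigma> 4 = 0 \<and> \<sigma> 6 = 0 \<and> 0 < \<sigma> 12 \<and> \<sigma> 12 < Suc (2 * A)) \<or>
      (\<exists>i < length \<Delta>. 0 < eval w \<sigma> (schema_exp i))"
    unfolding edge_exp_def add d eval_conj_exp list.set ball_simps r by auto
  moreover have "(\<exists>i < length \<Delta>. 0 < eval w \<sigma> (schema_exp i)) \<longleftrightarrow> (\<exists>i < length \<Delta>.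
      \<sigma> 12 = Suc (2 * A + i) \<and>
      (\<sigma> 2 = 0 \<and> \<sigma> 4 = 0 \<and> \<sigma> 6 = 0 \<and> \<not> 0 < eval w ?p (fst (\<Delta> ! i)) \<or>
       0 < eval w ?p (fst (\<Delta> ! i)) \<and>
       (\<exists>(ea, eb, l) \<in> set (snd (\<Delta> ! i)). \<sigma> 2 = eval w ?p ea \<and> \<sigma> 4 = eval w ?p eb \<and> \<sigma> 6 = Suc l)))"
    using s by (intro ex_cong1 conj_cong refl) simp
  ultimately show ?thesis unfolding edge_def by (simp only:)
qed

section \<open>Printing the instance\<close>

definition pairs :: "stmt \<Rightarrow> stmt" where
  "pairs s = For Ta (For Tb (For (Const C) (For Ta (For Tb (For (Const C) s)))))"

lemma sem_pairs:
  assumes "\<And>\<sigma>. \<sigma> 2 < ta w \<Longrightarrow> \<sigma> 4 < tb w \<Longrightarrow> \<sigma> 6 < C \<Longrightarrow> \<sigma> 8 < ta w \<Longrightarrow> \<sigma> 10 < tb w \<Longrightarrow>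
    \<sigma> 12 < C \<Longrightarrow>
    sem w 14 \<sigma> s = h (num w (\<sigma> 2) (\<sigma> 4) (\<sigma> 6), num w (\<sigma> 8) (\<sigma> 10) (\<sigma> 12))"
  shows "sem w 2 \<sigma> (pairs s) = concat (map h (List.product [0..<n w] [0..<n w]))"
  unfolding concat_map_product n_def concat_upt_mult pairs_def sem.simps eval_T eval.simps
  by (intro arg_cong[where f = concat] map_cong refl) (simp add: assms num_def)

definition U :: "bool list \<Rightarrow> nat set" where "U w = {v. v < n w \<and> 0 < pc v \<and> pc v < Suc (2 * A)}"
definition X :: "bool list \<Rightarrow> nat set" where "X w = {v. v < n w \<and> 2 * A < pc v}"
definition E :: "bool list \<Rightarrow> (nat \<times> nat) set" where
  "E w = {(u, v). u < n w \<and> v < n w \<and> edge w (pa w u) (pb w u) (pc u) (pa w v) (pb w v) (pc v)}"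
definition "vars w = ta w * tb w * A"

abbreviation "msp_of w \<equiv> cover_msp (n w) (X w) (E w) (vars w)"

text \<open>The budget involves the number of elements, so this number has to be available as an
  expression of the printing language.\<close>

lemma card_X: "card (X w) = ta w * tb w * length \<Delta>"
proof -
  let ?f = "\<lambda>(i, j). i * C + Suc (2 * A + j)"
  have inj: "inj_on ?f ({..<ta w * tb w} \<times> {..<length \<Delta>})"
  proof (rule inj_onI, clarify)
    fix i j i' j' assume *: "j < length \<Delta>" "j' < length \<Delta>"
      "i * C + Suc (2 * A + j) = i' * C + Suc (2 * A + j')"
    then have "Suc (2 * A + j) < C" "Suc (2 * A + j') < C" by (simp_all add: C_def)
    moreover have "\<And>i x. x < C \<Longrightarrow> (i * C + x) div C = i" by simp
    ultimately have "(i * C + Suc (2 * A + j)) div C = i" "(i' * C + Suc (2 * A + j')) div C = i'"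
      by blast+
    then show "i = i' \<and> j = j'" using * by (metis add_left_cancel add_Suc_right Suc_inject)
  qed
  have "X w = ?f ` ({..<ta w * tb w} \<times> {..<length \<Delta>})"
  proof safe
    fix v assume v: "v \<in> X w"
    then have "v div C < ta w * tb w" by (simp add: X_def n_def less_mult_imp_div_less)
    moreover have "pc v < C" "2 * A < pc v" "v = v div C * C + pc v"
      using v C_pos by (simp_all only: X_def pc_def div_mult_mod_eq mem_Collect_eq mod_less_divisor)
    then have "pc v - Suc (2 * A) < length \<Delta>" "v = v div C * C + Suc (2 * A + (pc v - Suc (2 * A)))"
      by (simp add: C_def, linarith)
    ultimately show "v \<in> ?f ` ({..<ta w * tb w} \<times> {..<length \<Delta>})"
      by (intro image_eqI[of _ _ "(v div C, pc v - Suc (2 * A))"]) auto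
  next
    fix i j assume *: "i < ta w * tb w" "j < length \<Delta>"
    then have c: "Suc (2 * A + j) < C" by (simp add: C_def)
    have "i * C + Suc (2 * A + j) < n w"
      unfolding n_def by (rule mixed_radix_less[OF *(1) c])
    moreover have "(i * C + Suc (2 * A + j)) mod C = Suc (2 * A + j)"
      using c by (simp only: mod_mult_self3 mod_less)
    ultimately show "i * C + Suc (2 * A + j) \<in> X w" by (simp add: X_def pc_def)
  qed
  then show ?thesis using card_image[OF inj] by (simp add: card_cartesian_product)
qed

definition "vertex_exp j = Add (Mul (Add (Mul (Var j) Tb) (Var (j + 2))) (Const C)) (Var (j + 4))"

text \<open>The fields are in the order of \<open>enc_msp\<close>. Each of the two modes, introduced
  by \<open>Out True\<close>, has travel time, energy, cost and capacity. Of the last two bits, one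
  closes the list of modes and the other encodes the infinite time bound.\<close>

definition reduction :: stmt where
  "reduction = Block [
     OutNat (Mul (Mul Ta Tb) (Const C)),
     pairs (Test edge_exp
       (Block [Out True, OutNat (vertex_exp 2), OutNat (vertex_exp 8), OutNat (Const 1)]) Nop),
     Out False,
     OutRat (Mul (Mul Ta Tb) (Const (length \<Delta> + A))),
     pairs (Block [Out True, Test (conj_exp (Sub (Var 12) (Const (2 * A)) # at_root))
       (OutNat (Const 1)) (OutNat (Const 0))]),
     Out False,
     Out True, OutRat (Const 0), OutRat (Const 1), OutRat (Const 0), OutRat (Const 1),
     Out True, OutRat (Const 0), OutRat (Const 0), OutRat (Const 1),
     OutRat (Mul (Mul Ta Tb) (Const C)),
     Out False, Out False]"

lemma eval_vertex_exp: "eval w \<sigma> (vertex_exp j) = num w (\<sigma> j) (\<sigma> (j + 2)) (\<sigma> (j + 4))"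
  by (simp add: vertex_exp_def num_def eval_T)

lemma root_num:
  "b < tb w \<Longrightarrow> c < C \<Longrightarrow> num w a b c = 0 \<longleftrightarrow> a = 0 \<and> b = 0 \<and> c = 0"
  using C_pos by (auto simp: num_def)

lemma sem_reduction: "sem w 2 (\<lambda>_. 0) reduction = enc_msp (msp_of w)"
proof -
  let ?I = "msp_of w"
  let ?p = "List.product [0..<n w] [0..<n w]"
  have edges: "sem w 2 (\<lambda>_. 0) (pairs (Test edge_exp
       (Block [Out True, OutNat (vertex_exp 2), OutNat (vertex_exp 8), OutNat (Const 1)]) Nop)) =
     concat (map (\<lambda>e. if e \<in> E w then True # (enc_nat (fst e) @ enc_nat (snd e) @ enc_nat 1) else []) ?p)"
    by (rule sem_pairs)
      (simp add: E_def eval_edge_exp num_less num_decode eval_vertex_exp del: length_upt)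
  have demands: "sem w 2 (\<lambda>_. 0) (pairs (Block [Out True, Test (conj_exp (Sub (Var 12) (Const (2 * A)) # at_root))
       (OutNat (Const 1)) (OutNat (Const 0))])) =
     concat (map (\<lambda>\<kappa>. True # enc_nat (demand ?I \<kappa>)) ?p)"
  proof (rule sem_pairs)
    fix \<sigma> :: "nat \<Rightarrow> nat"
    assume "\<sigma> 2 < ta w" "\<sigma> 4 < tb w" "\<sigma> 6 < C" "\<sigma> 8 < ta w" "\<sigma> 10 < tb w" "\<sigma> 12 < C"
    then have "0 < eval w \<sigma> (conj_exp (Sub (Var 12) (Const (2 * A)) # at_root)) \<longleftrightarrow>
        num w (\<sigma> 2) (\<sigma> 4) (\<sigma> 6) = 0 \<and> num w (\<sigma> 8) (\<sigma> 10) (\<sigma> 12) \<in> X w"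
      by (simp add: eval_conj_exp at_root_def eval_not_exp root_num X_def num_less num_decode) auto
    then show "sem w 14 \<sigma> (Block [Out True, Test (conj_exp (Sub (Var 12) (Const (2 * A)) # at_root))
       (OutNat (Const 1)) (OutNat (Const 0))]) =
      True # enc_nat (demand ?I (num w (\<sigma> 2) (\<sigma> 4) (\<sigma> 6), num w (\<sigma> 8) (\<sigma> 10) (\<sigma> 12)))"
      by (simp add: cover_msp_def)
  qed
  have b: "of_nat (ta w * tb w * (length \<Delta> + A)) = budget ?I"
    by (simp add: cover_msp_def card_X vars_def algebra_simps)
  have "edge_list ?I = filter (\<lambda>e. e \<in> E w) ?p"
    by (simp add: edge_list_def vertex_pairs_def cover_msp_def)
  moreover have weight: "weight ?I e = 1" for e by (simp add: cover_msp_def)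
  ultimately have e1: "enc_list (\<lambda>e. enc_nat (fst e) @ enc_nat (snd e) @ enc_nat (weight ?I e)) (edge_list ?I) =
      concat (map (\<lambda>e. if e \<in> E w then True # (enc_nat (fst e) @ enc_nat (snd e) @ enc_nat 1) else []) ?p) @ [False]"
    by (simp only: enc_list_filter weight)
  have e2: "enc_list (\<lambda>\<kappa>. enc_nat (demand ?I \<kappa>)) (vertex_pairs ?I) =
      concat (map (\<lambda>\<kappa>. True # enc_nat (demand ?I \<kappa>)) ?p) @ [False]"
    by (simp add: enc_list_def vertex_pairs_def cover_msp_def)
  have "[0..<Suc (num_modes ?I)] = [0, 1]" by (simp add: cover_msp_def upt_rec)
  then have e3: "enc_list (\<lambda>i. enc_rat (tau ?I i) @ enc_rat (eta ?I i) @ enc_rat (cost ?I i) @ enc_rat (cap ?I i))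
       [0..<Suc (num_modes ?I)] =
     True # (enc_rat (of_nat 0) @ enc_rat (of_nat 1) @ enc_rat (of_nat 0) @ enc_rat (of_nat 1)) @
     True # (enc_rat (of_nat 0) @ enc_rat (of_nat 0) @ enc_rat (of_nat 1) @ enc_rat (of_nat (n w))) @ [False]"
    by (simp only:) (simp add: enc_list_def cover_msp_def)
  have e4: "num_vertices ?I = n w" "time_bound ?I = None" by (simp_all add: cover_msp_def)
  show ?thesis
    unfolding enc_msp_def e1 e2 e3 e4 unfolding reduction_def sem_Block list.map concat.simps edges
      demands sem_OutRat eval.simps eval_T b sem.simps n_def[symmetric]
    by (simp del: One_nat_def)
qed

lemma ok_reduction: "ok_stmt 2 reduction"
proof -
  have T: "ok_exp d Ta" "ok_exp d Tb" for d using closed closed_ok by blast+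
  have "ok_exp 14 (schema_exp i)" if "i < length \<Delta>" for i
  proof -
    obtain g ls where gl: "\<Delta> ! i = (g, ls)" by force
    then have m: "(g, ls) \<in> set \<Delta>" using that by (metis nth_mem)
    have "ok_exp 14 (lit_exp x)" if "x \<in> set ls" for x
      using schemas_\<Delta>(2)[OF m] that by (cases x) (auto simp: lit_exp_def local_ok)
    then show ?thesis using local_ok schemas_\<Delta>(1)[OF m] by (simp add: schema_exp_def gl at_root_def)
  qed
  then have "ok_exp 14 edge_exp" by (simp add: edge_exp_def at_root_def)
  then show ?thesis by (simp add: reduction_def pairs_def vertex_exp_def at_root_def T)
qed

theorem poly_time_reduction: "poly_time (\<lambda>w. enc_msp (msp_of w))"
  using poly_time_sem[OF ok_reduction] by (simp add: sem_reduction)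

section \<open>Covers and satisfying assignments\<close>

lemma cover: "cover (n w) (U w) (X w) (E w)"
proof
  show "U w \<subseteq> {0<..<n w}" "X w \<subseteq> {0<..<n w}" by (auto simp: U_def X_def pc_def intro!: Nat.gr0I)
  show "U w \<inter> X w = {}" by (auto simp: U_def X_def)
  show n: "0 < n w" using pos C_pos by (simp add: n_def ta_def tb_def)
  have r: "u = 0" if "pa w u = 0" "pb w u = 0" "pc u = 0" for u
    using decode_num[of w u] that by (simp add: num_def)
  have "u = 0 \<and> v \<in> U w \<union> X w \<or> u \<in> U w \<and> v \<in> X w" if "(u, v) \<in> E w" for u v
  proof -
    from that have lt: "u < n w" "v < n w"
      and e: "edge w (pa w u) (pb w u) (pc u) (pa w v) (pb w v) (pc v)" by (auto simp: E_def)
    from e show ?thesis unfolding edge_def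
    proof (elim disjE exE conjE)
      fix i assume i: "i < length \<Delta>" "pc v = Suc (2 * A + i)"
        and "\<exists>(ea, eb, l) \<in> set (snd (\<Delta> ! i)). pa w u = eval w (place (pa w v) (pb w v)) ea \<and>
            pb w u = eval w (place (pa w v) (pb w v)) eb \<and> pc u = Suc l"
      then obtain ea eb l where "(ea, eb, l) \<in> set (snd (\<Delta> ! i))" "pc u = Suc l" by auto
      moreover from this have "l < 2 * A"
        using schemas_\<Delta>(2)[of "fst (\<Delta> ! i)" "snd (\<Delta> ! i)"] i(1) by auto
      ultimately show ?thesis using i lt by (simp add: U_def X_def)
    qed (use r lt in \<open>auto simp: U_def X_def\<close>)
  qed
  then show "E w \<subseteq> {0} \<times> (U w \<union> X w) \<union> U w \<times> X w" by auto
  have "pa w 0 = 0" "pb w 0 = 0" "pc 0 = 0" by (simp_all add: pa_def pb_def pc_def)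
  then show "{0} \<times> U w \<subseteq> E w" using n by (auto simp: E_def U_def edge_def)
qed

lemma msp_of_simps:
  "msp_instance (msp_of w)" "num_modes (msp_of w) = 1" "weight (msp_of w) e = 1"
  "time_bound (msp_of w) = None"
  using cover.instance_I[OF cover] by (auto simp: cover_msp_def)

text \<open>If the guard fails, the direct edge is present; if it holds, the predecessors of the
  element are precisely the literals of its clause that lie in the grid.\<close>

lemma element_covered:
  assumes "v < n w" "pc v = Suc (2 * A + i)" "i < length \<Delta>" "S \<subseteq> U w"
  shows "(0, v) \<in> E w \<or> (\<exists>u\<in>S. (u, v) \<in> E w) \<longleftrightarrow>
    (0 < eval w (place (pa w v) (pb w v)) (fst (\<Delta> ! i)) \<longrightarrow>
     (\<exists>(ea, eb, l) \<in> set (snd (\<Delta> ! i)). eval w (place (pa w v) (pb w v)) ea < ta w \<and>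
        eval w (place (pa w v) (pb w v)) eb < tb w \<and>
        num w (eval w (place (pa w v) (pb w v)) ea) (eval w (place (pa w v) (pb w v)) eb) (Suc l) \<in> S))"
    (is "?L \<longleftrightarrow> (?g \<longrightarrow> (\<exists>(ea, eb, l) \<in> ?ls. ?R ea eb l))")
proof -
  let ?p = "place (pa w v) (pb w v)"
  have n: "0 < n w" using assms(1) by simp
  have z: "pa w 0 = 0" "pb w 0 = 0" "pc 0 = 0" by (simp_all add: pa_def pb_def pc_def)
  have 0: "(0, v) \<in> E w \<longleftrightarrow> \<not> ?g"
    using assms n z by (auto simp: E_def edge_def)
  have 1: "(u, v) \<in> E w \<longleftrightarrow> ?g \<and> (\<exists>(ea, eb, l) \<in> ?ls. pa w u = eval w ?p ea \<and>
      pb w u = eval w ?p eb \<and> pc u = Suc l)" if "u \<in> U w" for u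
    using assms that by (auto simp: E_def edge_def U_def)
  have 2: "(\<exists>u\<in>S. \<exists>(ea, eb, l) \<in> ?ls. pa w u = eval w ?p ea \<and> pb w u = eval w ?p eb \<and> pc u = Suc l)
     \<longleftrightarrow> (\<exists>(ea, eb, l) \<in> ?ls. ?R ea eb l)"
  proof safe
    fix u ea eb l
    assume "u \<in> S" "(ea, eb, l) \<in> ?ls" "pa w u = eval w ?p ea" "pb w u = eval w ?p eb" "pc u = Suc l"
    moreover from this have "u < n w" using assms(4) by (auto simp: U_def)
    ultimately show "\<exists>(ea, eb, l) \<in> ?ls. ?R ea eb l"
      using decode_num[of w u] decode_less(1)[of u w] decode_less(2)[of w u] by (intro bexI[of _ "(ea, eb, l)"]) auto
  next
    fix ea eb l assume *: "(ea, eb, l) \<in> ?ls" "eval w ?p ea < ta w" "eval w ?p eb < tb w"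
      "num w (eval w ?p ea) (eval w ?p eb) (Suc l) \<in> S"
    have "l < 2 * A" using schemas_\<Delta>(2)[of "fst (\<Delta> ! i)" "snd (\<Delta> ! i)"] assms(3) *(1) by auto
    then have "Suc l < C" by (simp add: C_def)
    then show "\<exists>u\<in>S. \<exists>(ea, eb, l) \<in> ?ls. pa w u = eval w ?p ea \<and> pb w u = eval w ?p eb \<and> pc u = Suc l"
      using * num_decode[of "eval w ?p eb" w "Suc l" "eval w ?p ea"]
      by (intro bexI[OF _ *(4)] bexI[of _ "(ea, eb, l)"]) auto
  qed
  define K where "K u \<longleftrightarrow> (\<exists>(ea, eb, l) \<in> ?ls. pa w u = eval w ?p ea \<and> pb w u = eval w ?p eb \<and>
      pc u = Suc l)" for u
  have "(\<exists>u\<in>S. (u, v) \<in> E w) \<longleftrightarrow> (\<exists>u\<in>S. ?g \<and> K u)"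
    using 1[folded K_def] assms(4) by (intro bex_cong refl) (simp add: subset_iff)
  also have "\<dots> \<longleftrightarrow> ?g \<and> (\<exists>u\<in>S. K u)" by simp
  finally have 3: "(\<exists>u\<in>S. (u, v) \<in> E w) \<longleftrightarrow> ?g \<and> (\<exists>u\<in>S. K u)" .
  show ?thesis unfolding 0 3 2[folded K_def, symmetric] by auto
qed

lemma covers_iff:
  assumes "S \<subseteq> U w"
  shows "cover.covers (U w) (X w) (E w) S \<longleftrightarrow>
    (\<forall>a < ta w. \<forall>b < tb w. \<forall>(g, ls) \<in> set \<Delta>. 0 < eval w (place a b) g \<longrightarrow>
     (\<exists>(ea, eb, l) \<in> set ls. eval w (place a b) ea < ta w \<and> eval w (place a b) eb < tb w \<and>
        num w (eval w (place a b) ea) (eval w (place a b) eb) (Suc l) \<in> S))"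
    (is "_ \<longleftrightarrow> (\<forall>a < ta w. \<forall>b < tb w. \<forall>x \<in> set \<Delta>. ?R a b x)")
proof -
  have "cover.covers (U w) (X w) (E w) S \<longleftrightarrow> (\<forall>v\<in>X w. (0, v) \<in> E w \<or> (\<exists>u\<in>S. (u, v) \<in> E w))"
    using assms by (simp add: cover.covers_def[OF cover])
  also have "\<dots> \<longleftrightarrow> (\<forall>a < ta w. \<forall>b < tb w. \<forall>i < length \<Delta>. ?R a b (\<Delta> ! i))"
  proof safe
    fix a b i x y assume *: "\<forall>v\<in>X w. (0, v) \<in> E w \<or> (\<exists>u\<in>S. (u, v) \<in> E w)"
      "a < ta w" "b < tb w" "i < length \<Delta>" "\<Delta> ! i = (x, y)" "0 < eval w (place a b) x"
    let ?v = "num w a b (Suc (2 * A + i))"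
    have c: "Suc (2 * A + i) < C" using * by (simp add: C_def)
    have v: "?v < n w" "pa w ?v = a" "pb w ?v = b" "pc ?v = Suc (2 * A + i)"
      using num_less num_decode * c by auto
    then have "?v \<in> X w" by (simp add: X_def)
    with *(1) have "(0, ?v) \<in> E w \<or> (\<exists>u\<in>S. (u, ?v) \<in> E w)" by blast
    then show "\<exists>(ea, eb, l) \<in> set y. eval w (place a b) ea < ta w \<and> eval w (place a b) eb < tb w \<and>
        num w (eval w (place a b) ea) (eval w (place a b) eb) (Suc l) \<in> S"
      using element_covered[OF v(1,4) *(4) assms] * v by simp
  next
    fix v assume *: "\<forall>a < ta w. \<forall>b < tb w. \<forall>i < length \<Delta>. ?R a b (\<Delta> ! i)"
      "v \<in> X w" "\<not> (\<exists>u\<in>S. (u, v) \<in> E w)"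
    let ?i = "pc v - Suc (2 * A)"
    have "v < n w" "2 * A < pc v" "pc v < Suc (2 * A + length \<Delta>)"
      using *(2) decode_less(3)[of v] unfolding X_def C_def by blast+
    then have v: "v < n w" "pc v = Suc (2 * A + ?i)" "?i < length \<Delta>" by linarith+
    have "?R (pa w v) (pb w v) (\<Delta> ! ?i)"
      by (rule *(1)[rule_format, OF decode_less(1)[OF v(1)] decode_less(2) v(3)])
    then show "(0, v) \<in> E w"
      using element_covered[OF v assms] *(3) by (simp add: split_beta)
  qed
  also have "\<dots> \<longleftrightarrow> (\<forall>a < ta w. \<forall>b < tb w. \<forall>x \<in> set \<Delta>. ?R a b x)"
    by (simp only: all_set_conv_all_nth)
  finally show ?thesis .
qed

text \<open>Here \<open>inhabited\<close> enters: with all literals chosen, one literal inside the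
  grid is enough for each clause. Hence the instance has admissible solutions even if the formula is
  unsatisfiable.\<close>

lemma covers_U: "cover.covers (U w) (X w) (E w) (U w)"
proof -
  have m: "num w a b (Suc l) \<in> U w" if "a < ta w" "b < tb w" "l < 2 * A" for a b l
  proof -
    have "Suc l < C" using that by (simp add: C_def)
    then show ?thesis using that num_less num_decode by (simp add: U_def)
  qed
  have "\<exists>(ea, eb, l) \<in> set ls. eval w (place a b) ea < ta w \<and> eval w (place a b) eb < tb w \<and>
        num w (eval w (place a b) ea) (eval w (place a b) eb) (Suc l) \<in> U w"
    if ab: "a < ta w" "b < tb w" and gl: "(g, ls) \<in> set \<Delta>" "0 < eval w (place a b) g" for a b g ls
  proof -
    have "\<exists>(ea, eb, l) \<in> set ls. eval w (place a b) ea < ta w \<and> eval w (place a b) eb < tb w"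
    proof (cases "(g, ls) \<in> set \<Gamma>")
      case True
      then show ?thesis using inhabited[of g ls a w b] ab gl by (simp add: ta_def tb_def)
    next
      case False
      then obtain l where "(g, ls) = tautology l" using gl by (auto simp: \<Delta>_def)
      then show ?thesis using ab by (simp add: tautology_def place_def)
    qed
    then obtain ea eb l where "(ea, eb, l) \<in> set ls" "eval w (place a b) ea < ta w"
      "eval w (place a b) eb < tb w" by auto
    then show ?thesis using m schemas_\<Delta>(2)[OF gl(1)] by (intro bexI[of _ "(ea, eb, l)"]) auto
  qed
  then show ?thesis unfolding covers_iff[OF order_refl] by blast
qed

text \<open>Each tautology needs one of its two literals, so a cover meets every variable; with no
  more literals than there are variables it contains exactly one literal of each and is an
  assignment. Conversely, the true literals of an assignment form a small enough cover.\<close>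

lemma cover_iff_satisfiable:
  "(\<exists>S. cover.covers (U w) (X w) (E w) S \<and> card S \<le> vars w) \<longleftrightarrow> (\<exists>P. satisfied w P)"
proof
  assume "\<exists>S. cover.covers (U w) (X w) (E w) S \<and> card S \<le> vars w"
  then obtain S where S: "cover.covers (U w) (X w) (E w) S" "card S \<le> vars w" by blast
  then have SU: "S \<subseteq> U w" by (simp add: cover.covers_def[OF cover])
  then have fS: "finite S" using cover.fin(1)[OF cover] finite_subset by blast
  note c = S(1)[unfolded covers_iff[OF SU]]
  let ?V = "{..<ta w} \<times> {..<tb w} \<times> {..<A}"
  \<comment> \<open>The variable of a literal: literal \<open>l\<close> has component
    \<open>l + 1\<close>, and \<open>l\<close> and \<open>A + l\<close> agree modulo
    \<open>A\<close>.\<close>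
  let ?f = "\<lambda>u. (pa w u, pb w u, (pc u - 1) mod A)"
  have lit: "num w a b (Suc l) \<in> S \<or> num w a b (Suc (A + l)) \<in> S"
    if "a < ta w" "b < tb w" "l < A" for a b l
  proof -
    have "tautology l \<in> set \<Delta>" using that by (simp add: \<Delta>_def)
    from c that have "\<forall>(g, ls) \<in> set \<Delta>. 0 < eval w (place a b) g \<longrightarrow>
     (\<exists>(ea, eb, l) \<in> set ls. eval w (place a b) ea < ta w \<and> eval w (place a b) eb < tb w \<and>
        num w (eval w (place a b) ea) (eval w (place a b) eb) (Suc l) \<in> S)" by blast
    from bspec[OF this \<open>tautology l \<in> set \<Delta>\<close>] show ?thesis by (auto simp: tautology_def place_def)
  qed
  have dec: "?f (num w a b (Suc l)) = (a, b, l mod A)" if "a < ta w" "b < tb w" "l < 2 * A" for a b l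
  proof -
    have "Suc l < C" using that by (simp add: C_def)
    then show ?thesis using that num_decode by simp
  qed
  have "?V \<subseteq> ?f ` S"
  proof safe
    fix a b l assume *: "a < ta w" "b < tb w" "l < A"
    then show "(a, b, l) \<in> ?f ` S"
      using lit[OF *] dec[of a b l] dec[of a b "A + l"] by (force simp: image_iff)
  qed
  \<comment> \<open>A map from \<open>S\<close> onto at least \<open>card S\<close> variables is
    injective, so \<open>S\<close> never contains both literals of a variable.\<close>
  then have "card ?V \<le> card (?f ` S)" using fS by (intro card_mono) auto
  then have "card (?f ` S) = card S"
    using S(2) card_image_le[OF fS, of ?f] by (simp add: vars_def card_cartesian_product)
  then have inj: "inj_on ?f S" using fS by (intro eq_card_imp_inj_on)
  have excl: "\<not> (num w a b (Suc l) \<in> S \<and> num w a b (Suc (A + l)) \<in> S)"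
    if "a < ta w" "b < tb w" "l < A" for a b l
  proof
    assume "num w a b (Suc l) \<in> S \<and> num w a b (Suc (A + l)) \<in> S"
    then have "num w a b (Suc l) = num w a b (Suc (A + l))"
      using inj_onD[OF inj, of "num w a b (Suc l)" "num w a b (Suc (A + l))"]
        dec[of a b l] dec[of a b "A + l"] that by auto
    then show False using that by (simp add: num_def)
  qed
  have "satisfied w (\<lambda>a b l. num w a b (Suc l) \<in> S)"
    unfolding satisfied_def
  proof (intro allI impI ballI, clarify)
    fix a b g ls assume *: "a < ta w" "b < tb w" "(g, ls) \<in> set \<Gamma>" "0 < eval w (place a b) g"
    have m: "(g, ls) \<in> set \<Delta>" using *(3) by (simp add: \<Delta>_def)
    from c *(1,2) have "\<forall>(g, ls) \<in> set \<Delta>. 0 < eval w (place a b) g \<longrightarrow>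
     (\<exists>(ea, eb, l) \<in> set ls. eval w (place a b) ea < ta w \<and> eval w (place a b) eb < tb w \<and>
        num w (eval w (place a b) ea) (eval w (place a b) eb) (Suc l) \<in> S)" by blast
    from bspec[OF this m] *(4) obtain ea eb l where e: "(ea, eb, l) \<in> set ls"
      "eval w (place a b) ea < ta w" "eval w (place a b) eb < tb w"
      "num w (eval w (place a b) ea) (eval w (place a b) eb) (Suc l) \<in> S" by auto
    then have "l < 2 * A" using schemas_\<Delta>(2)[OF m] by blast
    then have "\<not> l < A \<Longrightarrow> num w (eval w (place a b) ea) (eval w (place a b) eb) (Suc (l - A)) \<notin> S"
      using excl[OF e(2,3), of "l - A"] e(4) by auto
    then show "\<exists>(ea, eb, l) \<in> set ls. eval w (place a b) ea < ta w \<and> eval w (place a b) eb < tb w \<and>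
        (if l < A then num w (eval w (place a b) ea) (eval w (place a b) eb) (Suc l) \<in> S
         else num w (eval w (place a b) ea) (eval w (place a b) eb) (Suc (l - A)) \<notin> S)"
      using e by (intro bexI[OF _ e(1)]) auto
  qed
  then show "\<exists>P. satisfied w P" by blast
next
  assume "\<exists>P. satisfied w P"
  then obtain P where P: "satisfied w P" by blast
  define Q where "Q a b l = (if l < A then P a b l else \<not> P a b (l - A))" for a b l
  define S where "S = {u \<in> U w. Q (pa w u) (pb w u) (pc u - 1)}"
  have mem: "num w a b (Suc l) \<in> S \<longleftrightarrow> Q a b l" if "a < ta w" "b < tb w" "l < 2 * A" for a b l
  proof -
    have "Suc l < C" using that by (simp add: C_def)
    then show ?thesis using that num_less num_decode by (simp add: S_def U_def)
  qed
  have SU: "S \<subseteq> U w" by (auto simp: S_def)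
  have "\<exists>(ea, eb, l) \<in> set ls. eval w (place a b) ea < ta w \<and> eval w (place a b) eb < tb w \<and>
        num w (eval w (place a b) ea) (eval w (place a b) eb) (Suc l) \<in> S"
    if ab: "a < ta w" "b < tb w" and gl: "(g, ls) \<in> set \<Delta>" "0 < eval w (place a b) g" for a b g ls
  proof -
    have "\<exists>(ea, eb, l) \<in> set ls. eval w (place a b) ea < ta w \<and> eval w (place a b) eb < tb w \<and>
        Q (eval w (place a b) ea) (eval w (place a b) eb) l"
    proof (cases "(g, ls) \<in> set \<Gamma>")
      case True
      from P ab have "\<forall>(g, ls) \<in> set \<Gamma>. 0 < eval w (place a b) g \<longrightarrow>
        (\<exists>(ea, eb, l) \<in> set ls. eval w (place a b) ea < ta w \<and> eval w (place a b) eb < tb w \<and>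
          Q (eval w (place a b) ea) (eval w (place a b) eb) l)"
        unfolding satisfied_def Q_def by blast
      from bspec[OF this True] gl(2) show ?thesis by simp
    next
      case False
      then obtain l where "(g, ls) = tautology l" "l < A" using gl by (auto simp: \<Delta>_def)
      then show ?thesis using ab by (auto simp: tautology_def place_def Q_def)
    qed
    then obtain ea eb l where "(ea, eb, l) \<in> set ls" "eval w (place a b) ea < ta w"
      "eval w (place a b) eb < tb w" "Q (eval w (place a b) ea) (eval w (place a b) eb) l" by auto
    then show ?thesis using mem schemas_\<Delta>(2)[OF gl(1)] by (intro bexI[of _ "(ea, eb, l)"]) auto
  qed
  then have "cover.covers (U w) (X w) (E w) S" unfolding covers_iff[OF SU] by blast
  moreover have "card S \<le> vars w"
  proof -
    let ?f = "\<lambda>u. (pa w u, pb w u, (pc u - 1) mod A)"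
    have "inj_on ?f S"
    proof (rule inj_onI)
      fix u v assume *: "u \<in> S" "v \<in> S" "?f u = ?f v"
      obtain i j where ij: "i < 2 * A" "j < 2 * A" "pc u = Suc i" "pc v = Suc j"
        using * by (cases "pc u"; cases "pc v") (auto simp: S_def U_def)
      then have q: "Q (pa w u) (pb w u) i" "Q (pa w u) (pb w u) j"
        using * by (auto simp: S_def)
      have m: "i mod A = (if i < A then i else i - A)" if "i < 2 * A" for i
        using that by (simp add: mod_if)
      have "i mod A = j mod A" using *(3) unfolding ij(3,4) by simp
      then have e: "(if i < A then i else i - A) = (if j < A then j else j - A)"
        unfolding m[OF ij(1)] m[OF ij(2)] .
      have "i < A \<longleftrightarrow> j < A"
      proof (rule ccontr)
        assume "(i < A) \<noteq> (j < A)"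
        then consider "i < A" "\<not> j < A" | "\<not> i < A" "j < A" by blast
        then show False
        proof cases
          case 1
          then have "i = j - A" using e by presburger
          then show False using q 1 unfolding Q_def by metis
        next
          case 2
          then have "j = i - A" using e by presburger
          then show False using q 2 unfolding Q_def by metis
        qed
      qed
      then have "i = j" using e by presburger
      then have "pc u = pc v" using ij by simp
      then have "num w (pa w u) (pb w u) (pc u) = num w (pa w v) (pb w v) (pc v)" using *(3) by simp
      then show "u = v" unfolding decode_num .
    qed
    moreover have "?f ` S \<subseteq> {..<ta w} \<times> {..<tb w} \<times> {..<A}"
    proof (rule image_subsetI)
      fix u assume "u \<in> S"
      then have "u < n w" "0 < A" by (auto simp: S_def U_def intro!: Nat.gr0I)
      then show "?f u \<in> {..<ta w} \<times> {..<tb w} \<times> {..<A}"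
        using decode_less(1)[of u w] decode_less(2)[of w u] by simp
    qed
    ultimately have "card S \<le> card ({..<ta w} \<times> {..<tb w} \<times> {..<A})"
      by (intro card_inj_on_le) auto
    then show ?thesis by (simp add: vars_def card_cartesian_product)
  qed
  ultimately show "\<exists>S. cover.covers (U w) (X w) (E w) S \<and> card S \<le> vars w" by blast
qed

theorem approximation_decides:
  assumes "is_approximation (msp_of w) \<alpha> F L M"
  shows "(\<exists>P. satisfied w P) \<longleftrightarrow>
    (\<forall>\<kappa>\<in>commodities (msp_of w). \<forall>e\<in>edges (msp_of w). F \<kappa> e = 0 \<or> M \<kappa> e 0 = 0)"
proof -
  have adm: "admissible (msp_of w) F L M" using assms by (simp add: is_approximation_def)
  have "edges (msp_of w) = E w" by (simp add: cover_msp_def)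
  then show ?thesis
    using cover.approximation_zero[OF cover _ _ assms] cover.zero_energy_imp_cover[OF cover adm]
      cover_iff_satisfiable[of w] by metis
qed

lemma admissible_exists: "\<exists>F L M. admissible (msp_of w) F L M"
  by (rule cover.cover_imp_admissible[OF cover covers_U])

end

section \<open>Accepting computations as satisfying assignments\<close>

text \<open>Horner's scheme.\<close>

lemma poly_exp: "\<exists>e. ok_exp 0 e \<and> (\<forall>w \<sigma>. eval w \<sigma> e = poly p (length w))"
proof (induction p)
  case 0
  show ?case by (intro exI[of _ "Const 0"]) simp
next
  case (pCons a p)
  then obtain e where "ok_exp 0 e \<and> (\<forall>w \<sigma>. eval w \<sigma> e = poly p (length w))" by blast
  then show ?case by (intro exI[of _ "Add (Const a) (Mul Len e)"]) simp
qed

definition less_exp :: "exp \<Rightarrow> exp \<Rightarrow> exp" where "less_exp a b = Sub b a"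

lemma eval_less_exp: "0 < eval w \<sigma> (less_exp a b) \<longleftrightarrow> eval w \<sigma> a < eval w \<sigma> b"
  by (simp add: less_exp_def)

lemma local_less_exp [simp]: "local_exp (less_exp a b) = (local_exp a \<and> local_exp b)"
  by (auto simp: less_exp_def)
lemma local_not_exp [simp]: "local_exp (not_exp e) = local_exp e" by (simp add: not_exp_def)
lemma local_eq_exp [simp]: "local_exp (eq_exp a b) = (local_exp a \<and> local_exp b)" by (auto simp: eq_exp_def)
lemma local_conj_exp [simp]: "local_exp (conj_exp es) = (\<forall>e\<in>set es. local_exp e)"
  by (induction es) (auto simp: conj_exp_def)

lemma closed_local: "ok_exp 0 e \<Longrightarrow> local_exp e"
  by (induction e) auto

lemma place_simps [simp]: "place a b 8 = a" "place a b 10 = b"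
  by (simp_all add: place_def)

fun offset :: "direction \<Rightarrow> int" where
  "offset MoveLeft = -1" | "offset Stay = 0" | "offset MoveRight = 1"

lemma move_offset: "move d h = h + offset d"
  by (cases d) auto

text \<open>Tape contents relative to the head: moving the head shifts the contents.\<close>

definition cell :: "(nat \<Rightarrow> tape) \<Rightarrow> nat \<Rightarrow> int \<Rightarrow> nat" where
  "cell T j i = fst (T j) (snd (T j) + i)"

lemma cell_0: "cell T j 0 = reads T j"
  by (simp add: cell_def reads_def read_tape_def)

lemma cell_acts:
  "cell (acts T g) j i = (if i + offset (snd (g j)) = 0 then fst (g j) else cell T j (i + offset (snd (g j))))"
  by (auto simp: cell_def acts_def act_tape_def move_offset algebra_simps)

text \<open>Contents shift against the move of the head: this is the position in the next row to
  which the symbol at \<open>Var 10\<close> goes. For a move to the right it is a truncated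
  subtraction, hence the condition \<open>0 < b\<close> in \<open>eval_source\<close>.\<close>

fun source :: "direction \<Rightarrow> exp" where
  "source MoveLeft = Add (Var 10) (Const 1)"
| "source Stay = Var 10"
| "source MoveRight = Sub (Var 10) (Const 1)"

lemma eval_source: "0 < b \<Longrightarrow> int (eval w (place a b) (source d)) = int b - offset d"
  by (cases d) auto

lemma local_source [simp]: "local_exp (source d)"
  by (cases d) auto

lemma length_doubled: "length (concat (map (\<lambda>b. [b, b]) x)) = 2 * length x"
  by (induction x) auto

lemma nth_doubled: "i < 2 * length x \<Longrightarrow> concat (map (\<lambda>b. [b, b]) x) ! i = x ! (i div 2)"
proof (induction x arbitrary: i)
  case (Cons a x)
  show ?case
  proof (cases "i < 2")
    case True
    then show ?thesis by (auto simp: less_2_cases_iff)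
  next
    case False
    then obtain k where "i = Suc (Suc k)" by (metis One_nat_def Suc_1 less_2_cases_iff not0_implies_Suc)
    then show ?thesis using Cons by simp
  qed
qed simp

lemma length_pair_word: "length (pair_word x y) = 2 * length x + 2 + length y"
  by (simp add: pair_word_def length_doubled)

lemma nth_pair_word:
  "i < 2 * length x \<Longrightarrow> pair_word x y ! i = x ! (i div 2)"
  "pair_word x y ! (2 * length x) = False"
  "pair_word x y ! (2 * length x + 1) = True"
  "pair_word x y ! (2 * length x + 2 + i) = y ! i"
  by (simp_all add: pair_word_def nth_append nth_doubled length_doubled)

text \<open>A machine without states on \<open>J\<close> tapes over \<open>S\<close> symbols is run
  for \<open>N\<close> steps; rows have \<open>2 * W + 1\<close> cells, with the heads in the
  middle. As \<open>N\<close> is less than \<open>W\<close>, disturbances from the border do not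
  reach the heads in time; the second bound leaves room for the doubled input, the separator and a
  witness of length up to \<open>Q\<close>.\<close>

locale tableau =
  fixes J S :: nat and G :: "(nat \<Rightarrow> nat) \<Rightarrow> nat \<Rightarrow> nat \<times> direction" and N W Q :: exp
  assumes J: "2 \<le> J" and S: "3 \<le> S"
    and G_local: "\<And>s s' j. (\<And>i. i < J \<Longrightarrow> s i = s' i) \<Longrightarrow> j < J \<Longrightarrow> G s j = G s' j"
    and G_bound: "\<And>s j. (\<And>i. i < J \<Longrightarrow> s i < S) \<Longrightarrow> j < J \<Longrightarrow> fst (G s j) < S"
    and closed_NWQ: "ok_exp 0 N" "ok_exp 0 W" "ok_exp 0 Q"
    and W_N: "\<And>w. eval w (\<lambda>_. 0) N < eval w (\<lambda>_. 0) W"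
    and W_Q: "\<And>w. 2 * length w + 2 + eval w (\<lambda>_. 0) Q \<le> eval w (\<lambda>_. 0) W"
begin

definition "nv x = eval x (\<lambda>_. 0) N"
definition "wv x = eval x (\<lambda>_. 0) W"
definition "qv x = eval x (\<lambda>_. 0) Q"

lemma eval_NWQ: "eval x \<sigma> N = nv x" "eval x \<sigma> W = wv x" "eval x \<sigma> Q = qv x"
  unfolding nv_def wv_def qv_def using closed_NWQ closed_eval by blast+

lemma bounds: "nv x < wv x" "2 * length x + 2 + qv x \<le> wv x"
  using W_N W_Q by (simp_all add: nv_def wv_def qv_def)

section \<open>The clauses of the tableau\<close>

definition "steps T t = ((\<lambda>T. acts T (G (reads T))) ^^ t) T"

text \<open>The propositional variable for symbol \<open>c\<close> on tape \<open>j\<close>, where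
  the place is given separately.\<close>

definition "letter j c = j * S + c"
definition "letters = J * S"

text \<open>Coordinates of a place are the time \<open>Var 8\<close> and the position \<open>Var 10\<close>; the heads are at \<open>W\<close>.\<close>

definition "reading \<tau> = map (\<lambda>j. (Var 8, W, letters + letter j (\<tau> ! j))) [0..<J]"
definition "inner = [less_exp (Var 8) N, less_exp (Const 0) (Var 10), less_exp (Var 10) (Mul (Const 2) W)]"

text \<open>An implication: if the heads read \<tau>, the symbol written by head \<open>j\<close>
  appears in the next row, displaced by the move. The premise contributes the negative literals
  \<open>reading \<tau>\<close>; one such clause for each of the constantly many \<tau> replaces a
  case distinction.\<close>

definition near_schema :: "nat list \<Rightarrow> nat \<Rightarrow> schema" where
  "near_schema \<tau> j = (conj_exp (eq_exp (Var 10) W # inner),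
     (Add (Var 8) (Const 1), source (snd (G ((!) \<tau>) j)), letter j (fst (G ((!) \<tau>) j))) # reading \<tau>)"

text \<open>Cells away from the head keep their symbol and are only displaced; the old symbol
  \<open>c\<close> is a further premise.\<close>

definition far_schema :: "nat list \<Rightarrow> nat \<Rightarrow> nat \<Rightarrow> schema" where
  "far_schema \<tau> j c = (conj_exp (not_exp (eq_exp (Var 10) W) # inner),
     (Add (Var 8) (Const 1), source (snd (G ((!) \<tau>) j)), letter j c) #
     (Var 8, Var 10, letters + letter j c) # reading \<tau>)"

definition step_schemas :: "schema list" where
  "step_schemas = concat (map (\<lambda>\<tau>. concat (map (\<lambda>j. near_schema \<tau> j # map (far_schema \<tau> j) [0..<S])
     [0..<J])) (List.n_lists J [0..<S]))"

definition "at_start g = conj_exp [eq_exp (Var 8) (Const 0), g]"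
definition "tail_pos = Add W (Add (Mul (Const 2) Len) (Const 2))"
definition "bit_pos = Add W (Mul (Const 2) (Var 10))"

text \<open>In several schemas \<open>Var 10\<close> is an index into the input or the witness and
  not a position. The first four write the doubled bits, the next two the separator. In the witness
  region each cell is blank or a bit, and after a blank only blanks follow, so it holds a word of
  any length up to \<open>Q\<close>. The last two make the rest blank.\<close>

definition start_schemas :: "schema list" where
  "start_schemas = [
     (at_start (conj_exp [less_exp (Var 10) Len, Bit (Var 10)]), [(Var 8, bit_pos, 2)]),
     (at_start (conj_exp [less_exp (Var 10) Len, Bit (Var 10)]), [(Var 8, Add bit_pos (Const 1), 2)]),
     (at_start (conj_exp [less_exp (Var 10) Len, not_exp (Bit (Var 10))]), [(Var 8, bit_pos, 1)]),
     (at_start (conj_exp [less_exp (Var 10) Len, not_exp (Bit (Var 10))]), [(Var 8, Add bit_pos (Const 1), 1)]),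
     (at_start (Const 1), [(Var 8, Add W (Mul (Const 2) Len), 1)]),
     (at_start (Const 1), [(Var 8, Add W (Add (Mul (Const 2) Len) (Const 1)), 2)]),
     (at_start (less_exp (Var 10) Q), map (\<lambda>c. (Var 8, Add tail_pos (Var 10), c)) [0, 1, 2]),
     (at_start (less_exp (Add (Var 10) (Const 1)) Q),
       [(Var 8, Add tail_pos (Var 10), letters), (Var 8, Add tail_pos (Add (Var 10) (Const 1)), 0)]),
     (at_start (less_exp (Var 10) W), [(Var 8, Var 10, 0)]),
     (at_start (not_exp (less_exp (Var 10) (Add tail_pos Q))), [(Var 8, Var 10, 0)])]"

definition blank_schemas :: "schema list" where
  "blank_schemas = map (\<lambda>j. (at_start (Const 1), [(Var 8, Var 10, letter j 0)])) [1..<J]"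

text \<open>Excludes rejection; all other schemas are true of every computation on some \<open>pair_word x y\<close>.\<close>

definition final_schema :: schema where
  "final_schema = (conj_exp [eq_exp (Var 8) N, eq_exp (Var 10) W], [(Var 8, Var 10, letters + letter 1 1)])"

definition all_schemas :: "schema list" where
  "all_schemas = final_schema # start_schemas @ blank_schemas @ step_schemas"

lemma at_start_inj: "at_start e = at_start e' \<longleftrightarrow> e = e'"
  by (simp add: at_start_def conj_exp_def)

lemma letter_less: "j < J \<Longrightarrow> c < S \<Longrightarrow> letter j c < letters"
  unfolding letter_def letters_def by (rule mixed_radix_less)

lemma letter_0_less: "j < J \<Longrightarrow> letter j 0 < 2 * letters"
  using letter_less[of j 0] S by simp

lemma letter_0: "letter 0 c = c" by (simp add: letter_def)

lemma small_letters: "0 < letters" "1 < letters" "2 < letters"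
  using letter_less[of 0] J S by (simp_all add: letter_0)

lemma step_schemas_cases:
  assumes "(g, ls) \<in> set step_schemas"
  obtains \<tau> j where "length \<tau> = J" "set \<tau> \<subseteq> {..<S}" "j < J" "(g, ls) = near_schema \<tau> j"
  | \<tau> j c where "length \<tau> = J" "set \<tau> \<subseteq> {..<S}" "j < J" "c < S" "(g, ls) = far_schema \<tau> j c"
proof -
  have "(g, ls) \<in> (\<Union>\<tau> \<in> set (List.n_lists J [0..<S]). \<Union>j \<in> {0..<J}.
      set (near_schema \<tau> j # map (far_schema \<tau> j) [0..<S]))"
    using assms unfolding step_schemas_def by simp
  then obtain \<tau> j where \<tau>: "\<tau> \<in> set (List.n_lists J [0..<S])" "j \<in> {0..<J}"
    "(g, ls) \<in> set (near_schema \<tau> j # map (far_schema \<tau> j) [0..<S])" by blast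
  then have "length \<tau> = J" "set \<tau> \<subseteq> {..<S}" "j < J" "(g, ls) = near_schema \<tau> j \<or> (\<exists>c<S. (g, ls) = far_schema \<tau> j c)"
    by (auto simp: set_n_lists lessThan_atLeast0)
  then show ?thesis using that by blast
qed

lemma step_schemas_mem:
  assumes "length \<tau> = J" "set \<tau> \<subseteq> {..<S}" "j < J"
  shows "near_schema \<tau> j \<in> set step_schemas" "c < S \<Longrightarrow> far_schema \<tau> j c \<in> set step_schemas"
proof -
  have "\<tau> \<in> set (List.n_lists J [0..<S])" using assms by (simp add: set_n_lists lessThan_atLeast0)
  then show "near_schema \<tau> j \<in> set step_schemas" "c < S \<Longrightarrow> far_schema \<tau> j c \<in> set step_schemas"
    using assms(3) unfolding step_schemas_def by force+
qed

lemma reading_local: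
  assumes "length \<tau> = J" "set \<tau> \<subseteq> {..<S}" "(ea, eb, l) \<in> set (reading \<tau>)"
  shows "local_exp ea \<and> local_exp eb \<and> l < 2 * letters"
proof -
  obtain j where j: "j < J" "ea = Var 8" "eb = W" "l = letters + letter j (\<tau> ! j)"
    using assms(3) by (auto simp: reading_def)
  have "\<tau> ! j < S" using assms(1,2) j(1) nth_mem by blast
  then show ?thesis using letter_less[OF j(1)] j closed_local closed_NWQ by simp
qed

lemma nth_bounded: "length \<tau> = J \<Longrightarrow> set \<tau> \<subseteq> {..<S} \<Longrightarrow> i < J \<Longrightarrow> \<tau> ! i < S"
  using nth_mem by blast

sublocale grid "Add N (Const 1)" "Add (Mul (Const 2) W) (Const 1)" letters all_schemas
proof
  show "ok_exp 0 (Add N (Const 1))" "ok_exp 0 (Add (Mul (Const 2) W) (Const 1))"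
    using closed_NWQ by simp_all
  show "0 < eval w (\<lambda>_. 0) (Add N (Const 1))" "0 < eval w (\<lambda>_. 0) (Add (Mul (Const 2) W) (Const 1))" for w
    by simp_all
next
  fix g ls assume gl: "(g, ls) \<in> set all_schemas"
  note cl = closed_NWQ[THEN closed_local]
  show "local_exp g"
  proof (cases "(g, ls) \<in> set step_schemas")
    case True
    then show ?thesis
      by (rule step_schemas_cases) (auto simp: near_schema_def far_schema_def inner_def cl)
  next
    case False
    then show ?thesis using gl cl
      by (auto simp: all_schemas_def final_schema_def start_schemas_def blank_schemas_def at_start_def
          tail_pos_def)
  qed
next
  fix g ls ea eb l assume gl: "(g, ls) \<in> set all_schemas" and e: "(ea, eb, l) \<in> set ls"
  note cl = closed_NWQ[THEN closed_local]
  show "local_exp ea \<and> local_exp eb \<and> l < 2 * letters"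
  proof (cases "(g, ls) \<in> set step_schemas")
    case True
    then show ?thesis
    proof (rule step_schemas_cases)
      fix \<tau> j assume *: "length \<tau> = J" "set \<tau> \<subseteq> {..<S}" "j < J" "(g, ls) = near_schema \<tau> j"
      have "letter j (fst (G ((!) \<tau>) j)) < letters"
        using * G_bound[of "(!) \<tau>" j] nth_bounded by (intro letter_less) auto
      then show ?thesis using * e reading_local[OF *(1,2), of ea eb l]
        by (auto simp: near_schema_def)
    next
      fix \<tau> j c assume *: "length \<tau> = J" "set \<tau> \<subseteq> {..<S}" "j < J" "c < S" "(g, ls) = far_schema \<tau> j c"
      then show ?thesis using e reading_local[OF *(1,2), of ea eb l] letter_less[OF *(3,4)]
        by (auto simp: far_schema_def)
    qed
  next
    case False
    then show ?thesis using gl e cl small_letters letter_0_less letter_less[of 1 1] J S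
      by (auto simp: all_schemas_def final_schema_def start_schemas_def blank_schemas_def at_start_def
          tail_pos_def bit_pos_def)
  qed
next
  fix w a b g ls
  assume gl: "(g, ls) \<in> set all_schemas" and a: "a < eval w (\<lambda>_. 0) (Add N (Const 1))"
    and b: "b < eval w (\<lambda>_. 0) (Add (Mul (Const 2) W) (Const 1))" and g: "0 < eval w (place a b) g"
  have ab: "a \<le> nv w" "b \<le> 2 * wv w" using a b by (simp_all add: eval_NWQ)
  have "\<exists>(ea, eb, l) \<in> set ls. eval w (place a b) ea \<le> nv w \<and> eval w (place a b) eb \<le> 2 * wv w"
  proof (cases "(g, ls) \<in> set step_schemas")
    case True
    \<comment> \<open>Every step clause has a premise at the head position \<open>W\<close> in the
      current row, and this place is always inside the grid.\<close>
    have "(Var 8, W, letters + letter 0 (\<tau> ! 0)) \<in> set (reading \<tau>)" for \<tau>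
      using J by (force simp: reading_def)
    with True have "\<exists>l. (Var 8, W, l) \<in> set ls"
      by (elim step_schemas_cases) (auto simp: near_schema_def far_schema_def)
    then obtain l where "(Var 8, W, l) \<in> set ls" by blast
    then show ?thesis using ab by (intro bexI[of _ "(Var 8, W, l)"]) (simp_all add: eval_NWQ)
  next
    case False
    then show ?thesis using gl g ab bounds[of w]
      by (auto simp: all_schemas_def final_schema_def start_schemas_def blank_schemas_def at_start_def
          tail_pos_def bit_pos_def eval_conj_exp eval_eq_exp eval_less_exp eval_not_exp eval_NWQ)
  qed
  then show "\<exists>(ea, eb, l) \<in> set ls. eval w (place a b) ea < eval w (\<lambda>_. 0) (Add N (Const 1)) \<and>
         eval w (place a b) eb < eval w (\<lambda>_. 0) (Add (Mul (Const 2) W) (Const 1))"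
    by (simp add: eval_NWQ less_Suc_eq_le)
qed

lemma t_simps: "ta w = Suc (nv w)" "tb w = Suc (2 * wv w)"
  unfolding ta_def tb_def eval.simps eval_NWQ by simp_all

definition "true_lit w P a b = (\<lambda>(ea, eb, l). eval w (place a b) ea \<le> nv w \<and>
   eval w (place a b) eb \<le> 2 * wv w \<and>
   (if l < letters then P (eval w (place a b) ea) (eval w (place a b) eb) l
    else \<not> P (eval w (place a b) ea) (eval w (place a b) eb) (l - letters)))"

lemma satisfied_alt:
  "satisfied w P \<longleftrightarrow> (\<forall>a \<le> nv w. \<forall>b \<le> 2 * wv w. \<forall>(g, ls) \<in> set all_schemas.
     0 < eval w (place a b) g \<longrightarrow> (\<exists>x \<in> set ls. true_lit w P a b x))"
  unfolding satisfied_def t_simps less_Suc_eq_le true_lit_def by (simp add: split_beta)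

lemma satisfiedD:
  assumes "satisfied w P" "(g, ls) \<in> set all_schemas" "a \<le> nv w" "b \<le> 2 * wv w"
    "0 < eval w (place a b) g"
  shows "\<exists>x \<in> set ls. true_lit w P a b x"
  using assms unfolding satisfied_alt by fast

lemma init_symbols: "3 \<le> S \<Longrightarrow> fst (init_tapes z j) p < S"
  by (auto simp: init_tapes_def inscription_def)

lemma steps_Suc: "steps T (Suc t) = acts (steps T t) (G (reads (steps T t)))"
  by (simp add: steps_def)

lemma cell_bound: "j < J \<Longrightarrow> cell (steps (init_tapes z) t) j i < S"
proof (induction t arbitrary: i j)
  case 0
  then show ?case using init_symbols S by (simp add: steps_def cell_def)
next
  case (Suc t)
  have "fst (G (reads (steps (init_tapes z) t)) j) < S"
    using Suc.IH[of _ 0] Suc.prems by (intro G_bound) (simp_all add: cell_0)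
  then show ?case using Suc unfolding steps_Suc cell_acts by simp
qed

lemma cell_init:
  "cell (init_tapes z) j i = (if j = 0 then inscription z i else 0)"
  by (simp add: cell_def init_tapes_def inscription_def)

lemma inscription_pair_word:
  fixes x y :: "bool list" and i :: nat
  defines "z \<equiv> pair_word x y"
  shows "i < length x \<Longrightarrow> inscription z (int (2 * i)) = (if x ! i then 2 else 1)"
    and "i < length x \<Longrightarrow> inscription z (int (2 * i + 1)) = (if x ! i then 2 else 1)"
    and "inscription z (int (2 * length x)) = 1"
    and "inscription z (int (2 * length x + 1)) = 2"
    and "inscription z (int (2 * length x + 2 + i)) =
      (if i < length y then if y ! i then 2 else 1 else 0)"
    and "k < 0 \<Longrightarrow> inscription z k = 0"
  unfolding z_def inscription_def nat_int length_pair_word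
  by (simp_all add: nth_pair_word nth_pair_word[simplified] del: of_nat_add of_nat_mult of_nat_Suc
      of_nat_numeral)


section \<open>From a satisfying assignment to an accepted witness\<close>

text \<open>The actual symbols are marked in \<open>P\<close>; nothing is said about marks of other
  symbols, which cannot hurt because step clauses derive marks from marks. The strip under control
  shrinks by one on both sides per step, since a cell depends on its neighbours and border cells are
  exempt from the step clauses.\<close>

definition holds where
  "holds x P R t \<longleftrightarrow> (\<forall>j<J. \<forall>b. \<bar>int b - int (wv x)\<bar> + int t + 1 \<le> int (wv x) \<longrightarrow>
     P t b (letter j (cell R j (int b - int (wv x)))))"

lemma reading_false:
  assumes inv: "holds x P R t" and t: "t < nv x" and lit: "l \<in> set (reading (map (reads R) [0..<J]))"
    and R: "\<And>j. j < J \<Longrightarrow> reads R j < S"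
  shows "\<not> true_lit x P t b l"
proof -
  obtain j where j: "j < J" "l = (Var 8, W, letters + letter j (reads R j))"
    using lit by (auto simp: reading_def)
  have "\<bar>int (wv x) - int (wv x)\<bar> + int t + 1 \<le> int (wv x)" using t bounds(1)[of x] by simp
  then have "P t (wv x) (letter j (cell R j (int (wv x) - int (wv x))))"
    using inv j(1) unfolding holds_def by blast
  then show ?thesis using j by (simp add: true_lit_def eval_NWQ cell_0)
qed

lemma holds_step:
  assumes sat: "satisfied x P" and inv: "holds x P R t" and t: "t < nv x"
    and R: "\<And>j i. j < J \<Longrightarrow> cell R j i < S"
  shows "holds x P (acts R (G (reads R))) (Suc t)"
  unfolding holds_def
proof (intro allI impI)
  fix j b assume j: "j < J" and b: "\<bar>int b - int (wv x)\<bar> + int (Suc t) + 1 \<le> int (wv x)"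
  have R0: "reads R j < S" if "j < J" for j using R[OF that, of 0] by (simp add: cell_0)
  let ?\<tau> = "map (reads R) [0..<J]"
  let ?g = "G (reads R) j"
  have g: "G ((!) ?\<tau>) j = ?g" using j by (intro G_local) auto
  \<comment> \<open>The position in the current row from which the symbol at \<open>b\<close> in the
    next row comes.\<close>
  define b' where "b' = nat (int b + offset (snd ?g))"
  have off: "\<bar>offset (snd ?g)\<bar> \<le> 1" by (cases "snd ?g") auto
  have b': "int b' = int b + offset (snd ?g)" using b off by (simp add: b'_def)
  then have b'_range: "0 < b'" "b' < 2 * wv x" "b' \<le> 2 * wv x"
    "\<bar>int b' - int (wv x)\<bar> + int t + 1 \<le> int (wv x)"
    using b off by linarith+
  have "int (eval x (place t b') (source (snd ?g))) = int b"
    using eval_source[OF b'_range(1)] b' by simp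
  then have src: "eval x (place t b') (source (snd ?g)) = b" by simp
  have \<tau>: "length ?\<tau> = J" "set ?\<tau> \<subseteq> {..<S}" using R0 by auto
  have inner: "\<forall>e\<in>set inner. 0 < eval x (place t b') e"
    using t b'_range by (simp add: inner_def eval_less_exp eval_NWQ)
  show "P (Suc t) b (letter j (cell (acts R (G (reads R))) j (int b - int (wv x))))"
  proof (cases "b' = wv x")
    case True
    have m: "near_schema ?\<tau> j \<in> set all_schemas"
      using step_schemas_mem(1)[OF \<tau> j] by (simp add: all_schemas_def)
    have gd: "0 < eval x (place t b') (conj_exp (eq_exp (Var 10) W # inner))"
      unfolding eval_conj_exp using inner True by (simp add: eval_eq_exp eval_NWQ)
    from satisfiedD[OF sat m[unfolded near_schema_def] less_imp_le[OF t] b'_range(3) gd]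
    have "true_lit x P t b' (Add (Var 8) (Const 1), source (snd ?g), letter j (fst ?g))"
      using reading_false[OF inv t _ R0] by (auto simp: g)
    moreover have "letter j (fst ?g) < letters"
      using R0 G_bound[of "reads R" j] j by (intro letter_less) auto
    ultimately have "P (Suc t) b (letter j (fst ?g))" by (simp add: true_lit_def src)
    moreover have "int b - int (wv x) + offset (snd ?g) = 0" using b' True by simp
    ultimately show ?thesis by (simp add: cell_acts)
  next
    case False
    let ?c = "cell R j (int b' - int (wv x))"
    have c: "?c < S" using R[OF j] .
    have m: "far_schema ?\<tau> j ?c \<in> set all_schemas"
      using step_schemas_mem(2)[OF \<tau> j c] by (simp add: all_schemas_def)
    have gd: "0 < eval x (place t b') (conj_exp (not_exp (eq_exp (Var 10) W) # inner))"
      unfolding eval_conj_exp using inner False by (simp add: eval_eq_exp eval_not_exp eval_NWQ)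
    have "P t b' (letter j ?c)" using inv j b'_range(4) unfolding holds_def by blast
    then have "\<not> true_lit x P t b' (Var 8, Var 10, letters + letter j ?c)"
      by (simp add: true_lit_def)
    with satisfiedD[OF sat m[unfolded far_schema_def] less_imp_le[OF t] b'_range(3) gd]
    have "true_lit x P t b' (Add (Var 8) (Const 1), source (snd ?g), letter j ?c)"
      using reading_false[OF inv t _ R0] by (auto simp: g)
    then have "P (Suc t) b (letter j ?c)"
      using letter_less[OF j c] by (simp add: true_lit_def src)
    moreover have e: "int b - int (wv x) + offset (snd ?g) = int b' - int (wv x)" using b' by simp
    moreover have "int b' - int (wv x) \<noteq> 0" using False by simp
    ultimately show ?thesis unfolding cell_acts e by simp
  qed
qed

lemma start_facts:
  assumes sat: "satisfied x P"
  shows "i < length x \<Longrightarrow> P 0 (wv x + 2 * i) (if x ! i then 2 else 1)"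
    and "i < length x \<Longrightarrow> P 0 (wv x + 2 * i + 1) (if x ! i then 2 else 1)"
    and "P 0 (wv x + 2 * length x) 1"
    and "P 0 (wv x + 2 * length x + 1) 2"
    and "i < qv x \<Longrightarrow> \<exists>c<3. P 0 (wv x + 2 * length x + 2 + i) c"
    and "i + 1 < qv x \<Longrightarrow> P 0 (wv x + 2 * length x + 2 + i) 0 \<Longrightarrow>
      P 0 (wv x + 2 * length x + 2 + (i + 1)) 0"
    and "b < wv x \<Longrightarrow> P 0 b 0"
    and "wv x + 2 * length x + 2 + qv x \<le> b \<Longrightarrow> b \<le> 2 * wv x \<Longrightarrow> P 0 b 0"
    and "1 \<le> j \<Longrightarrow> j < J \<Longrightarrow> b \<le> 2 * wv x \<Longrightarrow> P 0 b (letter j 0)"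
proof -
  have g: "0 < eval x (place 0 b) (at_start e) \<longleftrightarrow> 0 < eval x (place 0 b) e" for b e
    by (simp add: at_start_def eval_conj_exp eval_eq_exp)
  have D: "\<exists>l \<in> set ls. true_lit x P 0 b l"
    if "(at_start e, ls) \<in> set start_schemas \<union> set blank_schemas" "b \<le> 2 * wv x"
      "0 < eval x (place 0 b) e" for b e ls
    using satisfiedD[OF sat, of "at_start e" ls 0 b] that g by (auto simp: all_schemas_def)
  have D1: "true_lit x P 0 b l"
    if "(at_start e, [l]) \<in> set start_schemas \<union> set blank_schemas" "b \<le> 2 * wv x"
      "0 < eval x (place 0 b) e" for b e l
    using D[OF that] by simp
  note b = bounds[of x]
  have p: "eval x \<sigma> bit_pos = wv x + 2 * \<sigma> 10" "eval x \<sigma> tail_pos = wv x + (2 * length x + 2)" for \<sigma>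
    by (simp_all add: bit_pos_def tail_pos_def eval_NWQ)
  {
    assume i: "i < length x"
    show "P 0 (wv x + 2 * i) (if x ! i then 2 else 1)"
    proof (cases "x ! i")
      case True
      have "true_lit x P 0 i (Var 8, bit_pos, 2)"
        by (rule D1[of "conj_exp [less_exp (Var 10) Len, Bit (Var 10)]"])
          (use i True b in \<open>auto simp: start_schemas_def eval_conj_exp eval_less_exp\<close>)
      then show ?thesis using True small_letters by (simp add: true_lit_def p)
    next
      case False
      have "true_lit x P 0 i (Var 8, bit_pos, 1)"
        by (rule D1[of "conj_exp [less_exp (Var 10) Len, not_exp (Bit (Var 10))]"])
          (use i False b in \<open>auto simp: start_schemas_def eval_conj_exp eval_less_exp eval_not_exp\<close>)
      then show ?thesis using False small_letters by (simp add: true_lit_def p)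
    qed
    show "P 0 (wv x + 2 * i + 1) (if x ! i then 2 else 1)"
    proof (cases "x ! i")
      case True
      have "true_lit x P 0 i (Var 8, Add bit_pos (Const 1), 2)"
        by (rule D1[of "conj_exp [less_exp (Var 10) Len, Bit (Var 10)]"])
          (use i True b in \<open>auto simp: start_schemas_def eval_conj_exp eval_less_exp\<close>)
      then show ?thesis using True small_letters by (simp add: true_lit_def p)
    next
      case False
      have "true_lit x P 0 i (Var 8, Add bit_pos (Const 1), 1)"
        by (rule D1[of "conj_exp [less_exp (Var 10) Len, not_exp (Bit (Var 10))]"])
          (use i False b in \<open>auto simp: start_schemas_def eval_conj_exp eval_less_exp eval_not_exp\<close>)
      then show ?thesis using False small_letters by (simp add: true_lit_def p)
    qed
  }
  have "true_lit x P 0 0 (Var 8, Add W (Mul (Const 2) Len), 1)"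
    by (rule D1[of "Const 1"]) (auto simp: start_schemas_def)
  then show "P 0 (wv x + 2 * length x) 1" using small_letters by (simp add: true_lit_def eval_NWQ)
  have "true_lit x P 0 0 (Var 8, Add W (Add (Mul (Const 2) Len) (Const 1)), 2)"
    by (rule D1[of "Const 1"]) (auto simp: start_schemas_def)
  then show "P 0 (wv x + 2 * length x + 1) 2" using small_letters by (simp add: true_lit_def eval_NWQ)
  {
    assume i: "i < qv x"
    have "\<exists>l \<in> set (map (\<lambda>c. (Var 8, Add tail_pos (Var 10), c)) [0, 1, 2]). true_lit x P 0 i l"
      by (rule D[of "less_exp (Var 10) Q"]) (use i b in \<open>auto simp: start_schemas_def eval_less_exp eval_NWQ\<close>)
    then obtain c where "c \<in> {0, 1, 2}" "true_lit x P 0 i (Var 8, Add tail_pos (Var 10), c)" by auto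
    then have "c < 3 \<and> P 0 (wv x + 2 * length x + 2 + i) c"
      using small_letters by (auto simp: true_lit_def p)
    then show "\<exists>c<3. P 0 (wv x + 2 * length x + 2 + i) c" by blast
  }
  {
    assume i: "i + 1 < qv x" "P 0 (wv x + 2 * length x + 2 + i) 0"
    have "\<exists>l \<in> set [(Var 8, Add tail_pos (Var 10), letters),
        (Var 8, Add tail_pos (Add (Var 10) (Const 1)), 0)]. true_lit x P 0 i l"
      by (rule D[of "less_exp (Add (Var 10) (Const 1)) Q"])
        (use i b in \<open>auto simp: start_schemas_def eval_less_exp eval_NWQ\<close>)
    moreover have "\<not> true_lit x P 0 i (Var 8, Add tail_pos (Var 10), letters)"
      using i(2) by (simp add: true_lit_def p)
    ultimately have "true_lit x P 0 i (Var 8, Add tail_pos (Add (Var 10) (Const 1)), 0)" by auto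
    then show "P 0 (wv x + 2 * length x + 2 + (i + 1)) 0"
      using small_letters by (simp add: true_lit_def p)
  }
  {
    assume "b < wv x"
    then have "true_lit x P 0 b (Var 8, Var 10, 0)"
      by (intro D1[of "less_exp (Var 10) W"]) (auto simp: start_schemas_def eval_less_exp eval_NWQ)
    then show "P 0 b 0" using small_letters by (simp add: true_lit_def)
  }
  {
    assume "wv x + 2 * length x + 2 + qv x \<le> b" "b \<le> 2 * wv x"
    then have "true_lit x P 0 b (Var 8, Var 10, 0)"
      by (intro D1[of "not_exp (less_exp (Var 10) (Add tail_pos Q))"])
        (auto simp: start_schemas_def eval_less_exp eval_not_exp eval_NWQ p)
    then show "P 0 b 0" using small_letters by (simp add: true_lit_def)
  }
  {
    assume "1 \<le> j" "j < J" "b \<le> 2 * wv x"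
    then have "true_lit x P 0 b (Var 8, Var 10, letter j 0)"
      by (intro D1[of "Const 1"]) (auto simp: blank_schemas_def)
    then show "P 0 b (letter j 0)" using letter_less[OF \<open>j < J\<close>, of 0] S by (simp add: true_lit_def)
  }
qed

lemma satisfied_imp_witness:
  assumes sat: "satisfied x P"
  shows "\<exists>y. length y \<le> qv x \<and> reads (steps (init_tapes (pair_word x y)) (nv x)) 1 \<noteq> 1"
proof -
  note start = start_facts[OF sat]
  let ?p = "\<lambda>i. wv x + 2 * length x + 2 + i"
  \<comment> \<open>The witness ends at the first cell of its region that is marked blank, or else
    fills the region.\<close>
  define m where "m = (LEAST i. i = qv x \<or> i < qv x \<and> P 0 (?p i) 0)"
  have m: "m = qv x \<or> m < qv x \<and> P 0 (?p m) 0" unfolding m_def by (rule LeastI[of _ "qv x"]) simp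
  have before: "\<not> P 0 (?p i) 0" if "i < m" for i
    using not_less_Least[OF that[unfolded m_def]] that m by auto
  have after: "P 0 (?p i) 0" if "m \<le> i" "i < qv x" for i
    using that
  proof (induction rule: dec_induct)
    case base
    then show ?case using m by auto
  next
    case (step i)
    then show ?case using start(6)[of i] by simp
  qed
  \<comment> \<open>A cell may be marked with both bits; then \<open>True\<close> is taken. In
    either case the chosen symbol is a marked one.\<close>
  define y where "y = map (\<lambda>i. P 0 (?p i) 2) [0..<m]"
  have y: "length y = m" "\<And>i. i < m \<Longrightarrow> y ! i = P 0 (?p i) 2" by (simp_all add: y_def)
  let ?T = "init_tapes (pair_word x y)"
  note ins = inscription_pair_word[where x = x and y = y]
  have tape0: "P 0 b (inscription (pair_word x y) (int b - int (wv x)))" if b: "b \<le> 2 * wv x" for b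
  proof -
    consider "b < wv x" | i where "i < length x" "b = wv x + 2 * i"
      | i where "i < length x" "b = wv x + 2 * i + 1" | "b = wv x + 2 * length x"
      | "b = wv x + 2 * length x + 1" | i where "i < qv x" "b = ?p i"
      | "wv x + 2 * length x + 2 + qv x \<le> b"
    proof -
      let ?k = "b - wv x"
      have "?k = 2 * (?k div 2) \<or> ?k = 2 * (?k div 2) + 1" by presburger
      then have "b < wv x \<or> (\<exists>i<length x. b = wv x + 2 * i \<or> b = wv x + 2 * i + 1) \<or>
          b = wv x + 2 * length x \<or> b = wv x + 2 * length x + 1 \<or>
          (\<exists>i<qv x. b = ?p i) \<or> wv x + 2 * length x + 2 + qv x \<le> b"
      proof (cases "b < wv x + 2 * length x")
        case True
        then show ?thesis using \<open>?k = 2 * (?k div 2) \<or> ?k = 2 * (?k div 2) + 1\<close>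
          by (cases "b < wv x") (auto intro!: exI[of _ "?k div 2"])
      next
        case False
        then show ?thesis by (auto intro!: exI[of _ "b - (wv x + 2 * length x + 2)"])
      qed
      then show ?thesis using that by blast
    qed
    then show ?thesis
    proof cases
      case 1
      then show ?thesis using start(7) ins(6)[of "int b - int (wv x)"] by simp
    next
      case (2 i)
      then have "int b - int (wv x) = int (2 * i)" by simp
      then show ?thesis using start(1)[of i] ins(1)[of i] 2 by simp
    next
      case (3 i)
      then have "int b - int (wv x) = int (2 * i + 1)" by simp
      then show ?thesis using start(2)[of i] ins(2)[of i] 3 by simp
    next
      case 4
      then have "int b - int (wv x) = int (2 * length x)" by simp
      then show ?thesis using start(3) ins(3) 4 by simp
    next
      case 5
      then have "int b - int (wv x) = int (2 * length x + 1)" by simp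
      then show ?thesis using start(4) ins(4) 5 by simp
    next
      case (6 i)
      then have e: "int b - int (wv x) = int (2 * length x + 2 + i)" by simp
      show ?thesis
      proof (cases "i < m")
        case True
        obtain c where "c < 3" "P 0 (?p i) c" using start(5)[OF 6(1)] by blast
        then have "P 0 (?p i) 1 \<or> P 0 (?p i) 2"
          using before[OF True] by (cases "c = 0"; cases "c = 1"; cases "c = 2") auto
        then show ?thesis unfolding e ins(5) using True y 6 by auto
      next
        case False
        then show ?thesis unfolding e ins(5) using y after[of i] 6 by auto
      qed
    next
      case 7
      define i where "i = b - (wv x + 2 * length x + 2)"
      have i: "int b - int (wv x) = int (2 * length x + 2 + i)" "\<not> i < length y"
        using 7 m y(1) by (auto simp: i_def)
      show ?thesis unfolding i(1) ins(5) using i(2) start(8)[OF 7 b] by simp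
    qed
  qed
  have "holds x P ?T 0"
    unfolding holds_def cell_init
  proof (intro allI impI)
    fix j b assume j: "j < J" "\<bar>int b - int (wv x)\<bar> + int 0 + 1 \<le> int (wv x)"
    then have b: "b \<le> 2 * wv x" by linarith
    show "P 0 b (letter j (if j = 0 then inscription (pair_word x y) (int b - int (wv x)) else 0))"
      using tape0[OF b] start(9)[OF _ j(1) b] by (auto simp: letter_0)
  qed
  then have "holds x P (steps ?T t) t" if "t \<le> nv x" for t
    using that
  proof (induction t)
    case 0
    then show ?case by (simp add: steps_def)
  next
    case (Suc t)
    then show ?case unfolding steps_Suc by (intro holds_step[OF sat] cell_bound) auto
  qed
  from this[OF order_refl] have "holds x P (steps ?T (nv x)) (nv x)" .
  have "P (nv x) (wv x) (letter 1 (cell (steps ?T (nv x)) 1 (int (wv x) - int (wv x))))"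
  proof -
    have "\<bar>int (wv x) - int (wv x)\<bar> + int (nv x) + 1 \<le> int (wv x)" "1 < J"
      using J bounds(1)[of x] by simp_all
    then show ?thesis using \<open>holds x P (steps ?T (nv x)) (nv x)\<close> unfolding holds_def by blast
  qed
  moreover have "\<not> P (nv x) (wv x) (letter 1 1)"
    using satisfiedD[OF sat, of "fst final_schema" "snd final_schema" "nv x" "wv x"]
    by (auto simp: all_schemas_def final_schema_def eval_conj_exp eval_eq_exp eval_NWQ true_lit_def)
  \<comment> \<open>The symbol actually scanned is marked and, by \<open>final_schema\<close>,
    symbol 1 is not; so they differ.\<close>
  ultimately have "reads (steps ?T (nv x)) 1 \<noteq> 1" by (auto simp: cell_0)
  then show ?thesis using y(1) m by (intro exI[of _ y]) auto
qed

section \<open>From an accepted witness to a satisfying assignment\<close>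

lemma witness_imp_satisfied:
  assumes y: "length y \<le> qv x" and acc: "reads (steps (init_tapes (pair_word x y)) (nv x)) 1 \<noteq> 1"
  shows "\<exists>P. satisfied x P"
proof -
  let ?R = "steps (init_tapes (pair_word x y))"
  \<comment> \<open>The assignment marks the actual contents and nothing else; \<open>div\<close>
    and \<open>mod\<close> recover tape and symbol from a letter.\<close>
  define P where "P t b l \<longleftrightarrow> l mod S = cell (?R t) (l div S) (int b - int (wv x))" for t b l
  have P: "P t b (letter j c) \<longleftrightarrow> c = cell (?R t) j (int b - int (wv x))" if "c < S" for t b j c
    using that by (simp add: P_def letter_def)
  have P0: "P 0 b c \<longleftrightarrow> c = inscription (pair_word x y) (int b - int (wv x))" if "c < S" for b c
    using P[OF that, of 0 b 0] by (simp add: letter_0 steps_def cell_init)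
  note ins = inscription_pair_word[where x = x and y = y]
  have S3: "0 < S" "1 < S" "2 < S" using S by auto
  \<comment> \<open>A step clause whose \<tau> differs from the symbols scanned is true by its
    premise; this leaves only the clauses for the symbols actually scanned.\<close>
  have reading: "\<exists>l \<in> set (reading \<tau>). true_lit x P a b l"
    if \<tau>: "length \<tau> = J" "set \<tau> \<subseteq> {..<S}" and ne: "j < J" "\<tau> ! j \<noteq> reads (?R a) j" and a: "a \<le> nv x"
    for \<tau> j a b
  proof -
    have "\<not> P a (wv x) (letter j (\<tau> ! j))"
      using P[of "\<tau> ! j"] nth_bounded[OF \<tau> ne(1)] ne by (simp add: cell_0)
    then show ?thesis using ne(1) a
      by (intro bexI[of _ "(Var 8, W, letters + letter j (\<tau> ! j))"])
        (auto simp: true_lit_def reading_def eval_NWQ)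
  qed
  have "\<exists>l \<in> set ls. true_lit x P a b l"
    if a: "a \<le> nv x" and b: "b \<le> 2 * wv x" and gl: "(g, ls) \<in> set all_schemas"
      and g: "0 < eval x (place a b) g" for a b g ls
  proof -
    consider "(g, ls) \<in> set step_schemas" | "(g, ls) = final_schema" | "(g, ls) \<in> set start_schemas"
      | "(g, ls) \<in> set blank_schemas" using gl by (auto simp: all_schemas_def)
    then show ?thesis
    proof cases
      case 1
      have inner: "a < nv x \<and> 0 < b \<and> b < 2 * wv x" if "\<forall>e\<in>set inner. 0 < eval x (place a b) e"
        using that by (simp add: inner_def eval_less_exp eval_NWQ)
      from 1 show ?thesis
      proof (rule step_schemas_cases)
        fix \<tau> j assume *: "length \<tau> = J" "set \<tau> \<subseteq> {..<S}" "j < J" "(g, ls) = near_schema \<tau> j"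
        show ?thesis
        proof (cases "\<exists>i<J. \<tau> ! i \<noteq> reads (?R a) i")
          case True
          then show ?thesis using reading[OF *(1,2) _ _ a] *(4) by (auto simp: near_schema_def)
        next
          case False
          then have G: "G ((!) \<tau>) j = G (reads (?R a)) j" using *(3) by (intro G_local) auto
          let ?g = "G (reads (?R a)) j"
          have "0 < eval x (place a b) (conj_exp (eq_exp (Var 10) W # inner))"
            using g *(4) by (simp add: near_schema_def)
          then have gd: "b = wv x" "a < nv x" "0 < b" "b < 2 * wv x"
            using inner unfolding eval_conj_exp by (auto simp: eval_eq_exp eval_NWQ)
          have off: "\<bar>offset (snd ?g)\<bar> \<le> 1" by (cases "snd ?g") auto
          let ?e = "eval x (place a b) (source (snd ?g))"
          have e: "int ?e = int b - offset (snd ?g)" by (rule eval_source[OF gd(3)])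
          then have "?e \<le> 2 * wv x" using gd off by linarith
          moreover have c: "fst ?g < S"
            using cell_bound[of _ "pair_word x y" a 0] *(3) by (intro G_bound) (auto simp: cell_0)
          moreover have "P (Suc a) ?e (letter j (fst ?g))"
            unfolding P[OF c] steps_Suc cell_acts e using gd by simp
          ultimately have "true_lit x P a b (Add (Var 8) (Const 1), source (snd ?g), letter j (fst ?g))"
            using gd letter_less[OF *(3) c] by (simp add: true_lit_def)
          then show ?thesis using *(4) G by (auto simp: near_schema_def)
        qed
      next
        fix \<tau> j c assume *: "length \<tau> = J" "set \<tau> \<subseteq> {..<S}" "j < J" "c < S" "(g, ls) = far_schema \<tau> j c"
        show ?thesis
        proof (cases "\<exists>i<J. \<tau> ! i \<noteq> reads (?R a) i")
          case True
          then show ?thesis using reading[OF *(1,2) _ _ a] *(5) by (auto simp: far_schema_def)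
        next
          case False
          then have G: "G ((!) \<tau>) j = G (reads (?R a)) j" using *(3) by (intro G_local) auto
          let ?g = "G (reads (?R a)) j"
          have "0 < eval x (place a b) (conj_exp (not_exp (eq_exp (Var 10) W) # inner))"
            using g *(5) by (simp add: far_schema_def)
          then have gd: "b \<noteq> wv x" "a < nv x" "0 < b" "b < 2 * wv x"
            using inner unfolding eval_conj_exp by (auto simp: eval_eq_exp eval_not_exp eval_NWQ)
          show ?thesis
          proof (cases "c = cell (?R a) j (int b - int (wv x))")
            case True
            have off: "\<bar>offset (snd ?g)\<bar> \<le> 1" by (cases "snd ?g") auto
            let ?e = "eval x (place a b) (source (snd ?g))"
            have e: "int ?e = int b - offset (snd ?g)" by (rule eval_source[OF gd(3)])
            then have "?e \<le> 2 * wv x" using gd off by linarith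
            moreover have "P (Suc a) ?e (letter j c)"
              unfolding P[OF *(4)] steps_Suc cell_acts e using gd True by simp
            ultimately have "true_lit x P a b (Add (Var 8) (Const 1), source (snd ?g), letter j c)"
              using gd letter_less[OF *(3,4)] by (simp add: true_lit_def)
            then show ?thesis using *(5) G by (auto simp: far_schema_def)
          next
            case False
            then have "true_lit x P a b (Var 8, Var 10, letters + letter j c)"
              using P[OF *(4)] a b by (simp add: true_lit_def)
            then show ?thesis using *(5) by (auto simp: far_schema_def)
          qed
        qed
      qed
    next
      case 2
      then have "a = nv x" "b = wv x"
        using g by (auto simp: final_schema_def eval_conj_exp eval_eq_exp eval_NWQ)
      then have "true_lit x P a b (Var 8, Var 10, letters + letter 1 1)"
        using P[OF S3(2), of "nv x" "wv x" 1] acc by (simp add: true_lit_def cell_0)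
      then show ?thesis using 2 by (simp add: final_schema_def)
    next
      case 4
      then obtain j where j: "1 \<le> j" "j < J" "(g, ls) = (at_start (Const 1), [(Var 8, Var 10, letter j 0)])"
        by (auto simp: blank_schemas_def)
      then have "a = 0" using g by (simp add: at_start_def eval_conj_exp eval_eq_exp)
      then have "P a b (letter j 0)"
        using P[OF S3(1)] j by (simp add: steps_def cell_init)
      then show ?thesis using j a b letter_less[OF j(2) S3(1)] by (simp add: true_lit_def)
    next
      case 3
      have p: "eval x \<sigma> bit_pos = wv x + 2 * \<sigma> 10" "eval x \<sigma> tail_pos = wv x + (2 * length x + 2)" for \<sigma>
        by (simp_all add: bit_pos_def tail_pos_def eval_NWQ)
      obtain e where e: "g = at_start e" using 3 by (auto simp: start_schemas_def)
      have a0: "a = 0" and ge: "0 < eval x (place 0 b) e"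
        using g by (auto simp: e at_start_def eval_conj_exp eval_eq_exp)
      have lit: "true_lit x P 0 b (Var 8, eb, c)"
        if "eval x (place 0 b) eb = wv x + i" "wv x + i \<le> 2 * wv x" "c < 3"
          "c = inscription (pair_word x y) (int i)" for eb c i
        using that P0[of c] S small_letters less_le_trans[OF \<open>c < 3\<close> S] letter_less[of 0 c] J
        by (simp add: true_lit_def letter_0)
      note bd = bounds[of x]
      have bits: "true_lit x P 0 b (Var 8, bit_pos, if x ! b then 2 else 1)"
        "true_lit x P 0 b (Var 8, Add bit_pos (Const 1), if x ! b then 2 else 1)" if "b < length x"
        using that bd ins(1,2)[OF that]
        by (intro lit[of _ "2 * b"] lit[of _ "2 * b + 1"]; simp add: p)+
      have separator: "true_lit x P 0 b (Var 8, Add W (Mul (Const 2) Len), 1)"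
        "true_lit x P 0 b (Var 8, Add W (Add (Mul (Const 2) Len) (Const 1)), 2)"
        using bd ins(3,4)
        by (intro lit[of _ "2 * length x"] lit[of _ "2 * length x + 1"]; simp add: eval_NWQ)+
      have witness: "\<exists>c \<in> {0, 1, 2}. true_lit x P 0 b (Var 8, Add tail_pos (Var 10), c)" if "b < qv x"
      proof -
        let ?c = "inscription (pair_word x y) (int (2 * length x + 2 + b))"
        have c: "?c \<in> {0, 1, 2}" unfolding ins(5) by simp
        have "true_lit x P 0 b (Var 8, Add tail_pos (Var 10), ?c)"
          using bd that c by (intro lit[of _ "2 * length x + 2 + b"]) (auto simp: p)
        then show ?thesis using c by blast
      qed
      have mono: "true_lit x P 0 b (Var 8, Add tail_pos (Var 10), letters) \<or>
          true_lit x P 0 b (Var 8, Add tail_pos (Add (Var 10) (Const 1)), 0)" if q: "b + 1 < qv x"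
      proof (cases "b < length y")
        case True
        then have "\<not> P 0 (wv x + (2 * length x + 2 + b)) 0"
          using P0[OF S3(1), of "wv x + (2 * length x + 2 + b)"] ins(5)[of b] by simp
        then show ?thesis using bd q by (simp add: true_lit_def p add.assoc)
      next
        case False
        then have "true_lit x P 0 b (Var 8, Add tail_pos (Add (Var 10) (Const 1)), 0)"
          using bd q ins(5)[of "b + 1"]
          by (intro lit[of _ "2 * length x + 2 + (b + 1)"]) (auto simp: p)
        then show ?thesis by blast
      qed
      have left: "true_lit x P 0 b (Var 8, Var 10, 0)" if "b < wv x"
        using P0[OF S3(1), of b] ins(6)[of "int b - int (wv x)"] that small_letters
        by (simp add: true_lit_def)
      have right: "true_lit x P 0 b (Var 8, Var 10, 0)" if "wv x + (2 * length x + 2) + qv x \<le> b"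
      proof -
        define i where "i = b - (wv x + (2 * length x + 2))"
        have i: "b = wv x + (2 * length x + 2 + i)" "\<not> i < length y"
          using that y by (auto simp: i_def)
        show ?thesis using b i(2) ins(5)[of i] by (intro lit[of _ "2 * length x + 2 + i"]) (auto simp: i(1))
      qed
      have "(\<exists>l \<in> set ls. true_lit x P 0 b l)"
        using 3 ge bits separator witness mono left right unfolding e start_schemas_def
        by (auto simp: at_start_inj eval_conj_exp eval_less_exp eval_not_exp eval_NWQ p)
      then show ?thesis using a0 by simp
    qed
  qed
  then have "satisfied x P" unfolding satisfied_alt by blast
  then show ?thesis by blast
qed

theorem satisfiable_iff:
  "(\<exists>P. satisfied x P) \<longleftrightarrow>
     (\<exists>y. length y \<le> qv x \<and> reads (steps (init_tapes (pair_word x y)) (nv x)) 1 \<noteq> 1)"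
  using satisfied_imp_witness witness_imp_satisfied by blast

end

section \<open>Hardness\<close>

text \<open>
  The state of the machine becomes the symbol on the additional tape \<open>K\<close>, so that a step depends
  on the scanned symbols only.
\<close>

definition stateless :: "nat \<Rightarrow> machine \<Rightarrow> (nat \<Rightarrow> nat) \<Rightarrow> nat \<Rightarrow> nat \<times> direction" where
  "stateless K m s j =
     (if s K < states m then
        if j = K then (fst (trans m (s K) s), Stay) else snd (trans m (s K) s) j
      else (s j, Stay))"

lemma stateless_local:
  assumes "wf_m K S m" "\<And>i. i < Suc K \<Longrightarrow> s i = s' i" "j < Suc K"
  shows "stateless K m s j = stateless K m s' j"
proof (cases "s K < states m")
  case True
  then show ?thesis
    using assms(2)[of K] assms(3) wf_m_local[OF assms(1), of "s K" s s'] assms(2)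
    by (auto simp: stateless_def)
next
  case False
  then show ?thesis using assms(2)[of K] assms(2)[of j] assms(3) by (auto simp: stateless_def)
qed

lemma stateless_bound:
  assumes "wf_m K S m" "states m < S" "\<And>i. i < Suc K \<Longrightarrow> s i < S" "j < Suc K"
  shows "fst (stateless K m s j) < S"
proof (cases "s K < states m")
  case True
  have "fst (trans m (s K) s) \<le> states m" "\<And>i. i < K \<Longrightarrow> fst (snd (trans m (s K) s) i) < S"
    using wf_m_bound[OF assms(1) True, of s] assms(3) by auto
  then show ?thesis using True assms(2,4) by (auto simp: stateless_def less_Suc_eq)
next
  case False
  then show ?thesis using assms(3,4) by (auto simp: stateless_def)
qed

lemma stateless_exec:
  assumes wf: "wf_m K S m" and "exec m q U U' t" and "\<And>j. j < K \<Longrightarrow> T j = U j" "reads T K = q"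
  shows "\<exists>T'. ((\<lambda>T. acts T (stateless K m (reads T))) ^^ t) T = T' \<and>
    (\<forall>j<K. T' j = U' j) \<and> reads T' K = states m"
  using assms(2-)
proof (induction arbitrary: T rule: exec.induct)
  case (exec_step q U U' t)
  let ?T = "acts T (stateless K m (reads T))"
  have r: "reads T j = reads U j" if "j < K" for j using exec_step.prems(1)[OF that] by (simp add: reads_def)
  note l = wf_m_local[OF wf exec_step.hyps(1), of "reads T" "reads U", OF r]
  have "?T j = acts U (snd (trans m q (reads U))) j" if "j < K" for j
    using that exec_step.prems exec_step.hyps(1) l(2)[OF _ that] by (simp add: acts_def stateless_def)
  moreover have "reads ?T K = fst (trans m q (reads U))"
    using exec_step.prems(2) exec_step.hyps(1) l(1)
    by (simp add: acts_def stateless_def reads_def read_tape_def act_tape_def)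
  ultimately show ?case using exec_step.IH[of ?T] by (simp add: funpow_Suc_right del: funpow.simps)
qed auto

text \<open>Nothing changes after halting, so acceptance can be inspected at one time that is common
  to all witnesses.\<close>

lemma stateless_halted:
  assumes "reads T K = states m"
  shows "((\<lambda>T. acts T (stateless K m (reads T))) ^^ t) T = T"
proof (induction t)
  case (Suc t)
  have "stateless K m (reads T) = stay (reads T)" using assms by (auto simp: stateless_def)
  then have "acts T (stateless K m (reads T)) = T" by simp
  then show ?case using Suc by simp
qed simp

text \<open>The last conjunct is about arbitrary approximations rather than the optimum: whichever
  solution an algorithm returns, membership can be read off its zero pattern.\<close>

theorem NP_reduction:
  assumes "A \<in> class_NP"
  shows "\<exists>red :: bool list \<Rightarrow> msp. poly_time (\<lambda>x. enc_msp (red x)) \<and> (\<forall>x.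
    msp_instance (red x) \<and> num_modes (red x) = 1 \<and> (\<forall>e. weight (red x) e = 1) \<and>
    time_bound (red x) = None \<and> (\<exists>F L M. admissible (red x) F L M) \<and>
    (\<forall>\<alpha> F L M. is_approximation (red x) \<alpha> F L M \<longrightarrow> (x \<in> A \<longleftrightarrow>
       (\<forall>\<kappa>\<in>commodities (red x). \<forall>e\<in>edges (red x). F \<kappa> e = 0 \<or> M \<kappa> e 0 = 0))))"
proof -
  obtain R q where R: "R \<in> class_P"
    "\<And>x. x \<in> A \<longleftrightarrow> (\<exists>y. length y \<le> poly q (length x) \<and> pair_word x y \<in> R)"
    using assms by (auto simp: class_NP_def)
  obtain M p where M: "wf_tm M" "\<And>z. outputs_within M z [z \<in> R] (poly p (length z))"
    using R(1) by (auto simp: class_P_def)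
  define k where "k = num_tapes M"
  have k: "2 \<le> k" using M(1) by (simp add: k_def wf_tm_def)
  \<comment> \<open>Rewinding puts the head on the answer bit, so acceptance shows in the single
    cell that \<open>final_schema\<close> inspects. Tape \<open>k\<close> is the log; tape
    \<open>k + 1\<close> will carry the state.\<close>
  define m where "m = seq (lift k (\<lambda>i. i) k (of_tm M)) (rewind 1 k)"
  \<comment> \<open>Room for the symbols of \<open>M\<close>, the codes of the log and all states
    including the halting one.\<close>
  define S where "S = num_symbols M + states m + 4"
  have wf: "wf_m (Suc k) S m" unfolding m_def
    using k wf_of_tm[OF M(1), of S] by (intro wf_seq wf_lift wf_rewind) (auto simp: k_def S_def)
  define G where "G = stateless (Suc k) m"
  \<comment> \<open>\<open>[:2, 2:] + q\<close> bounds the length of the input paired with a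
    witness, and three times the running time plus 2 is the cost of the lifted and rewound
    machine.\<close>
  define r where "r = 3 * pcompose p ([:2, 2:] + q) + 2"
  obtain N where N: "ok_exp 0 N" "\<And>w \<sigma>. eval w \<sigma> N = poly r (length w)" using poly_exp by blast
  obtain Q where Q: "ok_exp 0 Q" "\<And>w \<sigma>. eval w \<sigma> Q = poly q (length w)" using poly_exp by blast
  define W where "W = Add N (Add (Const 3) (Add (Mul (Const 2) Len) Q))"
  interpret tableau "Suc (Suc k)" S G N W Q
  proof
    show "G s j = G s' j" if "\<And>i. i < Suc (Suc k) \<Longrightarrow> s i = s' i" "j < Suc (Suc k)" for s s' j
      unfolding G_def by (rule stateless_local[OF wf that])
    show "fst (G s j) < S" if "\<And>i. i < Suc (Suc k) \<Longrightarrow> s i < S" "j < Suc (Suc k)" for s j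
      unfolding G_def by (rule stateless_bound[OF wf _ that]) (simp add: S_def)
  qed (use N Q k in \<open>auto simp: W_def S_def\<close>)
  \<comment> \<open>The answer bit is coded by 1 for rejection and by 2 for acceptance.\<close>
  have accept: "reads (steps (init_tapes z) (nv x)) 1 \<noteq> 1 \<longleftrightarrow> z \<in> R"
    if z: "length z \<le> 2 * length x + 2 + poly q (length x)" for x z
  proof -
    have "\<exists>T'. runs m (init_tapes z) T' (3 * poly p (length z) + 2) \<and>
        T' 1 = (inscription [z \<in> R], 0) \<and>
        (\<forall>j. j \<noteq> k \<longrightarrow> j \<notin> (\<lambda>i. i) ` {..<num_tapes M} \<longrightarrow> T' j = init_tapes z j)"
      using lift_rewind[OF M(1) M(2)[of z], of "\<lambda>i. i" k "init_tapes z"] k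
      by (simp add: m_def k_def init_tapes_def)
    then obtain U where "runs m (init_tapes z) U (3 * poly p (length z) + 2)"
      and U1: "U 1 = (inscription [z \<in> R], 0)" by (elim exE conjE)
    then obtain t where U: "exec m 0 (init_tapes z) U t" "t \<le> 3 * poly p (length z) + 2"
      unfolding runs_def by (elim exE conjE)
    have "reads (init_tapes z) (Suc k) = 0"
      by (simp add: reads_def read_tape_def init_tapes_def inscription_def)
    from stateless_exec[OF wf U(1) refl this] obtain T
      where T: "((\<lambda>T. acts T (stateless (Suc k) m (reads T))) ^^ t) (init_tapes z) = T"
        "\<forall>j<Suc k. T j = U j" "reads T (Suc k) = states m" by (elim exE conjE)
    have "poly p (length z) \<le> poly p (2 * length x + 2 + poly q (length x))"
      using z by (rule poly_nat_mono)
    also have "\<dots> = poly p (poly ([:2, 2:] + q) (length x))"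
      by (rule arg_cong[where f = "poly p"]) simp
    also have "\<dots> = poly (pcompose p ([:2, 2:] + q)) (length x)" by (simp only: poly_pcompose)
    finally have "poly p (length z) \<le> poly (pcompose p ([:2, 2:] + q)) (length x)" .
    moreover have "nv x = 3 * poly (pcompose p ([:2, 2:] + q)) (length x) + 2"
    proof -
      have "nv x = poly r (length x)" by (simp only: nv_def N(2))
      also have "\<dots> = 3 * poly (pcompose p ([:2, 2:] + q)) (length x) + 2"
        by (simp only: r_def poly_add poly_mult poly_numeral)
      finally show ?thesis .
    qed
    ultimately have "t \<le> nv x" using U(2) by linarith
    then obtain d where d: "nv x = d + t" by (metis le_add_diff_inverse2)
    have "((\<lambda>T. acts T (stateless (Suc k) m (reads T))) ^^ nv x) (init_tapes z) = T"
      unfolding d funpow_add comp_apply T(1) by (rule stateless_halted[OF T(3)])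
    then have "steps (init_tapes z) (nv x) = T" unfolding steps_def unfolding G_def .
    then have "reads (steps (init_tapes z) (nv x)) 1 = inscription [z \<in> R] 0"
      using T(2) U1 k by (simp add: reads_def read_tape_def)
    then show ?thesis by (simp add: inscription_def)
  qed
  have "(\<exists>P. satisfied x P) \<longleftrightarrow> x \<in> A" for x
  proof -
    have "length y \<le> poly q (length x) \<and> reads (steps (init_tapes (pair_word x y)) (nv x)) 1 \<noteq> 1 \<longleftrightarrow>
        length y \<le> poly q (length x) \<and> pair_word x y \<in> R" for y
      using accept[of "pair_word x y" x] by (auto simp: length_pair_word)
    then show ?thesis unfolding satisfiable_iff R(2) by (simp add: qv_def Q(2))
  qed
  then have decides: "x \<in> A \<longleftrightarrow>
      (\<forall>\<kappa>\<in>commodities (msp_of x). \<forall>e\<in>edges (msp_of x). F \<kappa> e = 0 \<or> M \<kappa> e 0 = 0)"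
    if "is_approximation (msp_of x) \<alpha> F L M" for x \<alpha> F L M
    using approximation_decides[OF that] by simp
  show ?thesis
    by (rule exI[of _ "\<lambda>x. msp_of x"])
      (intro conjI allI impI poly_time_reduction msp_of_simps admissible_exists decides)
qed

text \<open>The approximation algorithm is specified on encodings of instances only and may return
  any approximation, so it is no function on words to which \<open>poly_time_comp\<close> would
  apply; the three machines are composed directly.\<close>

lemma approximable_imp_P_eq_NP:
  fixes \<alpha> :: "nat \<Rightarrow> rat"
  assumes "msp_approximable {I. msp_instance I \<and> num_modes I = 1 \<and>
      (\<forall>e \<in> edges I. weight I e = 1) \<and> time_bound I = None} \<alpha>"
  shows "class_P = class_NP"
proof
  show "class_P \<subseteq> class_NP" by (rule P_subset_NP)
  show "class_NP \<subseteq> class_P"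
  proof
    fix A assume "A \<in> class_NP"
    from NP_reduction[OF this] obtain red where r: "poly_time (\<lambda>x. enc_msp (red x))"
      "\<forall>x. msp_instance (red x) \<and> num_modes (red x) = 1 \<and> (\<forall>e. weight (red x) e = 1) \<and>
       time_bound (red x) = None \<and> (\<exists>F L M. admissible (red x) F L M) \<and>
       (\<forall>\<alpha> F L M. is_approximation (red x) \<alpha> F L M \<longrightarrow> (x \<in> A \<longleftrightarrow>
         (\<forall>\<kappa>\<in>commodities (red x). \<forall>e\<in>edges (red x). F \<kappa> e = 0 \<or> M \<kappa> e 0 = 0)))"
      by (elim exE conjE)
    note red = r(1) r(2)[THEN spec, THEN conjunct1]
      r(2)[THEN spec, THEN conjunct2, THEN conjunct1]
      r(2)[THEN spec, THEN conjunct2, THEN conjunct2, THEN conjunct1, THEN spec]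
      r(2)[THEN spec, THEN conjunct2, THEN conjunct2, THEN conjunct2, THEN conjunct1]
      r(2)[THEN spec, THEN conjunct2, THEN conjunct2, THEN conjunct2, THEN conjunct2, THEN conjunct1]
      r(2)[THEN spec, THEN conjunct2, THEN conjunct2, THEN conjunct2, THEN conjunct2, THEN conjunct2,
        rule_format]
    obtain M1 and p1 :: "nat poly" where M1: "wf_tm M1"
      "\<And>x. outputs_within M1 x (enc_msp (red x)) (poly p1 (length x))"
      using red(1) by (auto simp: poly_time_def)
    obtain M2 and p2 :: "nat poly" where M2: "wf_tm M2"
      "\<forall>I \<in> {I. msp_instance I \<and> num_modes I = 1 \<and> (\<forall>e \<in> edges I. weight I e = 1) \<and>
          time_bound I = None}. \<exists>out.
         outputs_within M2 (enc_msp I) out (poly p2 (length (enc_msp I))) \<and>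
         ((\<exists>F L M. admissible I F L M) \<longrightarrow>
            (\<exists>F L M. out = enc_solution I F L M \<and>
               is_approximation I (\<alpha> (card (vertices I)))
                 (\<lambda>\<kappa> e. of_rat (F \<kappa> e)) L (\<lambda>\<kappa> e i. of_rat (M \<kappa> e i))))"
      using assms unfolding msp_approximable_def by (elim exE conjE)
    obtain M3 and p3 :: "nat poly" where M3: "wf_tm M3"
      "\<And>x. outputs_within M3 x (zero_check x) (poly p3 (length x))"
      using poly_time_zero_check by (auto simp: poly_time_def)
    let ?t2 = "pcompose p2 p1"
    \<comment> \<open>The polynomial \<open>?t2\<close> bounds the running time of
      \<open>M2\<close>, and thereby the length of its output, which is the input of the zero
      test.\<close>
    let ?t = "3 * (3 * p1 + ?t2 + 2) + pcompose p3 ?t2 + 2"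
    have "outputs_within (comp_tm (comp_tm M1 M2) M3) x [x \<in> A] (poly ?t (length x))" for x
    proof -
      let ?I = "red x"
      have "?I \<in> {I. msp_instance I \<and> num_modes I = 1 \<and> (\<forall>e \<in> edges I. weight I e = 1) \<and>
          time_bound I = None}" using red(2-5) by simp
      from bspec[OF M2(2) this] red(6)[of x] obtain F L M
        where out: "outputs_within M2 (enc_msp ?I) (enc_solution ?I F L M)
          (poly p2 (length (enc_msp ?I)))"
        and apx: "is_approximation ?I (\<alpha> (card (vertices ?I)))
          (\<lambda>\<kappa> e. of_rat (F \<kappa> e)) L (\<lambda>\<kappa> e i. of_rat (M \<kappa> e i))"
        by (elim exE conjE) (metis (no_types, lifting))
      let ?out = "enc_solution ?I F L M"
      have "poly p2 (length (enc_msp ?I)) \<le> poly ?t2 (length x)"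
        using outputs_length[OF M1] by (simp add: poly_pcompose poly_nat_mono)
      then have o2: "outputs_within M2 (enc_msp ?I) ?out (poly ?t2 (length x))"
        using out outputs_within_mono by blast
      have "poly p3 (length ?out) \<le> poly (pcompose p3 ?t2) (length x)"
        using outputs_length[OF M2(1) o2] by (simp add: poly_pcompose poly_nat_mono)
      then have o3: "outputs_within M3 ?out (zero_check ?out) (poly (pcompose p3 ?t2) (length x))"
        using M3(2) outputs_within_mono by blast
      have "set (edge_list ?I) = edges ?I" "set (commodity_list ?I) = commodities ?I"
        using red(2)[of x]
        by (auto simp: edge_list_def commodity_list_def vertex_pairs_def msp_instance_def
            vertices_def commodities_def)
      \<comment> \<open>The test sees rationals and \<open>apx\<close> speaks of their real images;
        both have the same zeros.\<close>
      then have "zero_check ?out = [x \<in> A]"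
        using red(7)[OF apx] by (simp add: zero_check_solution)
      then show ?thesis
        using comp_tm_outputs[OF wf_comp_tm[OF M1(1) M2(1)] M3(1)
            comp_tm_outputs[OF M1(1) M2(1) M1(2) o2] o3]
        by simp
    qed
    moreover have "wf_tm (comp_tm (comp_tm M1 M2) M3)" by (intro wf_comp_tm M1(1) M2(1) M3(1))
    ultimately show "A \<in> class_P" unfolding class_P_def by blast
  qed
qed

lemma msp_approximable_mono:
  assumes "msp_approximable C \<alpha>" "D \<subseteq> C"
  shows "msp_approximable D \<alpha>"
proof -
  have "Ball C P \<Longrightarrow> Ball D P" for P using assms(2) by blast
  then show ?thesis using assms(1) unfolding msp_approximable_def by (elim exE conjE) (intro exI conjI)
qed

theorem theorem3p4:
  fixes \<alpha> :: "nat \<Rightarrow> rat"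
  assumes "polytime_computable \<alpha>"
    and "class_P \<noteq> class_NP"
  shows "\<not> msp_approximable {I. msp_instance I} \<alpha> \<and>
         \<not> msp_approximable
             {I. msp_instance I \<and> num_modes I = 1 \<and> (\<forall>e \<in> edges I. weight I e = 1) \<and>
                 time_bound I = None} \<alpha>"
proof -
  let ?C = "{I. msp_instance I \<and> num_modes I = 1 \<and> (\<forall>e \<in> edges I. weight I e = 1) \<and>
    time_bound I = None}"
  have "\<not> msp_approximable ?C \<alpha>" using approximable_imp_P_eq_NP[of \<alpha>] assms(2) by blast
  moreover have "msp_approximable ?C \<alpha>" if "msp_approximable {I. msp_instance I} \<alpha>"
    by (rule msp_approximable_mono[OF that]) blast
  ultimately show ?thesis by blast
qed

end
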